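(* Let $T>0$, $d,m\ge 1$, $H\in(\tfrac12,1)$, and let $W^H=(W^{H,1},\dots,W^{H,m})$ be an $m$-tuple of independent fractional Brownian motions with Hurst parameter $H$ defined on a complete probability space $(\Omega,\mathcal F,\mathbb P)$. Let $x(0)\in\mathbb R^d$ with $x^i(0)>0$ for $i=1,\dots,d$. Let $\sigma:[0,T]\times\mathbb R^d\to\mathbb R^{d\times m}$ and $b:[0,T]\times\mathbb R^d\to\mathbb R^d$ be bounded, and suppose there are constants $K_0$ and $\nu\ge H$ such that for all $x,y\in\mathbb R^d$ and all $s,t\in[0,T]$: $$|\sigma(t,x)-\sigma(t,y)|\le K_0|x-y|,\qquad |\sigma(t,x)-\sigma(s,x)|\le K_0|t-s|^{\nu},\qquad |b(t,x)-b(t,y)|\le K_0|x-y|.$$ Let $\lambda_0\in(\tfrac12,H)$. Then the stochastic differential equation with reflection $$X(t)=x(0)+\int_0^t b(s,X(s))\,ds+\int_0^t\sigma(s,X(s))\,dW^H_s+Y(t),\qquad t\in(0,T],$$ where $$Y^i(t)=\max_{s\in[0,t]}\big(Z^i(s)\big)^-\ (i=1,\dots,d),\qquad Z(t)=x(0)+\int_0^t b(s,X(s))\,ds+\int_0^t\sigma(s,X(s))\,dW^H_s,\qquad t\in[0,T],$$ admits a solution $X\in L^0\big(\Omega,\mathcal F,\mathbb P;C^{\lambda_0}(0,T;\mathbb R^d)\big)$.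
   Context: For $0<\lambda\le1$, $C^{\lambda}(s,t;\mathbb R^d)$ is the space of functions $f:[s,t]\to\mathbb R^d$ with $\|f\|_{\lambda,[s,t]}:=\sup_{s\le u<v\le t}\frac{|f(v)-f(u)|}{(v-u)^\lambda}<\infty$. For real $a$, $a^-=\max(-a,0)$. $L^0(\Omega,\mathcal F,\mathbb P;E)$ denotes the set of $E$-valued random variables. The integral with respect to $W^H$ is understood pathwise as a Young integral, i.e. the limit of Riemann–Stieltjes sums as the mesh tends to zero, which exists when the integrand is $\lambda$-Hölder and the integrator is $\gamma$-Hölder with $\lambda+\gamma>1$; almost surely, the paths of $W^H$ are $\gamma$-Hölder on $[0,T]$ for every $\gamma<H$. The equation is required to hold almost surely.
   Formalization: The drift b is additionally assumed Lebesgue measurable in t on [0,T] for each fixed x; without this the integral of b(s,X(s)) ds may be undefined, e.g. when b(t,x) is the indicator of a non-measurable set of times. *)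

theory Defs
  imports "HOL-Probability.Probability"
begin

section \<open>Fractional Brownian motion\<close>

text \<open>The zero variable is included, as the degenerate law \<open>N(0, 0)\<close> has no density.\<close>

definition centered_gaussian :: "'a measure \<Rightarrow> ('a \<Rightarrow> real) \<Rightarrow> bool" where
  "centered_gaussian M X \<longleftrightarrow>
     (\<exists>s>0. distributed M lborel X (normal_density 0 s)) \<or>
     (X \<in> borel_measurable M \<and> (AE \<omega> in M. X \<omega> = 0))"

definition centered_gaussian_process ::
  "'a measure \<Rightarrow> 'i set \<Rightarrow> ('i \<Rightarrow> 'a \<Rightarrow> real) \<Rightarrow> bool" where
  "centered_gaussian_process M I B \<longleftrightarrow>
     (\<forall>J c. finite J \<and> J \<subseteq> I \<longrightarrow> centered_gaussian M (\<lambda>\<omega>. \<Sum>t\<in>J. c t * B t \<omega>))"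

definition fractional_brownian_motion ::
  "'a measure \<Rightarrow> real set \<Rightarrow> real \<Rightarrow> (real \<Rightarrow> 'a \<Rightarrow> real) \<Rightarrow> bool" where
  "fractional_brownian_motion M I H B \<longleftrightarrow>
     centered_gaussian_process M I B \<and>
     (\<forall>s\<in>I. \<forall>t\<in>I. prob_space.expectation M (\<lambda>\<omega>. B s \<omega> * B t \<omega>) =
        (s powr (2 * H) + t powr (2 * H) - \<bar>t - s\<bar> powr (2 * H)) / 2) \<and>
     (AE \<omega> in M. continuous_on I (\<lambda>t. B t \<omega>))"

section \<open>Hoelder spaces\<close>

text \<open>A function on \<open>[a, b]\<close> is represented by its extension with the value
  \<open>undefined\<close> outside \<open>[a, b]\<close>, so that equality in the space is equality on \<open>[a, b]\<close>.
  The notions below are meant for \<open>a < b\<close>.\<close>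

definition holder_quotients ::
  "real \<Rightarrow> real \<Rightarrow> real \<Rightarrow> (real \<Rightarrow> 'b::real_normed_vector) \<Rightarrow> real set" where
  "holder_quotients l a b f =
     {norm (f v - f u) / (v - u) powr l | u v. a \<le> u \<and> u < v \<and> v \<le> b}"

definition holder_space ::
  "real \<Rightarrow> real \<Rightarrow> real \<Rightarrow> (real \<Rightarrow> 'b::real_normed_vector) set" where
  "holder_space l a b = {f \<in> extensional {a..b}. bdd_above (holder_quotients l a b f)}"

text \<open>The quotients only give a seminorm, vanishing on constants; adding the supremum norm
  yields the usual norm of \<open>C\<^sup>l\<close>.\<close>

definition holder_norm ::
  "real \<Rightarrow> real \<Rightarrow> real \<Rightarrow> (real \<Rightarrow> 'b::real_normed_vector) \<Rightarrow> real" where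
  "holder_norm l a b f = (SUP t\<in>{a..b}. norm (f t)) + Sup (holder_quotients l a b f)"

text \<open>The value off the space is irrelevant; it is 0 because \<^locale>\<open>Metric_space\<close>
  asks for a nonnegative function on the whole type.\<close>

definition holder_dist ::
  "real \<Rightarrow> real \<Rightarrow> real \<Rightarrow> (real \<Rightarrow> 'b) \<Rightarrow> (real \<Rightarrow> 'b::real_normed_vector) \<Rightarrow> real" where
  "holder_dist l a b f g =
     (if f \<in> holder_space l a b \<and> g \<in> holder_space l a b
      then holder_norm l a b (\<lambda>t. f t - g t) else 0)"

definition holder_borel ::
  "real \<Rightarrow> real \<Rightarrow> real \<Rightarrow> (real \<Rightarrow> 'b::real_normed_vector) measure" where
  "holder_borel l a b = sigma (holder_space l a b)
     {U. openin (Metric_space.mtopology (holder_space l a b) (holder_dist l a b)) U}"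

lemma holder_space_sup_bdd:
  fixes f :: "real \<Rightarrow> 'b::real_normed_vector"
  assumes "a < b" "0 < l" "bdd_above (holder_quotients l a b f)"
  shows "bdd_above ((\<lambda>t. norm (f t)) ` {a..b})"
proof -
  obtain K where K: "\<And>q. q \<in> holder_quotients l a b f \<Longrightarrow> q \<le> K"
    using assms(3) by (auto simp: bdd_above_def)
  have "norm (f t) \<le> norm (f a) + \<bar>K\<bar> * (b - a) powr l" if t: "t \<in> {a..b}" for t
  proof (cases "t = a")
    case False
    then have lt: "a < t" using t by auto
    have "norm (f t - f a) / (t - a) powr l \<le> K"
      using t lt by (intro K) (auto simp: holder_quotients_def)
    then have "norm (f t - f a) \<le> K * (t - a) powr l"
      using lt by (simp add: field_simps)
    also have "\<dots> \<le> \<bar>K\<bar> * (b - a) powr l"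
      using t lt assms(2) by (intro mult_mono powr_mono2) auto
    finally show ?thesis
      using norm_triangle_sub[of "f t" "f a"] by linarith
  qed simp
  then show ?thesis by (intro bdd_aboveI2)
qed

lemma holder_quotients_nonempty: "a < b \<Longrightarrow> holder_quotients l a b f \<noteq> {}"
  unfolding holder_quotients_def by blast

lemma holder_quotients_diff:
  fixes f g :: "real \<Rightarrow> 'b::real_normed_vector"
  assumes "a < b" "bdd_above (holder_quotients l a b f)" "bdd_above (holder_quotients l a b g)"
    and "q \<in> holder_quotients l a b (\<lambda>t. f t - g t)"
  shows "q \<le> Sup (holder_quotients l a b f) + Sup (holder_quotients l a b g)"
proof -
  obtain u v where uv: "a \<le> u" "u < v" "v \<le> b"
    and q: "q = norm ((f v - g v) - (f u - g u)) / (v - u) powr l"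
    using assms(4) by (auto simp: holder_quotients_def)
  have "(f v - g v) - (f u - g u) = (f v - f u) - (g v - g u)" by simp
  then have "q \<le> (norm (f v - f u) + norm (g v - g u)) / (v - u) powr l"
    unfolding q by (metis divide_right_mono norm_triangle_ineq4 powr_ge_zero)
  also have "\<dots> = norm (f v - f u) / (v - u) powr l + norm (g v - g u) / (v - u) powr l"
    by (simp add: add_divide_distrib)
  also have "\<dots> \<le> Sup (holder_quotients l a b f) + Sup (holder_quotients l a b g)"
    using uv assms(2,3) by (intro add_mono cSup_upper) (auto simp: holder_quotients_def)
  finally show ?thesis .
qed

lemma holder_quotients_diff_bdd:
  fixes f g :: "real \<Rightarrow> 'b::real_normed_vector"
  assumes "a < b" "bdd_above (holder_quotients l a b f)" "bdd_above (holder_quotients l a b g)"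
  shows "bdd_above (holder_quotients l a b (\<lambda>t. f t - g t))"
  using holder_quotients_diff[OF assms] unfolding bdd_above_def by blast

lemma holder_quotients_commute:
  "holder_quotients l a b (\<lambda>t. f t - g t) = holder_quotients l a b (\<lambda>t. g t - f t)"
proof -
  have "norm ((f v - g v) - (f u - g u)) = norm ((g v - f v) - (g u - f u))" for u v
    by (metis (no_types, lifting) minus_diff_eq minus_diff_minus norm_minus_cancel)
  then show ?thesis by (simp add: holder_quotients_def)
qed

lemma Metric_space_holder:
  assumes "a < b" "0 < l"
  shows "Metric_space (holder_space l a b :: (real \<Rightarrow> 'b::real_normed_vector) set)
           (holder_dist l a b)"
proof
  have Q0: "0 \<le> Sup (holder_quotients l a b h)"
    if "bdd_above (holder_quotients l a b h)" for h :: "real \<Rightarrow> 'b"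
  proof -
    obtain q where q: "q \<in> holder_quotients l a b h"
      using holder_quotients_nonempty[OF assms(1)] by blast
    then have "0 \<le> q" by (auto simp: holder_quotients_def)
    then show ?thesis using cSup_upper[OF q that] by linarith
  qed
  have S: "norm (h t) \<le> (SUP t\<in>{a..b}. norm (h t))"
    if "bdd_above (holder_quotients l a b h)" "t \<in> {a..b}" for h :: "real \<Rightarrow> 'b" and t
    using holder_space_sup_bdd[OF assms that(1)] that(2) by (rule cSUP_upper2) simp
  have S0: "0 \<le> (SUP t\<in>{a..b}. norm (h t))"
    if "bdd_above (holder_quotients l a b h)" for h :: "real \<Rightarrow> 'b"
  proof -
    have "norm (h a) \<le> (SUP t\<in>{a..b}. norm (h t))"
      using S[OF that, of a] assms(1) by simp
    then show ?thesis using norm_ge_zero[of "h a"] by linarith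
  qed
  have bdd: "bdd_above (holder_quotients l a b (\<lambda>t. f t - g t))"
    if "f \<in> holder_space l a b" "g \<in> holder_space l a b" for f g :: "real \<Rightarrow> 'b"
    using that by (intro holder_quotients_diff_bdd assms(1)) (simp_all add: holder_space_def)
  have Qc: "holder_quotients l a b (\<lambda>t. 0 :: 'b) = {0}"
    using holder_quotients_nonempty[OF assms(1), of l "\<lambda>t. 0 :: 'b"]
    by (auto simp: holder_quotients_def)
  show "0 \<le> holder_dist l a b f g" for f g :: "real \<Rightarrow> 'b"
  proof (cases "f \<in> holder_space l a b \<and> g \<in> holder_space l a b")
    case True
    then show ?thesis
      using Q0[OF bdd] S0[OF bdd] by (simp add: holder_dist_def holder_norm_def)
  next
    case False
    then show ?thesis by (auto simp: holder_dist_def)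
  qed
  show "holder_dist l a b f g = holder_dist l a b g f" for f g :: "real \<Rightarrow> 'b"
    by (simp add: holder_dist_def holder_norm_def norm_minus_commute
        holder_quotients_commute[of l a b f g])
  show "holder_dist l a b f g = 0 \<longleftrightarrow> f = g"
    if fg: "f \<in> holder_space l a b" "g \<in> holder_space l a b" for f g :: "real \<Rightarrow> 'b"
  proof
    assume "holder_dist l a b f g = 0"
    then have "(SUP t\<in>{a..b}. norm (f t - g t)) = 0"
      using Q0[OF bdd[OF fg]] S0[OF bdd[OF fg]] fg
      by (simp add: holder_dist_def holder_norm_def)
    then have "f t = g t" if "t \<in> {a..b}" for t
      using S[OF bdd[OF fg] that] by simp
    then show "f = g"
      using fg by (auto simp: holder_space_def intro: extensionalityI)
  next
    assume "f = g"
    then show "holder_dist l a b f g = 0"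
      using assms(1) fg by (simp add: holder_dist_def holder_norm_def Qc)
  qed
  show "holder_dist l a b f h \<le> holder_dist l a b f g + holder_dist l a b g h"
    if fgh: "f \<in> holder_space l a b" "g \<in> holder_space l a b" "h \<in> holder_space l a b"
    for f g h :: "real \<Rightarrow> 'b"
  proof -
    have "(SUP t\<in>{a..b}. norm (f t - h t)) \<le>
        (SUP t\<in>{a..b}. norm (f t - g t)) + (SUP t\<in>{a..b}. norm (g t - h t))"
    proof (rule cSUP_least)
      fix t assume t: "t \<in> {a..b}"
      have "norm (f t - h t) \<le> norm (f t - g t) + norm (g t - h t)"
        using norm_triangle_ineq[of "f t - g t" "g t - h t"] by simp
      then show "norm (f t - h t) \<le>
        (SUP t\<in>{a..b}. norm (f t - g t)) + (SUP t\<in>{a..b}. norm (g t - h t))"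
        using S[OF bdd[OF fgh(1,2)] t] S[OF bdd[OF fgh(2,3)] t] by linarith
    qed (use assms in auto)
    moreover have "Sup (holder_quotients l a b (\<lambda>t. f t - h t)) \<le>
        Sup (holder_quotients l a b (\<lambda>t. f t - g t)) + Sup (holder_quotients l a b (\<lambda>t. g t - h t))"
    proof (rule cSup_least)
      fix q assume "q \<in> holder_quotients l a b (\<lambda>t. f t - h t)"
      then have "q \<in> holder_quotients l a b (\<lambda>t. (f t - g t) - (h t - g t))" by simp
      from holder_quotients_diff[OF assms(1) bdd[OF fgh(1,2)] bdd[OF fgh(3,2)] this]
      show "q \<le> Sup (holder_quotients l a b (\<lambda>t. f t - g t)) +
          Sup (holder_quotients l a b (\<lambda>t. g t - h t))"
        by (simp add: holder_quotients_commute[of l a b h g])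
    qed (use holder_quotients_nonempty assms in blast)
    ultimately show ?thesis using fgh by (simp add: holder_dist_def holder_norm_def)
  qed
qed

section \<open>Young integral\<close>

text \<open>\<open>I\<close> is the limit of the Riemann--Stieltjes sums of \<open>f\<close> against \<open>g\<close> over tagged
  partitions of \<open>[a, b]\<close> with mesh tending to zero. Degenerate intervals, which the library
  admits in a tagged division, contribute nothing to the sum.\<close>

definition has_young_integral ::
  "(real \<Rightarrow> real) \<Rightarrow> (real \<Rightarrow> real) \<Rightarrow> real \<Rightarrow> real \<Rightarrow> real \<Rightarrow> bool" where
  "has_young_integral f g a b I \<longleftrightarrow>
     (\<forall>\<epsilon>>0. \<exists>\<delta>>0. \<forall>p. p tagged_division_of {a..b} \<and> (\<forall>(x, K)\<in>p. Sup K - Inf K < \<delta>) \<longrightarrow>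
        \<bar>(\<Sum>(x, K)\<in>p. f x * (g (Sup K) - g (Inf K))) - I\<bar> < \<epsilon>)"

definition young_integrable ::
  "(real \<Rightarrow> real) \<Rightarrow> (real \<Rightarrow> real) \<Rightarrow> real \<Rightarrow> real \<Rightarrow> bool" where
  "young_integrable f g a b \<longleftrightarrow> (\<exists>I. has_young_integral f g a b I)"

definition young_integral ::
  "(real \<Rightarrow> real) \<Rightarrow> (real \<Rightarrow> real) \<Rightarrow> real \<Rightarrow> real \<Rightarrow> real" where
  "young_integral f g a b = (THE I. has_young_integral f g a b I)"

lemma has_young_integral_unique:
  assumes "has_young_integral f g a b I" "has_young_integral f g a b J"
  shows "I = J"
proof (rule ccontr)
  assume "I \<noteq> J"
  then have e: "\<bar>I - J\<bar> / 2 > 0" by simp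
  obtain d1 where d1: "d1 > 0" "\<And>p. p tagged_division_of {a..b} \<Longrightarrow>
      \<forall>(x, K)\<in>p. Sup K - Inf K < d1 \<Longrightarrow>
      \<bar>(\<Sum>(x, K)\<in>p. f x * (g (Sup K) - g (Inf K))) - I\<bar> < \<bar>I - J\<bar> / 2"
    using assms(1) e unfolding has_young_integral_def by meson
  obtain d2 where d2: "d2 > 0" "\<And>p. p tagged_division_of {a..b} \<Longrightarrow>
      \<forall>(x, K)\<in>p. Sup K - Inf K < d2 \<Longrightarrow>
      \<bar>(\<Sum>(x, K)\<in>p. f x * (g (Sup K) - g (Inf K))) - J\<bar> < \<bar>I - J\<bar> / 2"
    using assms(2) e unfolding has_young_integral_def by meson
  define d where "d = min d1 d2 / 3"
  have d: "d > 0" using d1 d2 by (simp add: d_def)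
  obtain p where p: "p tagged_division_of cbox a b" "(\<lambda>x. ball x d) fine p"
    using fine_division_exists[OF gauge_ball[OF d], of a b] by blast
  have mesh: "Sup K - Inf K < min d1 d2" if xK: "(x, K) \<in> p" for x K
  proof -
    obtain u v where K: "K = cbox u v" using p(1) xK by (meson tagged_division_ofD(4))
    have "x \<in> K" using p(1) xK by (meson tagged_division_ofD(2))
    then have uv: "u \<le> v" using K by auto
    have "K \<subseteq> ball x d" using p(2) xK by (auto simp: fine_def)
    then have "u \<in> ball x d" "v \<in> ball x d" using K uv by auto
    then have "v - u < 2 * d" by (auto simp: dist_real_def)
    then show ?thesis using K uv d d1(1) d2(1) unfolding d_def by simp linarith
  qed
  have pt: "p tagged_division_of {a..b}" using p(1) by simp
  have "\<forall>(x, K)\<in>p. Sup K - Inf K < d1" "\<forall>(x, K)\<in>p. Sup K - Inf K < d2"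
    using mesh by fastforce+
  from d1(2)[OF pt this(1)] d2(2)[OF pt this(2)] show False
    using abs_triangle_ineq4[of "(\<Sum>(x, K)\<in>p. f x * (g (Sup K) - g (Inf K))) - J"
        "(\<Sum>(x, K)\<in>p. f x * (g (Sup K) - g (Inf K))) - I"] by simp
qed

lemma young_integral_eqI: "has_young_integral f g a b I \<Longrightarrow> young_integral f g a b = I"
  unfolding young_integral_def by (blast intro: has_young_integral_unique)

section \<open>The reflected equation\<close>

definition unreflected_path ::
  "(real \<Rightarrow> real^'d \<Rightarrow> real^'d) \<Rightarrow> (real \<Rightarrow> real^'d \<Rightarrow> real^'m^'d) \<Rightarrow> real^'d \<Rightarrow>
   ('m \<Rightarrow> real \<Rightarrow> real) \<Rightarrow> (real \<Rightarrow> real^'d) \<Rightarrow> real \<Rightarrow> real^'d" where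
  "unreflected_path b \<sigma> x0 w x t =
     x0 + (LINT s:{0..t}|lebesgue. b s (x s)) +
     (\<chi> i. \<Sum>j\<in>UNIV. young_integral (\<lambda>s. \<sigma> s (x s) $ i $ j) (w j) 0 t)"

definition neg_part :: "real \<Rightarrow> real" where
  "neg_part a = max (- a) 0"

definition is_maximum :: "real \<Rightarrow> real set \<Rightarrow> bool" where
  "is_maximum m A \<longleftrightarrow> m \<in> A \<and> (\<forall>a\<in>A. a \<le> m)"

definition solves_reflected_equation ::
  "real \<Rightarrow> (real \<Rightarrow> real^'d \<Rightarrow> real^'d) \<Rightarrow> (real \<Rightarrow> real^'d \<Rightarrow> real^'m^'d) \<Rightarrow> real^'d \<Rightarrow>
   ('m \<Rightarrow> real \<Rightarrow> real) \<Rightarrow> (real \<Rightarrow> real^'d) \<Rightarrow> bool" where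
  "solves_reflected_equation T b \<sigma> x0 w x \<longleftrightarrow>
     (\<forall>t\<in>{0..T}. set_integrable lebesgue {0..t} (\<lambda>s. b s (x s)) \<and>
        (\<forall>i j. young_integrable (\<lambda>s. \<sigma> s (x s) $ i $ j) (w j) 0 t)) \<and>
     (\<exists>z y. (\<forall>t\<in>{0..T}. z t = unreflected_path b \<sigma> x0 w x t) \<and>
        (\<forall>t\<in>{0..T}. \<forall>i. is_maximum (y t $ i) ((\<lambda>s. neg_part (z s $ i)) ` {0..t})) \<and>
        (\<forall>t\<in>{0<..T}. x t = z t + y t))"

end

theory Submission
  imports Defs
begin

text \<open>The Kolmogorov argument, applied to the even Gaussian moments of the increments, makes almost
  every path of the driver \<open>\<gamma>\<close>-Hoelder for some \<open>\<gamma>\<close> between \<open>lam\<close> and \<open>H\<close>. For such a path, the Euler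
  scheme on the grid \<open>T k / N\<close> satisfies a \<open>\<gamma>\<close>-Hoelder bound independent of \<open>N\<close>: the regulator
  oscillates no more than the unreflected path, and a discrete Young estimate controls the latter.
  Limits of subsequences of the scheme therefore exist, inherit the Young estimate, which
  identifies the limit of the sums as the Young integral, and solve the equation. As \<open>\<sigma>\<close> is only
  Lipschitz, uniqueness is not available, so the subsequence is chosen as a measurable function of
  \<open>\<omega>\<close> to keep the limit measurable. Finally, the paths are \<open>\<gamma>\<close>-Hoelder with \<open>\<gamma> > lam\<close>, hence lie in a
  separable part of the \<open>lam\<close>-Hoelder space, where pointwise measurability implies Borel
  measurability.\<close>

section \<open>Borel measurability in Hoelder spaces\<close>

text \<open>The a priori bound is circular, since the Hoelder constant of X is estimated through
  that of \<open>\<sigma>(s, X s)\<close>. Causality opens the circle: a left-point sum up to index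
  l reads X only before l, so the bound can be proved by induction on the length of the index
  interval. What remains is an inequality for one constant R, solvable because R enters its own
  bound with a power less than one.

  Reflection enters only through the oscillation of a single running maximum. Two running maxima are
  never compared in a Hoelder norm, which a contraction argument would have to do; this is why
  compactness is used.

  The state of the scheme keeps the drift integral, every entry of the matrix of stochastic
  integrals and the regulator apart, so that one convergent subsequence gives a limit for each of
  them, and each limit is identified on its own.

  After the moment estimate all analysis is done path by path; probability returns only as
  measurability in \<omega>. To let the selection run over all of the sample space, the driver is
  set to zero on the exceptional null set.\<close>

lemma holder_interpolation:
  fixes x y :: "'b::real_normed_vector"
  assumes "0 < lam" "lam < \<gamma>" and "norm x \<le> A" "norm y \<le> A"
    and hol: "norm (y - x) \<le> R * d powr \<gamma>" and R: "0 \<le> R"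
  shows "norm (y - x) \<le> (2 * A) powr (1 - lam / \<gamma>) * R powr (lam / \<gamma>) * d powr lam"
proof -
  define p where "p = lam / \<gamma>"
  have p: "0 < p" "p < 1" "\<gamma> * p = lam" using assms by (auto simp: p_def)
  have 1: "norm (y - x) \<le> 2 * A"
    using assms(3,4) norm_triangle_ineq4[of y x] by linarith
  \<comment> \<open>One factor is estimated by the size bound, the other by the Hoelder
    bound.\<close>
  have "norm (y - x) = norm (y - x) powr (1 - p) * norm (y - x) powr p"
    by (cases "norm (y - x) = 0") (auto simp flip: powr_add)
  also have "\<dots> \<le> (2 * A) powr (1 - p) * (R * d powr \<gamma>) powr p"
    using p 1 hol by (intro mult_mono powr_mono2) auto
  also have "(R * d powr \<gamma>) powr p = R powr p * d powr lam"
    using R p by (simp add: powr_mult powr_powr)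
  finally show ?thesis by (simp add: p_def mult.assoc)
qed

text \<open>The constant is carried explicitly, since approximants are chosen by comparing
  constants. The absolute value makes the condition symmetric, and extensionality is not
  imposed.\<close>

definition holder_const :: "real \<Rightarrow> real \<Rightarrow> real \<Rightarrow> (real \<Rightarrow> 'b::real_normed_vector) \<Rightarrow> bool" where
  "holder_const T \<gamma> R f \<longleftrightarrow>
     (\<forall>s\<in>{0..T}. \<forall>t\<in>{0..T}. norm (f t - f s) \<le> R * \<bar>t - s\<bar> powr \<gamma>)"

lemma holder_constD:
  "holder_const T \<gamma> R f \<Longrightarrow> s \<in> {0..T} \<Longrightarrow> t \<in> {0..T} \<Longrightarrow> norm (f t - f s) \<le> R * \<bar>t - s\<bar> powr \<gamma>"
  by (auto simp: holder_const_def)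

lemma holder_const_mono: "holder_const T \<gamma> R f \<Longrightarrow> R \<le> R' \<Longrightarrow> holder_const T \<gamma> R' f"
  unfolding holder_const_def by (meson mult_right_mono order_trans powr_ge_zero)

lemma holder_const_nonneg:
  assumes "holder_const T \<gamma> R f" "T > 0"
  shows "R \<ge> 0"
proof -
  have "0 \<le> R * T powr \<gamma>"
    using holder_constD[OF assms(1), of 0 T] assms(2) by (auto intro: order_trans[OF norm_ge_zero])
  then show ?thesis using assms(2) by (simp add: zero_le_mult_iff)
qed

lemma holder_const_imp_holder_space:
  assumes "holder_const T \<gamma> R f" "lam \<le> \<gamma>" "T > 0"
  shows "restrict f {0..T} \<in> holder_space lam 0 T"
proof -
  have R: "R \<ge> 0" using holder_const_nonneg assms by blast
  have "norm (f v - f u) / (v - u) powr lam \<le> R * T powr (\<gamma> - lam)"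
    if "0 \<le> u" "u < v" "v \<le> T" for u v
  proof -
    have "norm (f v - f u) \<le> R * (v - u) powr \<gamma>" using holder_constD[OF assms(1), of u v] that by auto
    also have "\<dots> = R * (v - u) powr (\<gamma> - lam) * (v - u) powr lam" by (simp flip: powr_add)
    also have "\<dots> \<le> R * T powr (\<gamma> - lam) * (v - u) powr lam"
      using that assms R by (intro mult_right_mono mult_left_mono powr_mono2) auto
    finally show ?thesis using that by (simp add: field_simps)
  qed
  then show ?thesis
    by (auto simp: holder_space_def holder_quotients_def bdd_above_def intro!: exI[of _ "R * T powr (\<gamma> - lam)"])
qed

text \<open>Interpolation for \<open>f - g\<close>, which has Hoelder constant \<open>2 * R\<close>
  and size at most \<open>A\<close>. As \<open>lam < \<gamma>\<close>, the bound tends to 0 with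
  \<open>A\<close> for fixed \<open>R\<close>.\<close>

lemma holder_dist_le:
  fixes f g :: "real \<Rightarrow> 'b::real_normed_vector"
  assumes f: "holder_const T \<gamma> R f" and g: "holder_const T \<gamma> R g"
    and mem: "f \<in> extensional {0..T}" "g \<in> extensional {0..T}"
    and T: "T > 0" and lam: "0 < lam" "lam < \<gamma>"
    and A: "\<And>t. t \<in> {0..T} \<Longrightarrow> norm (f t - g t) \<le> A" "A > 0"
  shows "holder_dist lam 0 T f g \<le> A + (2 * A) powr (1 - lam/\<gamma>) * (2 * R) powr (lam/\<gamma>)"
proof -
  have R: "R \<ge> 0" using holder_const_nonneg[OF f T] .
  have fg: "f \<in> holder_space lam 0 T" "g \<in> holder_space lam 0 T"
    using holder_const_imp_holder_space[OF f] holder_const_imp_holder_space[OF g] mem lam T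
    by (auto simp: extensional_restrict)
  have "(SUP t\<in>{0..T}. norm (f t - g t)) \<le> A"
    using T A by (intro cSUP_least) auto
  moreover have "Sup (holder_quotients lam 0 T (\<lambda>t. f t - g t)) \<le> (2 * A) powr (1 - lam/\<gamma>) * (2 * R) powr (lam/\<gamma>)"
  proof (rule cSup_least[OF holder_quotients_nonempty[OF T]])
    fix q assume "q \<in> holder_quotients lam 0 T (\<lambda>t. f t - g t)"
    then obtain u v where uv: "0 \<le> u" "u < v" "v \<le> T"
      and q: "q = norm ((f v - g v) - (f u - g u)) / (v - u) powr lam"
      by (auto simp: holder_quotients_def)
    have "(f v - g v) - (f u - g u) = (f v - f u) - (g v - g u)" by simp
    then have "norm ((f v - g v) - (f u - g u)) \<le> norm (f v - f u) + norm (g v - g u)"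
      by (metis norm_triangle_ineq4)
    also have "\<dots> \<le> 2 * R * (v - u) powr \<gamma>"
      using holder_constD[OF f, of u v] holder_constD[OF g, of u v] uv by auto
    finally have "norm ((f v - g v) - (f u - g u)) \<le> 2 * R * (v - u) powr \<gamma>" .
    then show "q \<le> (2 * A) powr (1 - lam/\<gamma>) * (2 * R) powr (lam/\<gamma>)"
      unfolding q using uv lam A R
        holder_interpolation[of lam \<gamma> "f u - g u" A "f v - g v" "2 * R" "v - u"]
      by (simp add: divide_le_eq)
  qed
  ultimately show ?thesis using fg by (simp add: holder_dist_def holder_norm_def)
qed

text \<open>Membership of the limit in an open set \<open>U\<close> is read off the approximants:
  for some \<open>m\<close> they eventually have a ball of radius 1/(m+1) around them inside
  \<open>U\<close>.\<close>

lemma measurable_holder_borel_of_limit: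
  fixes X :: "'a \<Rightarrow> real \<Rightarrow> 'b::real_normed_vector" and h :: "nat \<Rightarrow> 'c::countable \<Rightarrow> real \<Rightarrow> 'b"
  assumes T: "T > 0" "0 < lam"
    and X: "\<And>\<omega>. \<omega> \<in> space M \<Longrightarrow> X \<omega> \<in> holder_space lam 0 T"
    and h: "\<And>\<omega> n. \<omega> \<in> space M \<Longrightarrow> h n (c n \<omega>) \<in> holder_space lam 0 T"
    and c: "\<And>n. c n \<in> measurable M (count_space UNIV)"
    and lim: "\<And>\<omega>. \<omega> \<in> space M \<Longrightarrow> (\<lambda>n. holder_dist lam 0 T (X \<omega>) (h n (c n \<omega>))) \<longlonglongrightarrow> 0"
  shows "X \<in> measurable M (holder_borel lam 0 T)"
proof -
  interpret Metric_space "holder_space lam 0 T :: (real \<Rightarrow> 'b) set" "holder_dist lam 0 T"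
    by (rule Metric_space_holder) (use T in auto)
  let ?S = "holder_space lam 0 T :: (real \<Rightarrow> 'b) set"
  show ?thesis unfolding holder_borel_def
  proof (rule measurable_sigma_sets)
    show "sets (sigma ?S {U. openin mtopology U}) = sigma_sets ?S {U. openin mtopology U}"
      by (rule sets_measure_of) (use openin_subset[of mtopology] in auto)
    show "{U. openin mtopology U} \<subseteq> Pow ?S" by (use openin_subset[of mtopology] in auto)
    show "X \<in> space M \<rightarrow> ?S" using X by auto
    fix U assume "U \<in> {U. openin mtopology U}"
    then have U: "openin mtopology U" by simp
    define V where "V m = {x \<in> ?S. mball x (1 / real (Suc m)) \<subseteq> U}" for m
    have eq: "X \<omega> \<in> U \<longleftrightarrow> (\<exists>m. \<exists>n0. \<forall>n\<ge>n0. h n (c n \<omega>) \<in> V m)" if \<omega>: "\<omega> \<in> space M" for \<omega>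
    proof
      assume "X \<omega> \<in> U"
      then obtain r where r: "r > 0" "mball (X \<omega>) r \<subseteq> U"
        using U unfolding openin_mtopology by blast
      obtain m where m: "1 / real (Suc m) < r / 2"
        using nat_approx_posE[of "r/2"] r by auto
      have "eventually (\<lambda>n. holder_dist lam 0 T (X \<omega>) (h n (c n \<omega>)) < r / 2) sequentially"
        by (rule order_tendstoD(2)[OF lim[OF \<omega>]]) (use r in simp)
      then obtain n0 where n0: "\<And>n. n \<ge> n0 \<Longrightarrow> holder_dist lam 0 T (X \<omega>) (h n (c n \<omega>)) < r / 2"
        unfolding eventually_sequentially by blast
      have "h n (c n \<omega>) \<in> V m" if "n \<ge> n0" for n
      proof -
        have "mball (h n (c n \<omega>)) (1 / real (Suc m)) \<subseteq> mball (X \<omega>) r"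
        proof
          fix y assume y: "y \<in> mball (h n (c n \<omega>)) (1 / real (Suc m))"
          then have "holder_dist lam 0 T (X \<omega>) y \<le>
              holder_dist lam 0 T (X \<omega>) (h n (c n \<omega>)) + holder_dist lam 0 T (h n (c n \<omega>)) y"
            using X[OF \<omega>] by (intro triangle) auto
          also have "\<dots> < r" using n0[OF that] y m by (auto simp: mball_def)
          finally show "y \<in> mball (X \<omega>) r" using y X[OF \<omega>] by auto
        qed
        then show ?thesis using r(2) h[OF \<omega>] unfolding V_def by blast
      qed
      then show "\<exists>m. \<exists>n0. \<forall>n\<ge>n0. h n (c n \<omega>) \<in> V m" by blast
    next
      assume "\<exists>m. \<exists>n0. \<forall>n\<ge>n0. h n (c n \<omega>) \<in> V m"
      then obtain m n0 where n0: "\<And>n. n \<ge> n0 \<Longrightarrow> h n (c n \<omega>) \<in> V m" by blast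
      have "eventually (\<lambda>n. holder_dist lam 0 T (X \<omega>) (h n (c n \<omega>)) < 1 / real (Suc m)) sequentially"
        by (rule order_tendstoD(2)[OF lim[OF \<omega>]]) simp
      then have "eventually (\<lambda>n. holder_dist lam 0 T (X \<omega>) (h n (c n \<omega>)) < 1 / real (Suc m) \<and> n \<ge> n0) sequentially"
        using eventually_ge_at_top eventually_conj by blast
      then obtain n where n: "holder_dist lam 0 T (X \<omega>) (h n (c n \<omega>)) < 1 / real (Suc m)" "n \<ge> n0"
        using eventually_happens'[OF sequentially_bot] by blast
      then have "X \<omega> \<in> mball (h n (c n \<omega>)) (1 / real (Suc m))"
        using X[OF \<omega>] h[OF \<omega>] by (simp add: commute)
      then show "X \<omega> \<in> U" using n0[OF n(2)] unfolding V_def by blast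
    qed
    \<comment> \<open>\<open>V m\<close> may be any set, because the indices
      \<open>c n \<omega>\<close> carry the discrete sigma-algebra.\<close>
    have [measurable]: "Measurable.pred M (\<lambda>\<omega>. h n (c n \<omega>) \<in> V m)" for n m
      by (rule measurable_compose[OF c]) simp
    have "X -` U \<inter> space M = {\<omega> \<in> space M. \<exists>m. \<exists>n0. \<forall>n\<ge>n0. h n (c n \<omega>) \<in> V m}"
      using eq by blast
    also have "\<dots> \<in> sets M" by measurable
    finally show "X -` U \<inter> space M \<in> sets M" .
  qed
qed

text \<open>A path is approximated by a function chosen among those sharing its rounded values on a
  grid, with the least possible integer Hoelder constant, so that the approximants keep the Hoelder
  constant of the path while ranging over a countable set; interpolation turns uniform
  closeness into closeness in the weaker Hoelder norm.\<close>

lemma measurable_holder_borelI: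
  fixes X :: "'a \<Rightarrow> real \<Rightarrow> real^'d"
  assumes T: "T > 0" and lam: "0 < lam" "lam < \<gamma>"
    and Xm: "\<And>t. t \<in> {0..T} \<Longrightarrow> (\<lambda>\<omega>. X \<omega> t) \<in> borel_measurable M"
    and Xe: "\<And>\<omega>. \<omega> \<in> space M \<Longrightarrow> X \<omega> \<in> extensional {0..T}"
    and Xh: "\<And>\<omega>. \<omega> \<in> space M \<Longrightarrow> \<exists>R. holder_const T \<gamma> R (X \<omega>)"
  shows "X \<in> measurable M (holder_borel lam 0 T)"
proof -
  define g where "g n k = T * real k / real (Suc n)" for n k :: nat
  have g: "g n k \<in> {0..T}" if "k \<le> n" for n k
  proof -
    have "T * real k \<le> T * real (Suc n)" using that T by (intro mult_left_mono) auto
    then show ?thesis using T by (simp add: g_def divide_le_eq)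
  qed
  \<comment> \<open>Roundings are integer-valued functions on a finite type, so lists of them form a
    countable type.\<close>
  define rd where "rd n (x :: real^'d) = (\<lambda>i. \<lfloor>real (Suc n) * x $ i\<rfloor>)" for n x
  define rl where "rl n f = map (\<lambda>k. rd n (f (g n k))) [0..<Suc n]" for n and f :: "real \<Rightarrow> real^'d"
  define adm where "adm n c r f \<longleftrightarrow> f \<in> extensional {0..T} \<and> holder_const T \<gamma> (real r) f \<and> rl n f = c"
    for n c r f
  define h where "h n c = (SOME f. adm n c (LEAST r. \<exists>f. adm n c r f) f)" for n c
  have h: "h n (rl n (X \<omega>)) \<in> extensional {0..T}" "rl n (h n (rl n (X \<omega>))) = rl n (X \<omega>)"
      "holder_const T \<gamma> (real r) (h n (rl n (X \<omega>)))"
    if "\<omega> \<in> space M" "holder_const T \<gamma> (real r) (X \<omega>)" for n \<omega> r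
  proof -
    let ?c = "rl n (X \<omega>)"
    have a: "adm n ?c r (X \<omega>)" using that Xe by (simp add: adm_def)
    then have ex: "\<exists>r f. adm n ?c r f" by blast
    have "adm n ?c (LEAST r. \<exists>f. adm n ?c r f) (h n ?c)"
      unfolding h_def by (rule someI_ex[OF LeastI_ex[OF ex]])
    moreover have "(LEAST r. \<exists>f. adm n ?c r f) \<le> r"
      by (rule Least_le) (use a in blast)
    ultimately show "h n ?c \<in> extensional {0..T}" "rl n (h n ?c) = ?c" "holder_const T \<gamma> (real r) (h n ?c)"
      by (auto simp: adm_def intro: holder_const_mono)
  qed
  have nat_const: "\<exists>r. holder_const T \<gamma> (real r) (X \<omega>)" if "\<omega> \<in> space M" for \<omega>
    using Xh[OF that] holder_const_mono by (meson real_arch_simple)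
  show ?thesis
  proof (rule measurable_holder_borel_of_limit[where h=h and c="\<lambda>n \<omega>. rl n (X \<omega>)"])
    show "X \<omega> \<in> holder_space lam 0 T" if \<omega>: "\<omega> \<in> space M" for \<omega>
      using Xh[OF \<omega>] holder_const_imp_holder_space[of T \<gamma> _ "X \<omega>" lam] Xe[OF \<omega>] lam T
      by (auto simp: extensional_restrict)
    show "h n (rl n (X \<omega>)) \<in> holder_space lam 0 T" if \<omega>: "\<omega> \<in> space M" for \<omega> n
    proof -
      obtain r where "holder_const T \<gamma> (real r) (X \<omega>)" using nat_const[OF \<omega>] by blast
      from h[OF \<omega> this, of n] show ?thesis
        using holder_const_imp_holder_space[of T \<gamma> _ "h n (rl n (X \<omega>))" lam] lam T
        by (auto simp: extensional_restrict)
    qed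
    show "(\<lambda>\<omega>. rl n (X \<omega>)) \<in> measurable M (count_space UNIV)" for n
    proof (subst measurable_count_space_eq_countable, safe)
      fix c :: "('d \<Rightarrow> int) list"
      have "(\<lambda>\<omega>. rl n (X \<omega>)) -` {c} \<inter> space M =
          {\<omega> \<in> space M. length c = Suc n \<and> (\<forall>k\<in>{..n}. \<forall>i\<in>UNIV. \<lfloor>real (Suc n) * X \<omega> (g n k) $ i\<rfloor> = (c ! k) i)}"
        unfolding rl_def rd_def
        by (auto simp: list_eq_iff_nth_eq fun_eq_iff less_Suc_eq_le simp del: upt_Suc)
      moreover have "\<dots> \<in> sets M"
      proof (intro sets.sets_Collect_conj sets.sets_Collect_const sets.sets_Collect_finite_All)
        fix k i assume "k \<in> {..n}"
        then have "(\<lambda>\<omega>. X \<omega> (g n k)) \<in> borel_measurable M" using Xm[OF g] by simp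
        from measurable_compose[OF this borel_measurable_continuous_onI[of "\<lambda>x. x $ i"]]
        have [measurable]: "(\<lambda>\<omega>. X \<omega> (g n k) $ i) \<in> borel_measurable M"
          by (simp add: continuous_on_component)
        show "{\<omega> \<in> space M. \<lfloor>real (Suc n) * X \<omega> (g n k) $ i\<rfloor> = (c ! k) i} \<in> sets M"
          by measurable
      qed auto
      ultimately show "(\<lambda>\<omega>. rl n (X \<omega>)) -` {c} \<inter> space M \<in> sets M"
        by (simp only:)
    qed auto
    show "(\<lambda>n. holder_dist lam 0 T (X \<omega>) (h n (rl n (X \<omega>)))) \<longlonglongrightarrow> 0" if \<omega>: "\<omega> \<in> space M" for \<omega>
    proof -
      obtain r where r: "holder_const T \<gamma> (real r) (X \<omega>)" using nat_const[OF \<omega>] by blast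
      \<comment> \<open>The rounding error at a grid point summed over the coordinates, the
        oscillation of path and approximant between that point and \<open>t\<close>, and a term that
        only makes \<open>A n\<close> positive, as \<open>holder_dist_le\<close> requires.\<close>
      define A where "A n = real CARD('d) / real (Suc n) + 2 * real r * (T / real (Suc n)) powr \<gamma> + 1 / real (Suc n)" for n
      have Apos: "A n > 0" for n unfolding A_def using T by (intro add_nonneg_pos add_nonneg_nonneg) auto
      have close: "norm (X \<omega> t - h n (rl n (X \<omega>)) t) \<le> A n" if t: "t \<in> {0..T}" for n t
      proof -
        let ?h = "h n (rl n (X \<omega>))"
        \<comment> \<open>The grid ends at index \<open>n\<close>, one cell before \<open>T\<close>;
          the cap acts only at \<open>t = T\<close>, whose distance to the last grid point is still
          one cell.\<close>
        define k where "k = min n (nat \<lfloor>t * real (Suc n) / T\<rfloor>)"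
        have k: "k \<le> n" by (simp add: k_def)
        have kt: "\<bar>t - g n k\<bar> \<le> T / real (Suc n)"
        proof -
          define q where "q = t * real (Suc n) / T"
          have "t * real (Suc n) \<le> T * real (Suc n)" using t by (intro mult_right_mono) auto
          then have q: "0 \<le> q" "q \<le> real (Suc n)" using t T by (auto simp: q_def divide_le_eq mult.commute)
          have "\<bar>q - real k\<bar> \<le> 1"
            using q unfolding k_def q_def[symmetric] by (auto simp: min_def) linarith+
          moreover have "t - g n k = (q - real k) * (T / real (Suc n))"
            using T by (simp add: q_def g_def diff_divide_distrib left_diff_distrib del: of_nat_Suc)
          moreover have "0 \<le> T / real (Suc n)" using T by simp
          ultimately show ?thesis
            using mult_left_le_one_le[of "T / real (Suc n)" "\<bar>q - real k\<bar>"] T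
            by (simp add: abs_mult del: of_nat_Suc)
        qed
        have "norm (X \<omega> t - X \<omega> (g n k)) \<le> real r * \<bar>t - g n k\<bar> powr \<gamma>"
          using holder_constD[OF r g[OF k] t] .
        moreover have "norm (?h t - ?h (g n k)) \<le> real r * \<bar>t - g n k\<bar> powr \<gamma>"
          using holder_constD[OF h(3)[OF \<omega> r] g[OF k] t] .
        moreover have "real r * \<bar>t - g n k\<bar> powr \<gamma> \<le> real r * (T / real (Suc n)) powr \<gamma>"
          using kt lam by (intro mult_left_mono powr_mono2) auto
        moreover have "norm (X \<omega> (g n k) - ?h (g n k)) \<le> real CARD('d) / real (Suc n)"
        proof -
          have "rl n ?h ! k = rl n (X \<omega>) ! k" using h(2)[OF \<omega> r] by simp
          then have "rd n (?h (g n k)) = rd n (X \<omega> (g n k))"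
            using k by (simp add: rl_def less_Suc_eq_le del: upt_Suc)
          then have fl: "\<lfloor>real (Suc n) * ?h (g n k) $ i\<rfloor> = \<lfloor>real (Suc n) * X \<omega> (g n k) $ i\<rfloor>" for i
            unfolding rd_def by (rule fun_cong)
          have "\<bar>(X \<omega> (g n k) - ?h (g n k)) $ i\<bar> \<le> 1 / real (Suc n)" for i
          proof -
            have "\<bar>real (Suc n) * X \<omega> (g n k) $ i - real (Suc n) * ?h (g n k) $ i\<bar> \<le> 1"
              using floor_correct[of "real (Suc n) * X \<omega> (g n k) $ i"]
                floor_correct[of "real (Suc n) * ?h (g n k) $ i"] unfolding fl[of i] by linarith
            then have "real (Suc n) * \<bar>X \<omega> (g n k) $ i - ?h (g n k) $ i\<bar> \<le> 1"
              by (simp only: right_diff_distrib[symmetric] abs_mult abs_of_nat)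
            then show ?thesis by (simp add: pos_le_divide_eq mult.commute del: of_nat_Suc)
          qed
          then have "(\<Sum>i\<in>UNIV. \<bar>(X \<omega> (g n k) - ?h (g n k)) $ i\<bar>) \<le> (\<Sum>i\<in>(UNIV::'d set). 1 / real (Suc n))"
            by (intro sum_mono) auto
          then show ?thesis using norm_le_l1_cart[of "X \<omega> (g n k) - ?h (g n k)"] by simp
        qed
        moreover have "norm (X \<omega> t - ?h t) \<le> norm (X \<omega> t - X \<omega> (g n k)) +
            norm (X \<omega> (g n k) - ?h (g n k)) + norm (?h t - ?h (g n k))"
        proof -
          have "X \<omega> t - ?h t = (X \<omega> t - X \<omega> (g n k)) + (X \<omega> (g n k) - ?h (g n k)) - (?h t - ?h (g n k))"
            by simp
          then have "norm (X \<omega> t - ?h t) = norm ((X \<omega> t - X \<omega> (g n k)) + (X \<omega> (g n k) - ?h (g n k)) - (?h t - ?h (g n k)))"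
            by (rule arg_cong)
          then show ?thesis
            using norm_triangle_ineq4[of "(X \<omega> t - X \<omega> (g n k)) + (X \<omega> (g n k) - ?h (g n k))" "?h t - ?h (g n k)"]
              norm_triangle_ineq[of "X \<omega> t - X \<omega> (g n k)" "X \<omega> (g n k) - ?h (g n k)"]
            by linarith
        qed
        moreover have "0 \<le> 1 / real (Suc n)" by simp
        ultimately show ?thesis unfolding A_def by linarith
      qed
      define E where "E n = A n + (2 * A n) powr (1 - lam/\<gamma>) * (2 * real r) powr (lam/\<gamma>)" for n
      have hd: "holder_dist lam 0 T (X \<omega>) (h n (rl n (X \<omega>))) \<le> E n" for n
        unfolding E_def by (rule holder_dist_le[OF r h(3)[OF \<omega> r] Xe[OF \<omega>] h(1)[OF \<omega> r] T lam close Apos])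
      have inv: "(\<lambda>n. 1 / real (Suc n)) \<longlonglongrightarrow> 0" by (rule LIMSEQ_Suc[OF lim_1_over_n])
      have "(\<lambda>n. T / real (Suc n)) \<longlonglongrightarrow> 0"
        using tendsto_mult_left[OF inv, of T] by simp
      then have "(\<lambda>n. (T / real (Suc n)) powr \<gamma>) \<longlonglongrightarrow> 0 powr \<gamma>"
        using T lam by (intro tendsto_powr' tendsto_const) auto
      then have "A \<longlonglongrightarrow> real CARD('d) * 0 + 2 * real r * 0 + 0"
        unfolding A_def using lam inv tendsto_mult_left[OF inv, of "real CARD('d)"]
        by (intro tendsto_add tendsto_mult_left) auto
      then have A0: "A \<longlonglongrightarrow> 0" by simp
      have "(\<lambda>n. (2 * A n) powr (1 - lam/\<gamma>)) \<longlonglongrightarrow> (2 * 0) powr (1 - lam/\<gamma>)"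
        using lam Apos by (intro tendsto_powr' tendsto_mult tendsto_const A0) (auto simp: less_imp_le)
      then have "E \<longlonglongrightarrow> 0 + 0 * (2 * real r) powr (lam/\<gamma>)"
        unfolding E_def by (intro tendsto_add tendsto_mult tendsto_const A0) simp
      then have E0: "E \<longlonglongrightarrow> 0" by simp
      interpret Metric_space "holder_space lam 0 T :: (real \<Rightarrow> real^'d) set" "holder_dist lam 0 T"
        by (rule Metric_space_holder) (use T lam in auto)
      show ?thesis by (rule tendsto_sandwich[OF _ _ tendsto_const E0]) (use hd in auto)
    qed
  qed (use T lam in auto)
qed

section \<open>Measurable selection of a convergent subsequence\<close>

text \<open>Finitely many of the balls cover \<open>K\<close>, so by the pigeonhole principle one of
  them catches infinitely many indices of \<open>A\<close>.\<close>

lemma infinite_cover_ball: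
  fixes f :: "nat \<Rightarrow> 'b::metric_space"
  assumes "infinite A" "compact K" "\<And>n. f n \<in> K" "e > 0" "\<And>x. \<exists>j. dist (x::'b) (d j) < e"
  shows "\<exists>j::nat. infinite (A \<inter> {n. dist (f n) (d j) < e})"
proof -
  have "K \<subseteq> (\<Union>j. ball (d j) e)" using assms(5) by (auto simp: dist_commute)
  then obtain J where J: "finite J" "K \<subseteq> (\<Union>j\<in>J. ball (d j) e)"
    using compactE_image[OF assms(2), of UNIV "\<lambda>j. ball (d j) e"] by auto
  have "A \<subseteq> (\<Union>j\<in>J. A \<inter> {n. dist (f n) (d j) < e})"
  proof
    fix n assume "n \<in> A"
    moreover obtain j where "j \<in> J" "f n \<in> ball (d j) e" using J(2) assms(3)[of n] by blast
    ultimately show "n \<in> (\<Union>j\<in>J. A \<inter> {n. dist (f n) (d j) < e})" by (auto simp: dist_commute)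
  qed
  moreover have "infinite A" by (rule assms(1))
  ultimately have "\<not> (\<forall>j\<in>J. finite (A \<inter> {n. dist (f n) (d j) < e}))"
    using finite_UN_I[OF J(1), of "\<lambda>j. A \<inter> {n. dist (f n) (d j) < e}"] finite_subset[of A] by blast
  then show ?thesis by auto
qed

text \<open>At stage \<open>k\<close> one keeps the first ball of radius \<open>2\<^sup>-\<^sup>k\<close>, in a countable enumeration of centres,
  that contains infinitely many of the terms kept so far.\<close>

lemma measurable_convergent_subsequence:
  fixes f :: "nat \<Rightarrow> 'a \<Rightarrow> 'b::{metric_space, second_countable_topology}"
  assumes meas: "\<And>n. f n \<in> borel_measurable M"
    and cpt: "\<And>\<omega>. \<omega> \<in> space M \<Longrightarrow> \<exists>K. compact K \<and> (\<forall>n. f n \<omega> \<in> K)"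
  shows "\<exists>\<tau> :: nat \<Rightarrow> 'a \<Rightarrow> nat. (\<forall>k. \<tau> k \<in> measurable M (count_space UNIV)) \<and>
     (\<forall>\<omega>\<in>space M. strict_mono (\<lambda>k. \<tau> k \<omega>) \<and> convergent (\<lambda>k. f (\<tau> k \<omega>) \<omega>))"
proof -
  obtain D :: "'b set" where D: "countable D" "\<And>U. open U \<Longrightarrow> U \<noteq> {} \<Longrightarrow> \<exists>d\<in>D. d \<in> U"
    using countable_dense_exists by blast
  have "D \<noteq> {}" using D(2)[of UNIV] by auto
  define d where "d = from_nat_into D"
  have d: "\<exists>j. dist x (d j) < e" if "e > 0" for x e
  proof -
    have "ball x e \<noteq> {}" using that by simp
    from D(2)[OF open_ball this] obtain y where "y \<in> D" "y \<in> ball x e" by blast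
    moreover obtain j where "d j = y" unfolding d_def
      using from_nat_into_surj[OF D(1) \<open>y \<in> D\<close>] by blast
    ultimately show ?thesis by auto
  qed
  define e where "e k = (1/2::real) ^ k" for k :: nat
  have e: "e k > 0" for k by (simp add: e_def)
  define B where "B k \<omega> j = {n. dist (f n \<omega>) (d j) < e k}" for k \<omega> j
  define J where "J k A \<omega> = (LEAST j. infinite (A \<inter> B k \<omega> j))" for k A \<omega>
  define A where "A = rec_nat (\<lambda>\<omega>. UNIV) (\<lambda>k a \<omega>. a \<omega> \<inter> B k \<omega> (J k (a \<omega>) \<omega>))"
  have A0: "A 0 = (\<lambda>\<omega>. UNIV)" and AS: "A (Suc k) \<omega> = A k \<omega> \<inter> B k \<omega> (J k (A k \<omega>) \<omega>)" for k \<omega>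
    by (simp_all add: A_def)
  have Bm[measurable]: "Measurable.pred M (\<lambda>\<omega>. n \<in> B k \<omega> j)" for n k j
    unfolding B_def using meas[of n] by simp
  have Am: "Measurable.pred M (\<lambda>\<omega>. n \<in> A k \<omega>)" for n k
  proof (induction k arbitrary: n)
    case 0 then show ?case by (simp add: A0)
  next
    case (Suc k)
    note [measurable] = Suc
    \<comment> \<open>Infinitude of a set of naturals is a countable condition (arbitrarily large
      elements), so the least \<open>j\<close> satisfying it is measurable.\<close>
    have [measurable]: "(\<lambda>\<omega>. J k (A k \<omega>) \<omega>) \<in> measurable M (count_space UNIV)"
      unfolding J_def infinite_nat_iff_unbounded Int_iff by measurable
    have "Measurable.pred M (\<lambda>\<omega>. n \<in> B k \<omega> (J k (A k \<omega>) \<omega>))"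
      by (rule measurable_compose_countable[where f="\<lambda>j \<omega>. n \<in> B k \<omega> j"]) auto
    then show ?case unfolding AS Int_iff by measurable
  qed
  note [measurable] = Am
  have Ainf: "infinite (A k \<omega>)" if \<omega>: "\<omega> \<in> space M" for k \<omega>
  proof (induction k)
    case 0 then show ?case by (simp add: A0)
  next
    case (Suc k)
    obtain K where K: "compact K" "\<And>n. f n \<omega> \<in> K" using cpt[OF \<omega>] by blast
    have "\<exists>j. infinite (A k \<omega> \<inter> B k \<omega> j)"
      unfolding B_def by (rule infinite_cover_ball[OF Suc K e d[OF e]])
    then show ?case unfolding AS J_def by (rule LeastI_ex)
  qed
  have Adec: "A l \<omega> \<subseteq> A k \<omega>" if "k \<le> l" for k l \<omega>
    using that by (induction rule: dec_induct) (auto simp: AS)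
  \<comment> \<open>A diagonal choice; taking the least admissible index beyond the previous one
    keeps it measurable.\<close>
  define \<tau> where "\<tau> = rec_nat (\<lambda>\<omega>. 0) (\<lambda>k t \<omega>. LEAST n. n > t \<omega> \<and> n \<in> A (Suc k) \<omega>)"
  have \<tau>S: "\<tau> (Suc k) \<omega> = (LEAST n. n > \<tau> k \<omega> \<and> n \<in> A (Suc k) \<omega>)" for k \<omega>
    by (simp add: \<tau>_def)
  have \<tau>m: "\<tau> k \<in> measurable M (count_space UNIV)" for k
  proof (induction k)
    case 0 then show ?case by (simp add: \<tau>_def)
  next
    case (Suc k)
    note [measurable] = Suc
    show ?case unfolding \<tau>S by measurable
  qed
  have \<tau>1: "\<tau> (Suc k) \<omega> > \<tau> k \<omega> \<and> \<tau> (Suc k) \<omega> \<in> A (Suc k) \<omega>" if "\<omega> \<in> space M" for k \<omega>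
  proof -
    have "\<exists>n. n > \<tau> k \<omega> \<and> n \<in> A (Suc k) \<omega>"
      using Ainf[OF that, of "Suc k"] unfolding infinite_nat_iff_unbounded by blast
    from LeastI_ex[OF this] show ?thesis by (simp only: \<tau>S)
  qed
  have mono: "strict_mono (\<lambda>k. \<tau> k \<omega>)" if "\<omega> \<in> space M" for \<omega>
    using \<tau>1[OF that] by (simp add: strict_mono_Suc_iff)
  have conv: "convergent (\<lambda>k. f (\<tau> k \<omega>) \<omega>)" if \<omega>: "\<omega> \<in> space M" for \<omega>
  proof -
    obtain K where K: "compact K" "\<And>n. f n \<omega> \<in> K" using cpt[OF \<omega>] by blast
    \<comment> \<open>The centre depends on \<open>k\<close> alone, so all later terms are close to
      one common point.\<close>
    have near: "dist (f (\<tau> l \<omega>) \<omega>) (d (J k (A k \<omega>) \<omega>)) < e k" if "Suc k \<le> l" for k l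
    proof -
      obtain l' where "l = Suc l'" using \<open>Suc k \<le> l\<close> by (metis Suc_le_D)
      then have "\<tau> l \<omega> \<in> A l \<omega>" using \<tau>1[OF \<omega>, of l'] by simp
      then have "\<tau> l \<omega> \<in> A (Suc k) \<omega>" using Adec[OF that] by blast
      then show ?thesis unfolding AS B_def by simp
    qed
    have "Cauchy (\<lambda>k. f (\<tau> k \<omega>) \<omega>)"
    proof (rule metric_CauchyI)
      fix r :: real assume "r > 0"
      then obtain k where k: "e k < r / 2" unfolding e_def
        using real_arch_pow_inv[of "r/2" "1/2"] by auto
      have "dist (f (\<tau> m \<omega>) \<omega>) (f (\<tau> n \<omega>) \<omega>) < r" if "m \<ge> Suc k" "n \<ge> Suc k" for m n
        using near[OF that(1)] near[OF that(2)] k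
          dist_triangle2[of "f (\<tau> m \<omega>) \<omega>" "f (\<tau> n \<omega>) \<omega>" "d (J k (A k \<omega>) \<omega>)"] by linarith
      then show "\<exists>N. \<forall>m\<ge>N. \<forall>n\<ge>N. dist (f (\<tau> m \<omega>) \<omega>) (f (\<tau> n \<omega>) \<omega>) < r" by blast
    qed
    then show ?thesis
      using compact_imp_complete[OF K(1), unfolded complete_def, rule_format, of "\<lambda>k. f (\<tau> k \<omega>) \<omega>"] K(2)
      unfolding convergent_def by auto
  qed
  show ?thesis using \<tau>m mono conv by blast
qed

section \<open>Hoelder continuity of fractional Brownian paths\<close>

text \<open>The factor is the double factorial of 2p-1, the moment of order 2p of a standard normal
  variable. Expressing the scale by the second moment covers the degenerate law as well.\<close>

lemma (in prob_space) centered_gaussian_moment: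
  assumes "centered_gaussian M X"
  shows "X \<in> borel_measurable M"
    and "integrable M (\<lambda>\<omega>. X \<omega> ^ (2 * p))"
    and "p > 0 \<Longrightarrow> expectation (\<lambda>\<omega>. X \<omega> ^ (2 * p)) =
           fact (2 * p) / (2 ^ p * fact p) * expectation (\<lambda>\<omega>. (X \<omega>)\<^sup>2) ^ p"
proof -
  have "X \<in> borel_measurable M \<and> integrable M (\<lambda>\<omega>. X \<omega> ^ (2 * p)) \<and>
      (p > 0 \<longrightarrow> expectation (\<lambda>\<omega>. X \<omega> ^ (2 * p)) =
           fact (2 * p) / (2 ^ p * fact p) * expectation (\<lambda>\<omega>. (X \<omega>)\<^sup>2) ^ p)"
    using assms unfolding centered_gaussian_def
  proof (elim disjE exE conjE)
    fix s :: real assume s: "0 < s" and D: "distributed M lborel X (normal_density 0 s)"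
    have m: "expectation (\<lambda>\<omega>. X \<omega> ^ (2 * q)) = fact (2 * q) / ((2 / s\<^sup>2) ^ q * fact q)" for q
      using distributed_integral[OF D, of "\<lambda>x. x ^ (2 * q)"] integral_normal_moment_even[OF s, of 0 q]
      by simp
    have "integrable M (\<lambda>\<omega>. X \<omega> ^ (2 * p))"
      using distributed_integrable[OF D, of "\<lambda>x. x ^ (2 * p)"] integrable_normal_moment[OF s, of 0 "2 * p"]
      by simp
    moreover have "expectation (\<lambda>\<omega>. (X \<omega>)\<^sup>2) = s\<^sup>2"
      using m[of 1] by (simp add: fact_2)
    moreover have "X \<in> borel_measurable M" using distributed_measurable[OF D] by simp
    ultimately show ?thesis using s by (simp add: m power_divide)
  next
    assume X: "X \<in> borel_measurable M" and 0: "AE \<omega> in M. X \<omega> = 0"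
    have z: "AE \<omega> in M. X \<omega> ^ (2 * q) = 0" if "q > 0" for q using 0 that by auto
    have "expectation (\<lambda>\<omega>. X \<omega> ^ (2 * q)) = 0" if "q > 0" for q
      using integral_cong_AE[OF _ _ z[OF that]] X by simp
    from this[of p] this[of 1]
    have "p > 0 \<longrightarrow> expectation (\<lambda>\<omega>. X \<omega> ^ (2 * p)) =
           fact (2 * p) / (2 ^ p * fact p) * expectation (\<lambda>\<omega>. (X \<omega>)\<^sup>2) ^ p" by simp
    moreover have "integrable M (\<lambda>\<omega>. X \<omega> ^ (2 * p))"
    proof (cases "p = 0")
      case False
      then have "AE \<omega> in M. X \<omega> ^ (2 * p) = (\<lambda>\<omega>. 0) \<omega>" using z by simp
      from integrable_cong_AE[OF _ _ this] X show ?thesis by simp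
    qed simp
    ultimately show ?thesis using X by simp
  qed
  then show "X \<in> borel_measurable M" "integrable M (\<lambda>\<omega>. X \<omega> ^ (2 * p))"
    "p > 0 \<Longrightarrow> expectation (\<lambda>\<omega>. X \<omega> ^ (2 * p)) =
           fact (2 * p) / (2 ^ p * fact p) * expectation (\<lambda>\<omega>. (X \<omega>)\<^sup>2) ^ p" by auto
qed

lemma fbm_gaussian:
  assumes "fractional_brownian_motion M I H B"
  shows "t \<in> I \<Longrightarrow> centered_gaussian M (B t)"
    and "s \<in> I \<Longrightarrow> t \<in> I \<Longrightarrow> s \<noteq> t \<Longrightarrow> centered_gaussian M (\<lambda>\<omega>. B t \<omega> - B s \<omega>)"
proof -
  have *: "centered_gaussian M (\<lambda>\<omega>. \<Sum>t\<in>J. c t * B t \<omega>)" if "finite J" "J \<subseteq> I" for J c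
    using assms that unfolding fractional_brownian_motion_def centered_gaussian_process_def by blast
  show "centered_gaussian M (B t)" if "t \<in> I"
    using *[of "{t}" "\<lambda>_. 1"] that by simp
  \<comment> \<open>Linear combinations are indexed by sets of times, so the coefficients 1 and -1
    need two distinct times.\<close>
  show "centered_gaussian M (\<lambda>\<omega>. B t \<omega> - B s \<omega>)" if "s \<in> I" "t \<in> I" "s \<noteq> t"
    using *[of "{t, s}" "\<lambda>x. if x = t then 1 else -1"] that by (simp add: algebra_simps)
qed

lemma (in prob_space) fbm_increment_moment:
  assumes B: "fractional_brownian_motion M I H B" and st: "s \<in> I" "t \<in> I" "s \<noteq> t" and p: "p > 0"
  shows "expectation (\<lambda>\<omega>. (B t \<omega> - B s \<omega>) ^ (2 * p)) =
           fact (2 * p) / (2 ^ p * fact p) * \<bar>t - s\<bar> powr (2 * H * p)"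
    and "integrable M (\<lambda>\<omega>. (B t \<omega> - B s \<omega>) ^ (2 * p))"
proof -
  note G = fbm_gaussian(1)[OF B st(1)] fbm_gaussian(1)[OF B st(2)] fbm_gaussian(2)[OF B st]
  note I = centered_gaussian_moment(2)[OF G(1), of 1] centered_gaussian_moment(2)[OF G(2), of 1]
    centered_gaussian_moment(2)[OF G(3), of 1]
  have cov: "expectation (\<lambda>\<omega>. B u \<omega> * B v \<omega>) =
        (u powr (2 * H) + v powr (2 * H) - \<bar>v - u\<bar> powr (2 * H)) / 2" if "u \<in> I" "v \<in> I" for u v
    using B that unfolding fractional_brownian_motion_def by blast
  \<comment> \<open>Polarisation: the covariance determines the second moment of the
    increment.\<close>
  have "expectation (\<lambda>\<omega>. B s \<omega> * B t \<omega>) =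
      expectation (\<lambda>\<omega>. ((B s \<omega>)\<^sup>2 + (B t \<omega>)\<^sup>2 - (B t \<omega> - B s \<omega>)\<^sup>2) / 2)"
    by (rule Bochner_Integration.integral_cong) (auto simp: power2_eq_square algebra_simps)
  also have "\<dots> = (expectation (\<lambda>\<omega>. (B s \<omega>)\<^sup>2) + expectation (\<lambda>\<omega>. (B t \<omega>)\<^sup>2) - expectation (\<lambda>\<omega>. (B t \<omega> - B s \<omega>)\<^sup>2)) / 2"
    using I by simp
  finally have "expectation (\<lambda>\<omega>. (B t \<omega> - B s \<omega>)\<^sup>2) = \<bar>t - s\<bar> powr (2 * H)"
    using cov[of s s] cov[of t t] cov[of s t] st by (simp add: power2_eq_square field_simps)
  then show "expectation (\<lambda>\<omega>. (B t \<omega> - B s \<omega>) ^ (2 * p)) =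
           fact (2 * p) / (2 ^ p * fact p) * \<bar>t - s\<bar> powr (2 * H * p)"
    using centered_gaussian_moment(3)[OF G(3) p] st(3) by (simp add: powr_powr flip: powr_realpow)
  show "integrable M (\<lambda>\<omega>. (B t \<omega> - B s \<omega>) ^ (2 * p))"
    by (rule centered_gaussian_moment(2)[OF G(3)])
qed

text \<open>The deterministic half of the Kolmogorov argument, by chaining: each time is reached
  from its level-n dyadic point through ever finer increments, whose bounds form a geometric series,
  and continuity carries the estimate to the limit.\<close>

lemma dyadic_increments_imp_holder:
  fixes f :: "real \<Rightarrow> real"
  assumes T: "T > 0" and \<gamma>: "\<gamma> > 0" and C: "C \<ge> 0" and cont: "continuous_on {0..T} f"
    and inc: "\<And>n k. k < 2 ^ n \<Longrightarrow>
      \<bar>f (T * real (Suc k) / 2 ^ n) - f (T * real k / 2 ^ n)\<bar> \<le> C * (1 / 2 ^ n) powr \<gamma>"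
  shows "\<exists>R. holder_const T \<gamma> R f"
proof -
  define \<rho> where "\<rho> = (1 / 2 :: real) powr \<gamma>"
  have \<rho>: "0 < \<rho>" "\<rho> < 1" using \<gamma> powr_less_mono2[of \<gamma> "1/2" 1] by (auto simp: \<rho>_def)
  have \<rho>n: "(1 / 2 ^ n) powr \<gamma> = \<rho> ^ n" for n
  proof -
    have "1 / 2 ^ n = (1 / 2 :: real) powr real n" by (simp add: powr_realpow power_one_over)
    moreover have "\<rho> ^ n = \<rho> powr real n" using \<rho> by (simp add: powr_realpow)
    ultimately show ?thesis by (simp only: \<rho>_def powr_powr mult.commute)
  qed
  \<comment> \<open>\<open>d n t\<close> is the level-n dyadic point at or just below
    \<open>t\<close>. Passing to level n+1 leaves it in place or moves it by one increment of that
    level.\<close>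
  define i where "i n t = nat \<lfloor>2 ^ n * t / T\<rfloor>" for n and t :: real
  define d where "d n t = T * real (i n t) / 2 ^ n" for n t
  have ib: "real (i n t) \<le> 2 ^ n * t / T" "2 ^ n * t / T < real (i n t) + 1" if "t \<in> {0..T}" for n t
  proof -
    have "0 \<le> 2 ^ n * t / T" using that T by auto
    then show "real (i n t) \<le> 2 ^ n * t / T" "2 ^ n * t / T < real (i n t) + 1"
      unfolding i_def by linarith+
  qed
  have ile: "i n t \<le> 2 ^ n" if "t \<in> {0..T}" for n t
  proof -
    have "2 ^ n * t / T \<le> 2 ^ n" using that T by (simp add: divide_le_eq)
    with ib(1)[OF that, of n] have "real (i n t) \<le> 2 ^ n" by (rule order_trans)
    then show ?thesis by simp
  qed
  have din: "d n t \<in> {0..T}" if "t \<in> {0..T}" for n t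
  proof -
    have "real (i n t) \<le> 2 ^ n" using ile[OF that, of n] by simp
    then have "T * real (i n t) \<le> T * 2 ^ n" using T by simp
    then show ?thesis using T by (simp add: d_def divide_le_eq)
  qed
  have step: "\<bar>f (d (Suc n) t) - f (d n t)\<bar> \<le> C * \<rho> ^ Suc n" if t: "t \<in> {0..T}" for n t
  proof -
    have "real (i (Suc n) t) < 2 * (real (i n t) + 1)" "2 * real (i n t) < real (i (Suc n) t) + 1"
      using ib[OF t, of n] ib[OF t, of "Suc n"] by auto
    then have "real (i (Suc n) t) < real (2 * i n t + 2)" "real (2 * i n t) < real (i (Suc n) t + 1)" by simp_all
    then have "i (Suc n) t = 2 * i n t \<or> i (Suc n) t = Suc (2 * i n t)" unfolding of_nat_less_iff by linarith
    then show ?thesis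
    proof
      assume "i (Suc n) t = 2 * i n t"
      then have "d (Suc n) t = d n t" by (simp add: d_def)
      then show ?thesis using C \<rho> by simp
    next
      assume *: "i (Suc n) t = Suc (2 * i n t)"
      then have "2 * i n t < 2 ^ Suc n" using ile[OF t, of "Suc n"] by simp
      from inc[OF this] have "\<bar>f (d (Suc n) t) - f (T * real (2 * i n t) / 2 ^ Suc n)\<bar> \<le> C * \<rho> ^ Suc n"
        by (simp only: \<rho>n d_def *)
      moreover have "T * real (2 * i n t) / 2 ^ Suc n = d n t" by (simp add: d_def)
      ultimately show ?thesis by simp
    qed
  qed
  \<comment> \<open>The sum of the geometric series with ratio \<open>\<rho>\<close> and first term
    \<open>C\<close>.\<close>
  define K where "K = C / (1 - \<rho>)"
  have K: "K \<ge> 0" "C = K * (1 - \<rho>)" using C \<rho> by (auto simp: K_def)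
  \<comment> \<open>The factor \<open>1 - \<rho> ^ j\<close>, a partial sum, is what lets the
    induction close.\<close>
  have chain: "\<bar>f (d (n + j) t) - f (d n t)\<bar> \<le> K * \<rho> ^ n * (1 - \<rho> ^ j)" if t: "t \<in> {0..T}" for n j t
  proof (induction j)
    case (Suc j)
    have "\<bar>f (d (Suc (n + j)) t) - f (d n t)\<bar> \<le> C * \<rho> ^ Suc (n + j) + K * \<rho> ^ n * (1 - \<rho> ^ j)"
      using step[OF t, of "n + j"] Suc by linarith
    also have "C * \<rho> ^ Suc (n + j) \<le> C * \<rho> ^ (n + j)"
      using C \<rho> by (intro mult_left_mono power_decreasing) auto
    also have "C * \<rho> ^ (n + j) + K * \<rho> ^ n * (1 - \<rho> ^ j) = K * \<rho> ^ n * (1 - \<rho> ^ Suc j)"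
      unfolding K(2) by (simp add: power_add algebra_simps)
    finally show ?case by simp
  qed simp
  have approx: "\<bar>f t - f (d n t)\<bar> \<le> K * \<rho> ^ n" if t: "t \<in> {0..T}" for n t
  proof -
    have "(\<lambda>j. d (n + j) t) \<longlonglongrightarrow> t"
    proof (rule LIMSEQ_I)
      fix r :: real assume r: "r > 0"
      obtain N where N: "(1/2) ^ N < r / T" using real_arch_pow_inv[of "r/T" "1/2"] r T by auto
      have "norm (d (n + j) t - t) < r" if "j \<ge> N" for j
      proof -
        let ?m = "n + j"
        have "d ?m t - t = (real (i ?m t) - 2 ^ ?m * t / T) * (T / 2 ^ ?m)"
          using T by (simp add: d_def field_simps)
        moreover have "\<bar>real (i ?m t) - 2 ^ ?m * t / T\<bar> \<le> 1" using ib[OF t, of ?m] by linarith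
        ultimately have "\<bar>d ?m t - t\<bar> \<le> T / 2 ^ ?m"
          using T mult_right_mono[of "\<bar>real (i ?m t) - 2 ^ ?m * t / T\<bar>" 1 "T / 2 ^ ?m"] by (simp add: abs_mult)
        also have "\<dots> = T * (1/2) ^ ?m" by (simp add: power_one_over)
        also have "\<dots> \<le> T * (1/2) ^ N"
          using T that by (intro mult_left_mono power_decreasing) auto
        also have "\<dots> < r" using N unfolding pos_less_divide_eq[OF T] by (simp only: mult.commute)
        finally show ?thesis by simp
      qed
      then show "\<exists>N. \<forall>j\<ge>N. norm (d (n + j) t - t) < r" by blast
    qed
    then have "(\<lambda>j. f (d (n + j) t)) \<longlonglongrightarrow> f t"
      by (rule continuous_on_tendsto_compose[OF cont _ t]) (use din[OF t] in auto)
    then have "(\<lambda>j. \<bar>f (d (n + j) t) - f (d n t)\<bar>) \<longlonglongrightarrow> \<bar>f t - f (d n t)\<bar>"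
      by (intro tendsto_intros)
    moreover have "\<bar>f (d (n + j) t) - f (d n t)\<bar> \<le> K * \<rho> ^ n" for j
    proof -
      have "K * \<rho> ^ n * (1 - \<rho> ^ j) \<le> K * \<rho> ^ n * 1"
        using K \<rho> by (intro mult_left_mono) auto
      then show ?thesis using chain[OF t, of n j] by linarith
    qed
    ultimately show ?thesis by (intro LIMSEQ_le_const2) auto
  qed
  \<comment> \<open>Two chains and at most one increment between their starting points give
    \<open>2 * K + C\<close>; the other factor turns \<open>\<rho> ^ n\<close> into a power of
    \<open>t - s\<close>.\<close>
  define R where "R = (2 * K + C) * (2 / T) powr \<gamma>"
  have main: "\<bar>f t - f s\<bar> \<le> R * \<bar>t - s\<bar> powr \<gamma>" if st: "s \<in> {0..T}" "t \<in> {0..T}" "s < t" for s t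
  proof -
    define q where "q = (t - s) / T"
    have u: "0 < q" "q \<le> 1" using st T by (auto simp: q_def divide_le_eq)
    \<comment> \<open>At this level \<open>t - s\<close> lies between half a cell and a whole one,
      so the dyadic points below \<open>s\<close> and \<open>t\<close> coincide or are
      neighbours.\<close>
    define n where "n = (LEAST n. (1/2) ^ Suc n \<le> q)"
    have ex: "\<exists>n. (1/2) ^ Suc n \<le> q"
    proof -
      obtain n where "(1/2) ^ n < q" using real_arch_pow_inv[of q "1/2"] u by auto
      moreover have "(1/2 :: real) ^ Suc n \<le> (1/2) ^ n" by (rule power_decreasing) auto
      ultimately show ?thesis by (intro exI[of _ n]) linarith
    qed
    have n1: "(1/2) ^ Suc n \<le> q" unfolding n_def by (rule LeastI_ex[OF ex])
    have n2: "q \<le> (1/2) ^ n"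
    proof (cases n)
      case (Suc m)
      then have "m < (LEAST n. (1/2) ^ Suc n \<le> q)" unfolding n_def[symmetric] by simp
      from not_less_Least[OF this] show ?thesis using Suc by simp
    qed (use u in simp)
    have "2 ^ n * t / T - 2 ^ n * s / T = 2 ^ n * q" by (simp add: q_def diff_divide_distrib right_diff_distrib)
    also have "\<dots> \<le> 2 ^ n * (1/2) ^ n" by (intro mult_left_mono n2) auto
    also have "\<dots> = 1" by (simp add: power_one_over)
    finally have "real (i n t) < real (i n s) + 2" using ib[OF st(1), of n] ib[OF st(2), of n] by linarith
    moreover have "2 ^ n * s / T \<le> 2 ^ n * t / T" using st T by (intro divide_right_mono) auto
    then have "real (i n s) < real (i n t) + 1" using ib[OF st(1), of n] ib[OF st(2), of n] by linarith
    ultimately have "real (i n t) < real (i n s + 2)" "real (i n s) < real (i n t + 1)" by simp_all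
    then have "i n t = i n s \<or> i n t = Suc (i n s)" unfolding of_nat_less_iff by linarith
    then have mid: "\<bar>f (d n t) - f (d n s)\<bar> \<le> C * \<rho> ^ n"
    proof
      assume "i n t = i n s" then show ?thesis using C \<rho> by (simp add: d_def)
    next
      assume *: "i n t = Suc (i n s)"
      then have "i n s < 2 ^ n" using ile[OF st(2), of n] by simp
      from inc[OF this] show ?thesis by (simp add: \<rho>n d_def *)
    qed
    have "\<bar>f t - f s\<bar> \<le> (2 * K + C) * \<rho> ^ n"
      using approx[OF st(1), of n] approx[OF st(2), of n] mid by (simp add: algebra_simps)
    moreover have "\<rho> ^ n \<le> (2 / T) powr \<gamma> * (t - s) powr \<gamma>"
    proof -
      have "\<rho> ^ n = ((1/2) ^ n) powr \<gamma>" using \<rho>n[of n] by (simp add: power_one_over)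
      also have "\<dots> \<le> (2 * q) powr \<gamma>" using n1 \<gamma> by (intro powr_mono2) auto
      also have "\<dots> = (2 / T) powr \<gamma> * (t - s) powr \<gamma>" using T st by (simp add: q_def powr_mult[symmetric])
      finally show ?thesis .
    qed
    then have "(2 * K + C) * \<rho> ^ n \<le> (2 * K + C) * ((2 / T) powr \<gamma> * (t - s) powr \<gamma>)"
      using K(1) C by (intro mult_left_mono) auto
    ultimately show ?thesis using st(3) by (simp add: R_def mult.assoc)
  qed
  have "norm (f t - f s) \<le> R * \<bar>t - s\<bar> powr \<gamma>" if "s \<in> {0..T}" "t \<in> {0..T}" for s t
    using main[of s t] main[of t s] that by (cases s t rule: linorder_cases) (auto simp: abs_minus_commute)
  then show ?thesis unfolding holder_const_def by blast
qed

text \<open>The increments of all levels enter one weighted sum of finite expectation. Where it is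
  finite, its value bounds every single increment, so no coarse levels have to be set apart.\<close>

lemma (in prob_space) fbm_paths_holder:
  fixes B :: "real \<Rightarrow> 'a \<Rightarrow> real"
  assumes B: "fractional_brownian_motion M {0..T} H B" and T: "T > 0" and \<gamma>: "0 < \<gamma>" "\<gamma> < H"
  shows "AE \<omega> in M. \<exists>R. holder_const T \<gamma> R (\<lambda>t. B t \<omega>)"
proof -
  \<comment> \<open>The order of the moment must make 2p(H-\<gamma>) exceed 1, to beat the 2^n
    increments at level n.\<close>
  obtain p :: nat where p: "1 / (2 * (H - \<gamma>)) < real p" using reals_Archimedean2 by blast
  have "0 < 1 / (2 * (H - \<gamma>))" using \<gamma> by simp
  with p have p0: "p > 0" by (metis less_trans of_nat_0_less_iff)
  have p1: "2 * real p * (H - \<gamma>) > 1" using p \<gamma> by (simp add: divide_less_eq mult.commute mult.left_commute)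
  define g where "g n k = T * real k / 2 ^ n" for n k :: nat
  have g: "g n k \<in> {0..T}" if "k \<le> 2 ^ n" for n k
  proof -
    have "real k \<le> 2 ^ n" using that by simp
    then have "T * real k \<le> T * 2 ^ n" using T by simp
    then show ?thesis using T by (simp add: g_def divide_le_eq)
  qed
  have gd: "g n (Suc k) - g n k = T / 2 ^ n" for n k
    by (simp add: g_def field_simps)
  define c where "c = fact (2 * p) / (2 ^ p * fact p) * T powr (2 * H * p)"
  define D where "D n k \<omega> = (2 ^ n) powr (2 * \<gamma> * p) * (B (g n (Suc k)) \<omega> - B (g n k) \<omega>) ^ (2 * p)" for n k \<omega>
  \<comment> \<open>The ratio between levels: weight and moment contribute 2^(-2p(H-\<gamma>)), the
    doubled number of increments gives a factor 2 back.\<close>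
  define \<theta> where "\<theta> = (1 / 2 :: real) powr (2 * real p * (H - \<gamma>) - 1)"
  have \<theta>: "0 < \<theta>" "\<theta> < 1" using p1 powr_less_mono2[of "2 * real p * (H - \<gamma>) - 1" "1/2" 1] by (auto simp: \<theta>_def)
  have D0: "D n k \<omega> \<ge> 0" for n k \<omega> by (simp add: D_def)
  have Dm: "D n k \<in> borel_measurable M" and Di: "integrable M (D n k)"
    and De: "expectation (D n k) = (2 ^ n) powr (2 * \<gamma> * p) * (fact (2 * p) / (2 ^ p * fact p) * (T / 2 ^ n) powr (2 * H * p))"
    if "k < 2 ^ n" for n k
  proof -
    have in': "g n k \<in> {0..T}" "g n (Suc k) \<in> {0..T}" using that by (auto intro!: g simp del: atLeastAtMost_iff)
    have ne: "g n k \<noteq> g n (Suc k)" using gd[of n k] T by auto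
    note m = fbm_increment_moment[OF B in' ne p0]
    show I: "integrable M (D n k)" unfolding D_def using m(2) by simp
    then show "D n k \<in> borel_measurable M" by simp
    show "expectation (D n k) = (2 ^ n) powr (2 * \<gamma> * p) * (fact (2 * p) / (2 ^ p * fact p) * (T / 2 ^ n) powr (2 * H * p))"
      unfolding D_def using m(1) T by (simp add: gd)
  qed
  have pow: "2 ^ n * ((2 ^ n) powr (2 * \<gamma> * p) * (fact (2 * p) / (2 ^ p * fact p) * (T / 2 ^ n) powr (2 * H * p))) = c * \<theta> ^ n" for n :: nat
  proof -
    define N where "N = (2::real) ^ n"
    have N: "N = 2 powr real n" "N > 0" by (simp_all add: N_def powr_realpow)
    have \<theta>2: "\<theta> = 2 powr (- (2 * real p * (H - \<gamma>) - 1))" unfolding \<theta>_def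
      by (simp only: powr_minus_divide powr_divide) simp
    have "\<theta> ^ n = \<theta> powr real n" using \<theta> by (simp add: powr_realpow)
    also have "\<dots> = 2 powr (real n - 2 * real p * (H - \<gamma>) * real n)"
      unfolding \<theta>2 powr_powr by (simp add: algebra_simps)
    also have "\<dots> = 2 powr (real n + 2 * \<gamma> * p * real n - 2 * H * p * real n)"
      by (simp add: algebra_simps)
    also have "\<dots> = N * N powr (2 * \<gamma> * p) / N powr (2 * H * p)"
      by (simp add: N(1) powr_powr powr_add powr_diff mult.commute)
    finally have "\<theta> ^ n = N * N powr (2 * \<gamma> * p) / N powr (2 * H * p)" .
    then show ?thesis
      using T N(2) unfolding N_def[symmetric] by (simp add: c_def powr_divide)
  qed
  define S where "S \<omega> = (\<Sum>n. \<Sum>k<2 ^ n. ennreal (D n k \<omega>))" for \<omega>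
  have Sm: "(\<lambda>\<omega>. \<Sum>k<2 ^ n. ennreal (D n k \<omega>)) \<in> borel_measurable M" for n
    using Dm by (intro borel_measurable_sum measurable_compose[OF _ measurable_ennreal]) auto
  have "(\<integral>\<^sup>+\<omega>. S \<omega> \<partial>M) = (\<Sum>n. \<integral>\<^sup>+\<omega>. (\<Sum>k<2 ^ n. ennreal (D n k \<omega>)) \<partial>M)"
    unfolding S_def by (rule nn_integral_suminf[OF Sm])
  also have "\<dots> = (\<Sum>n. ennreal (c * \<theta> ^ n))"
  proof (rule arg_cong[where f=suminf], rule ext)
    fix n
    have "(\<integral>\<^sup>+\<omega>. (\<Sum>k<2 ^ n. ennreal (D n k \<omega>)) \<partial>M) = (\<Sum>k<2 ^ n. \<integral>\<^sup>+\<omega>. ennreal (D n k \<omega>) \<partial>M)"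
      using Dm by (intro nn_integral_sum measurable_compose[OF _ measurable_ennreal]) auto
    also have "\<dots> = (\<Sum>k<(2::nat) ^ n. ennreal ((2 ^ n) powr (2 * \<gamma> * p) * (fact (2 * p) / (2 ^ p * fact p) * (T / 2 ^ n) powr (2 * H * p))))"
      using Di De D0 by (intro sum.cong refl) (subst nn_integral_eq_integral, auto)
    also have "\<dots> = ennreal (c * \<theta> ^ n)"
      unfolding pow[symmetric] using T by (subst sum_ennreal) auto
    finally show "(\<integral>\<^sup>+\<omega>. (\<Sum>k<2 ^ n. ennreal (D n k \<omega>)) \<partial>M) = ennreal (c * \<theta> ^ n)" .
  qed
  also have "\<dots> = ennreal (\<Sum>n. c * \<theta> ^ n)"
    using \<theta> T by (intro suminf_ennreal2 summable_mult summable_geometric) (auto simp: c_def)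
  finally have "(\<integral>\<^sup>+\<omega>. S \<omega> \<partial>M) \<noteq> \<infinity>" by simp
  moreover have "S \<in> borel_measurable M"
    unfolding S_def using Sm by (rule borel_measurable_suminf_order)
  ultimately have fin: "AE \<omega> in M. S \<omega> \<noteq> \<infinity>" by (intro nn_integral_PInf_AE) auto
  have cont: "AE \<omega> in M. continuous_on {0..T} (\<lambda>t. B t \<omega>)"
    using B unfolding fractional_brownian_motion_def by blast
  from fin cont show ?thesis
  proof eventually_elim
    case (elim \<omega>)
    define s where "s = enn2real (S \<omega>)"
    have s: "S \<omega> = ennreal s" "s \<ge> 0" using elim by (auto simp: s_def less_top)
    have Ds: "D n k \<omega> \<le> s" if "k < 2 ^ n" for n k
    proof -
      have "ennreal (D n k \<omega>) \<le> (\<Sum>k<2 ^ n. ennreal (D n k \<omega>))"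
        using that by (intro member_le_sum) auto
      also have "\<dots> \<le> S \<omega>" unfolding S_def
        using sum_le_suminf[of "\<lambda>n. \<Sum>k<2 ^ n. ennreal (D n k \<omega>)" "{n}"] by simp
      finally show ?thesis unfolding s(1) using s(2) by simp
    qed
    show ?case
    proof (rule dyadic_increments_imp_holder[OF T \<gamma>(1) _ elim(2), of "s powr (1 / (2 * p))"])
      fix n k :: nat assume k: "k < 2 ^ n"
      define x where "x = \<bar>B (g n (Suc k)) \<omega> - B (g n k) \<omega>\<bar>"
      have x: "x \<ge> 0" by (simp add: x_def)
      have "(2 ^ n) powr (2 * \<gamma> * p) * x ^ (2 * p) \<le> s"
        using Ds[OF k] unfolding D_def x_def by (simp add: power_mult)
      moreover have "x ^ (2 * p) = x powr (2 * p)"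
        using x p0 powr_realpow[of x "2 * p"] by (cases "x = 0") simp_all
      ultimately have "((2 ^ n) powr (2 * \<gamma> * p) * x powr (2 * p)) powr (1 / (2 * p)) \<le> s powr (1 / (2 * p))"
        by (intro powr_mono2) auto
      then have "(2 ^ n) powr \<gamma> * x \<le> s powr (1 / (2 * p))"
        using p0 x by (simp add: powr_mult powr_powr)
      then have "x \<le> s powr (1 / (2 * p)) * (1 / 2 ^ n) powr \<gamma>"
        by (simp add: powr_divide field_simps)
      then show "\<bar>B (T * real (Suc k) / 2 ^ n) \<omega> - B (T * real k / 2 ^ n) \<omega>\<bar> \<le> s powr (1 / (2 * p)) * (1 / 2 ^ n) powr \<gamma>"
        unfolding x_def g_def .
    qed simp
  qed
qed

section \<open>Young's estimate\<close>

text \<open>The proof bisects the interval. The induction hypothesis uses \<open>l - k - 1\<close> instead of \<open>l - k\<close>,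
  because this length is at most halved for both parts even when \<open>l - k\<close> is odd.\<close>

lemma discrete_young:
  fixes f w :: "nat \<Rightarrow> real"
  assumes ex: "0 \<le> \<alpha>" "0 \<le> \<gamma>" "1 < \<alpha> + \<gamma>" "\<alpha> + \<gamma> \<le> 2" and FG: "0 \<le> F" "0 \<le> G" and "k \<le> l"
    and f: "\<And>p q. k \<le> p \<Longrightarrow> p \<le> q \<Longrightarrow> q < l \<Longrightarrow> \<bar>f q - f p\<bar> \<le> F * real (q - p) powr \<alpha>"
    and w: "\<And>p q. k \<le> p \<Longrightarrow> p \<le> q \<Longrightarrow> q \<le> l \<Longrightarrow> \<bar>w q - w p\<bar> \<le> G * real (q - p) powr \<gamma>"
  shows "\<bar>(\<Sum>p=k..<l. f p * (w (Suc p) - w p)) - f k * (w l - w k)\<bar>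
     \<le> 4 / (1 - 2 powr (1 - (\<alpha> + \<gamma>))) * F * G * real (l - k) powr (\<alpha> + \<gamma>)"
proof -
  define \<theta> where "\<theta> = \<alpha> + \<gamma>"
  \<comment> \<open>The solution of \<open>c * 2 powr (1 - \<theta>) + 4 = c\<close>: the two halves
    account for the first term, the defect of the split for the 4.\<close>
  define c where "c = 4 / (1 - (2::real) powr (1 - \<theta>))"
  have \<theta>: "1 < \<theta>" "\<theta> \<le> 2" using ex by (auto simp: \<theta>_def)
  have r: "(2::real) powr (1 - \<theta>) < 1" using \<theta> by (simp add: powr_less_one)
  then have "1 - (2::real) powr (1 - \<theta>) \<noteq> 0" by linarith
  from nonzero_eq_divide_eq[OF this] have "c * (1 - 2 powr (1 - \<theta>)) = 4" using c_def by blast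
  then have "c * 2 powr (1 - \<theta>) + 4 = c" by (simp add: algebra_simps)
  moreover have "c > 0" using r by (simp add: c_def)
  ultimately have c: "c > 0" "c * 2 powr (1 - \<theta>) + 4 = c" by auto
  have cFG: "0 \<le> c * (F * G)" using c(1) FG by simp
  define E where "E k l = (\<Sum>p=k..<l. f p * (w (Suc p) - w p)) - f k * (w l - w k)" for k l :: nat
  have main: "\<bar>E a b\<bar> \<le> c * (F * G) * real (b - a - 1) powr \<theta>" if "k \<le> a" "a \<le> b" "b \<le> l" for a b
    using that
  proof (induction "b - a" arbitrary: a b rule: less_induct)
    case less
    define n where "n = b - a"
    show ?case
    proof (cases "n \<le> 1")
      case True
      then have "b = a \<or> b = Suc a" using less.prems n_def by linarith
      then show ?thesis using c FG by (auto simp: E_def)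
    next
      case False
      define m where "m = a + n div 2"
      have m: "a < m" "m < b" "k \<le> m" "m \<le> l" "m - a = n div 2" "b - m = n - n div 2"
        using False less.prems by (auto simp: m_def n_def)
      \<comment> \<open>Bisection changes the one-step approximation only by a product of
        increments, of \<open>f\<close> over the left part and of \<open>w\<close> over the right
        part.\<close>
      have E: "E a b = E a m + E m b + (f m - f a) * (w b - w m)"
        using sum.atLeastLessThan_concat[of a m b "\<lambda>p. f p * (w (Suc p) - w p)"] m
        by (simp add: E_def algebra_simps)
      have half: "real (j - 1) powr \<theta> \<le> real (n - 1) powr \<theta> * 2 powr (- \<theta>)" if "j = n div 2 \<or> j = n - n div 2" for j
      proof -
        have "2 * (j - 1) \<le> n - 1" using that by auto
        then have "real (2 * (j - 1)) \<le> real (n - 1)" by (rule of_nat_mono)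
        then have "real (j - 1) powr \<theta> \<le> (real (n - 1) / 2) powr \<theta>" using \<theta> by (intro powr_mono2) auto
        also have "\<dots> = real (n - 1) powr \<theta> * 2 powr (- \<theta>)" by (simp add: powr_divide powr_minus_divide)
        finally show ?thesis .
      qed
      have "\<bar>E a m\<bar> \<le> c * (F * G) * real (m - a - 1) powr \<theta>" using less m by (intro less.hyps) auto
      also have "\<dots> \<le> c * (F * G) * (real (n - 1) powr \<theta> * 2 powr (- \<theta>))"
        by (intro mult_left_mono half cFG) (use m in simp)
      finally have 1: "\<bar>E a m\<bar> \<le> c * (F * G) * (real (n - 1) powr \<theta> * 2 powr (- \<theta>))" .
      have "\<bar>E m b\<bar> \<le> c * (F * G) * real (b - m - 1) powr \<theta>" using less m by (intro less.hyps) auto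
      also have "\<dots> \<le> c * (F * G) * (real (n - 1) powr \<theta> * 2 powr (- \<theta>))"
        by (intro mult_left_mono half cFG) (use m in simp)
      finally have 2: "\<bar>E m b\<bar> \<le> c * (F * G) * (real (n - 1) powr \<theta> * 2 powr (- \<theta>))" .
      have "\<bar>(f m - f a) * (w b - w m)\<bar> \<le> (F * real (m - a) powr \<alpha>) * (G * real (b - m) powr \<gamma>)"
        unfolding abs_mult
      proof (rule mult_mono)
        show "\<bar>f m - f a\<bar> \<le> F * real (m - a) powr \<alpha>" using less.prems m by (intro f) auto
        show "\<bar>w b - w m\<bar> \<le> G * real (b - m) powr \<gamma>" using less.prems m by (intro w) auto
      qed (use FG in auto)
      also have "\<dots> \<le> (F * real n powr \<alpha>) * (G * real n powr \<gamma>)"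
      proof (rule mult_mono)
        show "F * real (m - a) powr \<alpha> \<le> F * real n powr \<alpha>"
          using ex FG m(5) by (intro mult_left_mono powr_mono2) auto
        show "G * real (b - m) powr \<gamma> \<le> G * real n powr \<gamma>"
          using ex FG m(6) by (intro mult_left_mono powr_mono2) auto
      qed (use FG in auto)
      also have "\<dots> = F * G * real n powr \<theta>" by (simp add: \<theta>_def powr_add)
      \<comment> \<open>Here \<open>n \<ge> 2\<close> gives \<open>n \<le> 2 * (n - 1)\<close>, and
        \<open>\<theta> \<le> 2\<close> bounds the resulting factor by 4.\<close>
      also have "\<dots> \<le> F * G * (4 * real (n - 1) powr \<theta>)"
      proof (rule mult_left_mono)
        have "real n powr \<theta> \<le> (2 * real (n - 1)) powr \<theta>" using False \<theta> by (intro powr_mono2) auto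
        also have "\<dots> = 2 powr \<theta> * real (n - 1) powr \<theta>" by (rule powr_mult)
        also have "\<dots> \<le> 2 powr 2 * real (n - 1) powr \<theta>"
          using \<theta> by (intro mult_right_mono powr_mono) auto
        finally show "real n powr \<theta> \<le> 4 * real (n - 1) powr \<theta>" by simp
      qed (use FG in simp)
      finally have 3: "\<bar>(f m - f a) * (w b - w m)\<bar> \<le> F * G * (4 * real (n - 1) powr \<theta>)" .
      have "\<bar>E a b\<bar> \<le> 2 * (c * (F * G) * (real (n - 1) powr \<theta> * 2 powr (- \<theta>))) + F * G * (4 * real (n - 1) powr \<theta>)"
      proof -
        have "\<bar>E a b\<bar> \<le> \<bar>E a m\<bar> + \<bar>E m b\<bar> + \<bar>(f m - f a) * (w b - w m)\<bar>"
          unfolding E by (intro order_trans[OF abs_triangle_ineq] add_mono abs_triangle_ineq order_refl)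
        also have "\<dots> \<le> c * (F * G) * (real (n - 1) powr \<theta> * 2 powr (- \<theta>)) +
            c * (F * G) * (real (n - 1) powr \<theta> * 2 powr (- \<theta>)) + F * G * (4 * real (n - 1) powr \<theta>)"
          by (intro add_mono 1 2 3)
        finally show ?thesis by (simp only: mult_2)
      qed
      also have "\<dots> = (c * 2 powr (1 - \<theta>) + 4) * (F * G) * real (n - 1) powr \<theta>"
      proof -
        have "(2::real) powr (1 - \<theta>) = 2 * 2 powr (- \<theta>)" by (simp add: powr_diff powr_minus_divide)
        then show ?thesis by (simp only: ring_distribs mult_ac)
      qed
      finally show ?thesis unfolding c(2) n_def by simp
    qed
  qed
  have "\<bar>E k l\<bar> \<le> c * (F * G) * real (l - k - 1) powr \<theta>" using main[of k l] \<open>k \<le> l\<close> by simp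
  also have "\<dots> \<le> c * (F * G) * real (l - k) powr \<theta>"
    using c FG \<theta> by (intro mult_left_mono powr_mono2) auto
  finally show ?thesis by (simp add: E_def c_def \<theta>_def mult.assoc)
qed

text \<open>\<open>J\<close> is a candidate for the indefinite integral. Its increments telescope
  over a tagged division, and local errors of order \<open>\<theta> > 1\<close> add up to a multiple
  of \<open>\<delta> powr (\<theta> - 1)\<close>. The local estimate must hold for every tag
  \<open>x\<close>, not only for the left end.\<close>

lemma has_young_integralI:
  assumes ab: "a \<le> b" and \<theta>: "1 < \<theta>" and C: "0 \<le> C"
    and J: "\<And>u x v. a \<le> u \<Longrightarrow> u \<le> x \<Longrightarrow> x \<le> v \<Longrightarrow> v \<le> b \<Longrightarrow>
      \<bar>f x * (g v - g u) - (J v - J u)\<bar> \<le> C * (v - u) powr \<theta>"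
  shows "has_young_integral f g a b (J b - J a)"
  unfolding has_young_integral_def
proof (intro allI impI)
  fix \<epsilon> :: real assume \<epsilon>: "\<epsilon> > 0"
  \<comment> \<open>The added 1 makes \<open>D\<close> positive and strictly larger than
    \<open>C * (b - a)\<close>; \<open>\<delta>\<close> is then taken with
    \<open>D * \<delta> powr (\<theta> - 1) = \<epsilon>\<close>.\<close>
  define D where "D = C * (b - a) + 1"
  have D: "D > 0" "C * (b - a) < D" using C ab by (auto simp: D_def add_nonneg_pos)
  define \<delta> where "\<delta> = (\<epsilon> / D) powr (1 / (\<theta> - 1))"
  have \<delta>: "\<delta> > 0" using \<epsilon> D by (simp add: \<delta>_def)
  have \<delta>p: "\<delta> powr (\<theta> - 1) = \<epsilon> / D" using \<theta> \<epsilon> D by (simp add: \<delta>_def powr_powr)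
  show "\<exists>\<delta>>0. \<forall>p. p tagged_division_of {a..b} \<and> (\<forall>(x, K)\<in>p. Sup K - Inf K < \<delta>) \<longrightarrow>
        \<bar>(\<Sum>(x, K)\<in>p. f x * (g (Sup K) - g (Inf K))) - (J b - J a)\<bar> < \<epsilon>"
  proof (intro exI[of _ \<delta>] conjI \<delta> allI impI, elim conjE)
    fix p assume p: "p tagged_division_of {a..b}" and mesh: "\<forall>(x, K)\<in>p. Sup K - Inf K < \<delta>"
    have bound: "\<bar>f x * (g (Sup K) - g (Inf K)) - (J (Sup K) - J (Inf K))\<bar>
        \<le> C * \<delta> powr (\<theta> - 1) * (Sup K - Inf K)" if xK: "(x, K) \<in> p" for x K
    proof -
      obtain u v where K: "K = cbox u v" using p xK by (meson tagged_division_ofD(4))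
      have x: "x \<in> K" "K \<subseteq> {a..b}" using p xK by (meson tagged_division_ofD(2,3))+
      then have uv: "u \<le> x" "x \<le> v" "Sup K = v" "Inf K = u" "a \<le> u" "v \<le> b" using K by auto
      have "\<bar>f x * (g v - g u) - (J v - J u)\<bar> \<le> C * (v - u) powr \<theta>" using uv by (intro J) auto
      also have "(v - u) powr \<theta> = (v - u) powr (\<theta> - 1) * (v - u)"
        using uv powr_mult_base[of "v - u" "\<theta> - 1"] by (simp add: mult.commute)
      also have "\<dots> \<le> \<delta> powr (\<theta> - 1) * (v - u)"
        using mesh xK uv \<theta> by (intro mult_right_mono powr_mono2) auto
      finally show ?thesis using C uv by (simp add: mult_left_mono mult.assoc)
    qed
    have J': "(\<Sum>(x, K)\<in>p. J (Sup K) - J (Inf K)) = J b - J a"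
      by (rule additive_tagged_division_1[OF ab p])
    have l: "(\<Sum>(x, K)\<in>p. Sup K - Inf K) = b - a"
      using additive_tagged_division_1[OF ab p, of "\<lambda>x. x"] .
    have "\<bar>(\<Sum>(x, K)\<in>p. f x * (g (Sup K) - g (Inf K))) - (J b - J a)\<bar> =
        \<bar>\<Sum>(x, K)\<in>p. f x * (g (Sup K) - g (Inf K)) - (J (Sup K) - J (Inf K))\<bar>"
      unfolding J'[symmetric] by (simp add: sum_subtractf case_prod_beta)
    also have "\<dots> \<le> (\<Sum>(x, K)\<in>p. C * \<delta> powr (\<theta> - 1) * (Sup K - Inf K))"
      using bound by (intro order_trans[OF sum_abs] sum_mono) auto
    also have "\<dots> = C * \<delta> powr (\<theta> - 1) * (\<Sum>(x, K)\<in>p. Sup K - Inf K)"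
      by (simp add: sum_distrib_left case_prod_beta)
    also have "\<dots> = (C * (b - a)) * (\<epsilon> / D)" by (simp add: l \<delta>p)
    also have "\<dots> < D * (\<epsilon> / D)" using D \<epsilon> by (intro mult_strict_right_mono) auto
    also have "\<dots> = \<epsilon>" using D by simp
    finally show "\<bar>(\<Sum>(x, K)\<in>p. f x * (g (Sup K) - g (Inf K))) - (J b - J a)\<bar> < \<epsilon>" .
  qed
qed

section \<open>The Euler scheme\<close>

text \<open>As \<open>\<epsilon> < 1\<close>, the left side grows more slowly than
  \<open>R\<close>.\<close>

lemma exists_sublinear_bound:
  fixes a c K K' \<epsilon> :: real
  assumes "0 \<le> a" "0 \<le> c" "0 \<le> K" "0 \<le> K'" "0 < \<epsilon>" "\<epsilon> < 1"
  shows "\<exists>R\<ge>0. a + c * (K * R + K') powr \<epsilon> \<le> R"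
proof -
  define L where "L = K + K'"
  define S where "S = a + c * L powr \<epsilon> + 1"
  have S: "S \<ge> 1" using assms by (simp add: S_def)
  \<comment> \<open>The solution of \<open>S * R powr \<epsilon> = R\<close>. The 1 in
    \<open>S\<close> forces \<open>R \<ge> 1\<close>, so that constants are absorbed into powers of
    \<open>R\<close>.\<close>
  define R where "R = S powr (1 / (1 - \<epsilon>))"
  have R: "R \<ge> 1" using S assms by (simp add: R_def ge_one_powr_ge_zero)
  have "K * R + K' \<le> L * R" using R assms mult_left_mono[of 1 R K'] by (simp add: L_def algebra_simps)
  then have "(K * R + K') powr \<epsilon> \<le> (L * R) powr \<epsilon>" using R assms by (intro powr_mono2) auto
  also have "\<dots> = L powr \<epsilon> * R powr \<epsilon>" by (rule powr_mult)
  finally have "c * (K * R + K') powr \<epsilon> \<le> c * (L powr \<epsilon> * R powr \<epsilon>)"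
    using assms by (intro mult_left_mono)
  moreover have "a \<le> a * R powr \<epsilon>" using assms R mult_left_mono[of 1 "R powr \<epsilon>" a]
    by (simp add: ge_one_powr_ge_zero)
  ultimately have "a + c * (K * R + K') powr \<epsilon> \<le> (a + c * L powr \<epsilon>) * R powr \<epsilon>"
    by (simp add: algebra_simps)
  also have "\<dots> \<le> S * R powr \<epsilon>" by (intro mult_right_mono) (simp_all add: S_def)
  also have "S = R powr (1 - \<epsilon>)" using S assms by (simp add: R_def powr_powr)
  also have "R powr (1 - \<epsilon>) * R powr \<epsilon> = R" using R by (simp add: powr_add[symmetric])
  finally show ?thesis using R by (intro exI[of _ R]) auto
qed

lemma norm_le_l1_matrix: "norm A \<le> (\<Sum>i\<in>UNIV. \<Sum>j\<in>UNIV. \<bar>A $ i $ j\<bar>)" for A :: "real^'m^'d"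
proof -
  have "norm A \<le> (\<Sum>i\<in>UNIV. norm (A $ i))" unfolding norm_vec_def by (rule L2_set_le_sum) auto
  also have "\<dots> \<le> (\<Sum>i\<in>UNIV. \<Sum>j\<in>UNIV. \<bar>A $ i $ j\<bar>)" by (intro sum_mono norm_le_l1_cart)
  finally show ?thesis .
qed

lemma neg_part_lipschitz: "\<bar>neg_part a - neg_part b\<bar> \<le> \<bar>a - b\<bar>"
  by (auto simp: neg_part_def max_def)

text \<open>Only deterministic data; the driver is a path handed to the scheme.
  \<open>\<gamma>\<close> is the Hoelder exponent of the driver, and
  \<open>\<gamma> \<le> \<nu>\<close> makes \<open>\<sigma>\<close> at least \<gamma>-Hoelder in
  time.\<close>

locale reflected_sde =
  fixes T \<nu> K \<gamma> Mb Ms :: real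
    and b :: "real \<Rightarrow> real^'d \<Rightarrow> real^'d" and \<sigma> :: "real \<Rightarrow> real^'d \<Rightarrow> real^'m^'d" and x0 :: "real^'d"
  assumes T: "T > 0" and \<gamma>: "1/2 < \<gamma>" "\<gamma> < 1" "\<gamma> \<le> \<nu>" and K: "0 \<le> K"
    and x0: "\<And>i. x0 $ i > 0"
    and \<sigma>_bound: "\<And>t x. t \<in> {0..T} \<Longrightarrow> norm (\<sigma> t x) \<le> Ms"
    and b_bound: "\<And>t x. t \<in> {0..T} \<Longrightarrow> norm (b t x) \<le> Mb"
    and b_meas: "\<And>x. (\<lambda>t. b t x) \<in> borel_measurable (lebesgue_on {0..T})"
    and \<sigma>_x: "\<And>t x y. t \<in> {0..T} \<Longrightarrow> norm (\<sigma> t x - \<sigma> t y) \<le> K * norm (x - y)"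
    and \<sigma>_t: "\<And>s t x. s \<in> {0..T} \<Longrightarrow> t \<in> {0..T} \<Longrightarrow> norm (\<sigma> t x - \<sigma> s x) \<le> K * \<bar>t - s\<bar> powr \<nu>"
    and b_x: "\<And>t x y. t \<in> {0..T} \<Longrightarrow> norm (b t x - b t y) \<le> K * norm (x - y)"
begin

text \<open>A state of the Euler scheme consists of the drift integral, the matrix of the integrals
  of \<open>\<sigma>\<^sub>i\<^sub>j\<close> against the \<open>j\<close>-th driver, and the regulator.\<close>

definition zst :: "(real^'d) \<times> (real^'m^'d) \<times> (real^'d) \<Rightarrow> real^'d" where
  "zst p = x0 + fst p + (\<chi> i. \<Sum>j\<in>UNIV. fst (snd p) $ i $ j)"

definition xst :: "(real^'d) \<times> (real^'m^'d) \<times> (real^'d) \<Rightarrow> real^'d" where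
  "xst p = zst p + snd (snd p)"

definition gp :: "nat \<Rightarrow> nat \<Rightarrow> real" where
  "gp N k = T * real k / real N"

text \<open>As \<open>b\<close> is merely measurable in time, a sample at a grid point would carry
  no information; time is integrated exactly with the space variable frozen. Half-open cells tile
  the interval.\<close>

definition drift :: "real \<Rightarrow> real \<Rightarrow> real^'d \<Rightarrow> real^'d" where
  "drift u v x = (LINT s:{u..<v}|lebesgue. b s x)"

text \<open>The coefficients are taken at the old state, the regulator at the new unreflected value.
  The \<open>0\<close> is a placeholder, since \<open>zst\<close> does not read the third
  component.\<close>

definition estep where
  "estep N w k p =
    (let D = fst p + drift (gp N k) (gp N (Suc k)) (xst p);
         A = fst (snd p) + (\<chi> i j. \<sigma> (gp N k) (xst p) $ i $ j * (w j (gp N (Suc k)) - w j (gp N k)))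
     in (D, A, \<chi> i. max (snd (snd p) $ i) (neg_part (zst (D, A, 0) $ i))))"

primrec euler :: "nat \<Rightarrow> ('m \<Rightarrow> real \<Rightarrow> real) \<Rightarrow> nat \<Rightarrow> (real^'d) \<times> (real^'m^'d) \<times> (real^'d)" where
  "euler N w 0 = (0, 0, 0)"
| "euler N w (Suc k) = estep N w k (euler N w k)"

abbreviation "eD N w k \<equiv> fst (euler N w k)"
abbreviation "eA N w k \<equiv> fst (snd (euler N w k))"
abbreviation "eY N w k \<equiv> snd (snd (euler N w k))"
abbreviation "eZ N w k \<equiv> zst (euler N w k)"
abbreviation "eX N w k \<equiv> xst (euler N w k)"

section \<open>Grid, drift integrals and increments of the scheme\<close>

lemma Ms_nonneg: "0 \<le> Ms" and Mb_nonneg: "0 \<le> Mb"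
  using order_trans[OF norm_ge_zero \<sigma>_bound[of 0 0]] order_trans[OF norm_ge_zero b_bound[of 0 0]] T by auto

lemma gp_mem: "N > 0 \<Longrightarrow> k \<le> N \<Longrightarrow> gp N k \<in> {0..T}"
  using T by (auto simp: gp_def divide_le_eq)

lemma gp_diff: "k \<le> l \<Longrightarrow> gp N l - gp N k = T / real N * real (l - k)"
  by (simp add: gp_def of_nat_diff right_diff_distrib diff_divide_distrib)

lemma gp_mono: "k \<le> l \<Longrightarrow> gp N k \<le> gp N l"
  using T by (simp add: gp_def divide_right_mono)

lemma zst_nth: "zst p $ i = x0 $ i + fst p $ i + (\<Sum>j\<in>UNIV. fst (snd p) $ i $ j)"
  by (simp add: zst_def)

lemma b_set_integrable:
  assumes "0 \<le> u" "v \<le> T"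
  shows "set_integrable lebesgue {u..<v} (\<lambda>s. b s x)"
proof -
  have "(\<lambda>s. indicator {0..T} s *\<^sub>R b s x) \<in> borel_measurable lebesgue"
    using b_meas[of x] by (subst (asm) borel_measurable_restrict_space_iff) auto
  then have "(\<lambda>s. indicator {u..<v} s *\<^sub>R (indicator {0..T} s *\<^sub>R b s x)) \<in> borel_measurable lebesgue"
    by (rule borel_measurable_scaleR[rotated]) (rule borel_measurable_indicator, simp)
  also have "(\<lambda>s. indicator {u..<v} s *\<^sub>R (indicator {0..T} s *\<^sub>R b s x)) = (\<lambda>s. indicator {u..<v} s *\<^sub>R b s x)"
    using assms by (auto simp: indicator_def fun_eq_iff)
  finally have m: "(\<lambda>s. indicator {u..<v} s *\<^sub>R b s x) \<in> borel_measurable lebesgue" .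
  show ?thesis unfolding set_integrable_def
  proof (rule integrableI_bounded_set[where A="{u..<v}" and B=Mb])
    show "AE s\<in>{u..<v} in lebesgue. norm (indicator {u..<v} s *\<^sub>R b s x) \<le> Mb"
      using assms by (intro AE_I2) (auto intro!: b_bound)
    show "(\<lambda>s. indicator {u..<v} s *\<^sub>R b s x) \<in> borel_measurable lebesgue" by (rule m)
    show "emeasure lebesgue {u..<v} < \<infinity>" by (cases "u \<le> v") simp_all
  qed auto
qed

lemma drift_norm:
  assumes "0 \<le> u" "u \<le> v" "v \<le> T"
  shows "norm (drift u v x) \<le> Mb * (v - u)"
proof -
  have "norm (drift u v x) \<le> (LINT s|lebesgue. indicator {u..<v} s * Mb)"
    unfolding drift_def set_lebesgue_integral_def
  proof (rule Bochner_Integration.integral_norm_bound_integral)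
    show "integrable lebesgue (\<lambda>s. indicator {u..<v} s *\<^sub>R b s x)"
      using b_set_integrable[of u v x] assms unfolding set_integrable_def by simp
    show "integrable lebesgue (\<lambda>s. indicator {u..<v} s * Mb)"
      using assms by (intro integrable_mult_left integrable_real_indicator) auto
    show "norm (indicator {u..<v} s *\<^sub>R b s x) \<le> indicator {u..<v} s * Mb" for s
      using assms b_bound[of s x] by (auto simp: indicator_def)
  qed
  also have "\<dots> = Mb * (v - u)" using assms by simp
  finally show ?thesis .
qed

lemma drift_lipschitz:
  assumes "0 \<le> u" "u \<le> v" "v \<le> T"
  shows "norm (drift u v x - drift u v y) \<le> K * (v - u) * norm (x - y)"
proof -
  note I = b_set_integrable[of u v x] b_set_integrable[of u v y]
  have "drift u v x - drift u v y = (LINT s|lebesgue. indicator {u..<v} s *\<^sub>R (b s x - b s y))"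
    unfolding drift_def set_lebesgue_integral_def using I assms
    by (simp add: set_integrable_def scaleR_diff_right)
  also have "norm \<dots> \<le> (LINT s|lebesgue. indicator {u..<v} s * (K * norm (x - y)))"
  proof (rule Bochner_Integration.integral_norm_bound_integral)
    show "integrable lebesgue (\<lambda>s. indicator {u..<v} s *\<^sub>R (b s x - b s y))"
      using I assms unfolding set_integrable_def scaleR_diff_right by (intro Bochner_Integration.integrable_diff) auto
    show "integrable lebesgue (\<lambda>s. indicator {u..<v} s * (K * norm (x - y)))"
      using assms by (intro integrable_mult_left integrable_real_indicator) auto
    show "norm (indicator {u..<v} s *\<^sub>R (b s x - b s y)) \<le> indicator {u..<v} s * (K * norm (x - y))" for s
      using assms b_x[of s x y] by (auto simp: indicator_def)
  qed
  also have "\<dots> = K * (v - u) * norm (x - y)" using assms by simp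
  finally show ?thesis .
qed

lemma euler_Suc:
  "eD N w (Suc k) = eD N w k + drift (gp N k) (gp N (Suc k)) (eX N w k)"
  "eA N w (Suc k) $ i $ j = eA N w k $ i $ j + \<sigma> (gp N k) (eX N w k) $ i $ j * (w j (gp N (Suc k)) - w j (gp N k))"
  "eY N w (Suc k) $ i = max (eY N w k $ i) (neg_part (eZ N w (Suc k) $ i))"
  by (simp_all add: estep_def Let_def zst_def)

lemma eA_sum: "k \<le> l \<Longrightarrow> eA N w l $ i $ j - eA N w k $ i $ j =
   (\<Sum>p=k..<l. \<sigma> (gp N p) (eX N w p) $ i $ j * (w j (gp N (Suc p)) - w j (gp N p)))"
proof (induction rule: dec_induct)
  case (step n)
  show ?case
    unfolding euler_Suc(2) sum.atLeastLessThan_Suc[OF step(1)] step(3)[symmetric] by (simp only: algebra_simps)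
qed simp

lemma eD_norm:
  assumes "N > 0" "k \<le> l" "l \<le> N"
  shows "norm (eD N w l - eD N w k) \<le> Mb * (gp N l - gp N k)"
  using assms(2,3)
proof (induction rule: dec_induct)
  case (step n)
  have "norm (eD N w (Suc n) - eD N w k) \<le> norm (eD N w n - eD N w k) + norm (drift (gp N n) (gp N (Suc n)) (eX N w n))"
    unfolding euler_Suc using norm_triangle_ineq[of "eD N w n - eD N w k" "drift (gp N n) (gp N (Suc n)) (eX N w n)"]
    by (simp only: algebra_simps)
  also have "norm (drift (gp N n) (gp N (Suc n)) (eX N w n)) \<le> Mb * (gp N (Suc n) - gp N n)"
    using gp_mem[OF assms(1), of n] gp_mem[OF assms(1), of "Suc n"] gp_mono[of n "Suc n" N] step
    by (intro drift_norm) auto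
  finally show ?case using step by (simp add: algebra_simps)
qed simp

text \<open>With \<open>eY_attained\<close> this shows that the recursion computes a running
  maximum. The base case rests on \<open>x0\<close> being positive, so that its negative part equals
  the initial regulator 0.\<close>

lemma eY_ge: "p \<le> k \<Longrightarrow> neg_part (eZ N w p $ i) \<le> eY N w k $ i"
proof (induction k)
  case 0
  then show ?case using less_imp_le[OF x0[of i]] by (simp add: zst_nth neg_part_def)
next
  case (Suc k)
  then show ?case by (cases "p = Suc k") (auto simp: euler_Suc(3) simp del: euler.simps(2) intro: max.coboundedI1)
qed

lemma eY_attained: "\<exists>p\<le>k. eY N w k $ i = neg_part (eZ N w p $ i)"
proof (induction k)
  case 0
  then show ?case using less_imp_le[OF x0[of i]] by (simp add: zst_nth neg_part_def)
next
  case (Suc k)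
  then obtain p where p: "p \<le> k" "eY N w k $ i = neg_part (eZ N w p $ i)" by blast
  show ?case
  proof (cases "eY N w k $ i \<le> neg_part (eZ N w (Suc k) $ i)")
    case True
    then have "eY N w (Suc k) $ i = neg_part (eZ N w (Suc k) $ i)" unfolding euler_Suc(3) by simp
    then show ?thesis by blast
  next
    case False
    then have "eY N w (Suc k) $ i = neg_part (eZ N w p $ i)" unfolding euler_Suc(3) using p by simp
    then show ?thesis using p le_SucI by blast
  qed
qed

text \<open>If the maximum up to \<open>l\<close> is attained by index \<open>k\<close>, the
  regulator has not moved. Otherwise it is attained later, while at \<open>k\<close> the regulator
  was at least the negative part of \<open>eZ N w k\<close>, and \<open>neg_part\<close> is
  1-Lipschitz.\<close>

lemma eY_diff:
  assumes "k \<le> l" and q: "\<And>r. k \<le> r \<Longrightarrow> r \<le> l \<Longrightarrow> \<bar>eZ N w r $ i - eZ N w k $ i\<bar> \<le> q"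
  shows "\<bar>eY N w l $ i - eY N w k $ i\<bar> \<le> q"
proof -
  have q0: "0 \<le> q" using q[of k] assms(1) by simp
  have le: "eY N w k $ i \<le> eY N w l $ i"
  proof -
    obtain p where "p \<le> k" "eY N w k $ i = neg_part (eZ N w p $ i)" using eY_attained by blast
    then show ?thesis using eY_ge[of p l N w i] assms(1) by simp
  qed
  obtain p where p: "p \<le> l" "eY N w l $ i = neg_part (eZ N w p $ i)" using eY_attained by blast
  show ?thesis
  proof (cases "p \<le> k")
    case True
    then show ?thesis using eY_ge[of p k N w i] p le q0 by simp
  next
    case False
    then have "\<bar>neg_part (eZ N w p $ i) - neg_part (eZ N w k $ i)\<bar> \<le> q"
      using q[of p] p order_trans[OF neg_part_lipschitz] by simp
    then show ?thesis using p eY_ge[of k k N w i] le by simp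
  qed
qed

section \<open>A priori Hoelder bound, uniform in the mesh\<close>

definition driver_holder :: "real \<Rightarrow> ('m \<Rightarrow> real \<Rightarrow> real) \<Rightarrow> bool" where
  "driver_holder G w \<longleftrightarrow>
     0 \<le> G \<and> (\<forall>j. \<forall>s\<in>{0..T}. \<forall>t\<in>{0..T}. \<bar>w j t - w j s\<bar> \<le> G * \<bar>t - s\<bar> powr \<gamma>)"

lemma driver_holderD:
  "driver_holder G w \<Longrightarrow> s \<in> {0..T} \<Longrightarrow> t \<in> {0..T} \<Longrightarrow> \<bar>w j t - w j s\<bar> \<le> G * \<bar>t - s\<bar> powr \<gamma>"
  by (auto simp: driver_holder_def)

text \<open>Since \<open>\<sigma>\<close> is bounded, \<open>\<sigma>(s, X s)\<close> is \<open>1/2\<close>-Hoelder with a constant growing only like a power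
  less than one of the \<open>\<gamma>\<close>-Hoelder constant \<open>R\<close> of \<open>X\<close>; as \<open>1/2 + \<gamma> > 1\<close>, Young's estimate then
  closes the a priori bound for large \<open>R\<close> without any restriction on \<open>T\<close>.\<close>

definition coeff_const :: "real \<Rightarrow> real" where
  "coeff_const R = (2 * Ms) powr (1 - 1/2/\<gamma>) * (K * R + K * T powr (\<nu> - \<gamma>)) powr (1/2/\<gamma>)"

definition young_const :: real where
  "young_const = 4 / (1 - 2 powr (1 - (1/2 + \<gamma>)))"

text \<open>The Hoelder constant of a component of the unreflected scheme when X has constant
  \<open>R\<close>. The terms stem from the drift, from the coefficient frozen at the left end, and
  from the Young remainder lowered from exponent \<open>1/2 + \<gamma>\<close> to
  \<open>\<gamma>\<close>.\<close>

definition incr_const :: "real \<Rightarrow> real \<Rightarrow> real" where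
  "incr_const G R = Mb * T powr (1 - \<gamma>) +
     real CARD('m) * (Ms * G + young_const * coeff_const R * G * T powr (1/2))"

lemma coeff_const_nonneg: "0 \<le> coeff_const R"
  by (simp add: coeff_const_def)

lemma young_const_nonneg: "0 \<le> young_const"
proof -
  have "(2::real) powr (1 - (1/2 + \<gamma>)) < 1" using \<gamma> by (intro powr_less_one) auto
  then show ?thesis by (simp add: young_const_def)
qed

text \<open>The first bound is linear in \<open>R\<close> and serves the limit, where
  \<open>R\<close> is fixed. The second interpolates it with the bound of \<open>\<sigma>\<close>
  and carries only the power \<open>1/2/\<gamma> < 1\<close> of \<open>R\<close>.\<close>

lemma coeff_incr:
  assumes st: "s \<in> {0..T}" "t \<in> {0..T}" and R: "0 \<le> R" and xy: "norm (y - x) \<le> R * \<bar>t - s\<bar> powr \<gamma>"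
  shows "norm (\<sigma> t y - \<sigma> s x) \<le> (K * R + K * T powr (\<nu> - \<gamma>)) * \<bar>t - s\<bar> powr \<gamma>"
    and "norm (\<sigma> t y - \<sigma> s x) \<le> coeff_const R * \<bar>t - s\<bar> powr (1/2)"
proof -
  have "norm (\<sigma> t y - \<sigma> s x) \<le> norm (\<sigma> t y - \<sigma> t x) + norm (\<sigma> t x - \<sigma> s x)"
    using norm_triangle_ineq[of "\<sigma> t y - \<sigma> t x" "\<sigma> t x - \<sigma> s x"] by simp
  also have "\<dots> \<le> K * (R * \<bar>t - s\<bar> powr \<gamma>) + K * (T powr (\<nu> - \<gamma>) * \<bar>t - s\<bar> powr \<gamma>)"
  proof (rule add_mono)
    show "norm (\<sigma> t y - \<sigma> t x) \<le> K * (R * \<bar>t - s\<bar> powr \<gamma>)"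
      using \<sigma>_x[OF st(2), of y x] mult_left_mono[OF xy K] by linarith
    have "\<bar>t - s\<bar> powr \<nu> = \<bar>t - s\<bar> powr (\<nu> - \<gamma>) * \<bar>t - s\<bar> powr \<gamma>" by (simp add: powr_add[symmetric])
    also have "\<dots> \<le> T powr (\<nu> - \<gamma>) * \<bar>t - s\<bar> powr \<gamma>"
      using st \<gamma> by (intro mult_right_mono powr_mono2) auto
    finally have "\<bar>t - s\<bar> powr \<nu> \<le> T powr (\<nu> - \<gamma>) * \<bar>t - s\<bar> powr \<gamma>" .
    from mult_left_mono[OF this K] show "norm (\<sigma> t x - \<sigma> s x) \<le> K * (T powr (\<nu> - \<gamma>) * \<bar>t - s\<bar> powr \<gamma>)"
      using \<sigma>_t[OF st, of x] by linarith
  qed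
  finally show 1: "norm (\<sigma> t y - \<sigma> s x) \<le> (K * R + K * T powr (\<nu> - \<gamma>)) * \<bar>t - s\<bar> powr \<gamma>"
    by (simp add: algebra_simps)
  show "norm (\<sigma> t y - \<sigma> s x) \<le> coeff_const R * \<bar>t - s\<bar> powr (1/2)"
    unfolding coeff_const_def
    by (rule holder_interpolation) (use \<gamma> \<sigma>_bound st 1 K R in auto)
qed

text \<open>X is controlled only at indices strictly below \<open>l\<close>, as the left-point sum
  does not read it at \<open>l\<close>; the induction for X depends on this.\<close>

lemma euler_young:
  assumes N: "N > 0" and kl: "k \<le> l" "l \<le> N" and w: "driver_holder G w" and R: "0 \<le> R"
    and X: "\<And>p q. k \<le> p \<Longrightarrow> p \<le> q \<Longrightarrow> q < l \<Longrightarrow> norm (eX N w q - eX N w p) \<le> R * (gp N q - gp N p) powr \<gamma>"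
  shows "\<bar>eA N w l $ i $ j - eA N w k $ i $ j - \<sigma> (gp N k) (eX N w k) $ i $ j * (w j (gp N l) - w j (gp N k))\<bar>
    \<le> young_const * coeff_const R * G * (gp N l - gp N k) powr (1/2 + \<gamma>)"
proof -
  \<comment> \<open>The mesh converts index differences into time differences; its powers go into
    the two Hoelder constants and recombine at the end.\<close>
  define h where "h = T / real N"
  have h: "0 < h" using T N by (simp add: h_def)
  have G: "0 \<le> G" using w by (simp add: driver_holder_def)
  have d: "(gp N q - gp N p) powr e = h powr e * real (q - p) powr e" if "p \<le> q" for p q e
    unfolding gp_diff[OF that] h_def by (rule powr_mult)
  have "\<bar>(\<Sum>p=k..<l. \<sigma> (gp N p) (eX N w p) $ i $ j * (w j (gp N (Suc p)) - w j (gp N p)))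
      - \<sigma> (gp N k) (eX N w k) $ i $ j * (w j (gp N l) - w j (gp N k))\<bar>
     \<le> 4 / (1 - 2 powr (1 - (1/2 + \<gamma>))) * (coeff_const R * h powr (1/2)) * (G * h powr \<gamma>) * real (l - k) powr (1/2 + \<gamma>)"
  proof (rule discrete_young)
    fix p q assume pq: "k \<le> p" "p \<le> q" "q < l"
    have m: "gp N p \<in> {0..T}" "gp N q \<in> {0..T}" "gp N p \<le> gp N q"
      using pq kl gp_mem[OF N, of p] gp_mem[OF N, of q] gp_mono[of p q N] by auto
    have "\<bar>\<sigma> (gp N q) (eX N w q) $ i $ j - \<sigma> (gp N p) (eX N w p) $ i $ j\<bar>
        = \<bar>(\<sigma> (gp N q) (eX N w q) - \<sigma> (gp N p) (eX N w p)) $ i $ j\<bar>" by simp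
    also have "\<dots> \<le> norm (\<sigma> (gp N q) (eX N w q) - \<sigma> (gp N p) (eX N w p))"
      by (rule order_trans[OF component_le_norm_cart Finite_Cartesian_Product.norm_nth_le])
    also have "\<dots> \<le> coeff_const R * \<bar>gp N q - gp N p\<bar> powr (1/2)"
      using X[OF pq] m by (intro coeff_incr(2) R) auto
    also have "\<dots> = coeff_const R * h powr (1/2) * real (q - p) powr (1/2)"
      using d[OF pq(2)] m by simp
    finally show "\<bar>\<sigma> (gp N q) (eX N w q) $ i $ j - \<sigma> (gp N p) (eX N w p) $ i $ j\<bar> \<le>
        coeff_const R * h powr (1/2) * real (q - p) powr (1/2)" .
  next
    fix p q assume pq: "k \<le> p" "p \<le> q" "q \<le> l"
    have m: "gp N p \<in> {0..T}" "gp N q \<in> {0..T}" "gp N p \<le> gp N q"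
      using pq kl gp_mem[OF N, of p] gp_mem[OF N, of q] gp_mono[of p q N] by auto
    have "\<bar>w j (gp N q) - w j (gp N p)\<bar> \<le> G * \<bar>gp N q - gp N p\<bar> powr \<gamma>"
      by (rule driver_holderD[OF w m(1,2)])
    then show "\<bar>w j (gp N q) - w j (gp N p)\<bar> \<le> G * h powr \<gamma> * real (q - p) powr \<gamma>"
      using d[OF pq(2)] m by simp
  qed (use \<gamma> kl G coeff_const_nonneg in auto)
  also have "\<dots> = young_const * coeff_const R * G * ((h powr (1/2) * h powr \<gamma>) * real (l - k) powr (1/2 + \<gamma>))"
    by (simp add: young_const_def)
  also have "\<dots> = young_const * coeff_const R * G * (gp N l - gp N k) powr (1/2 + \<gamma>)"
    by (simp only: d[OF kl(1)] powr_add[symmetric])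
  finally show ?thesis by (simp only: eA_sum[OF kl(1)])
qed

lemma euler_A_incr:
  assumes N: "N > 0" and kl: "k \<le> l" "l \<le> N" and w: "driver_holder G w" and R: "0 \<le> R"
    and X: "\<And>p q. k \<le> p \<Longrightarrow> p \<le> q \<Longrightarrow> q < l \<Longrightarrow> norm (eX N w q - eX N w p) \<le> R * (gp N q - gp N p) powr \<gamma>"
  shows "\<bar>eA N w l $ i $ j - eA N w k $ i $ j\<bar>
    \<le> (Ms * G + young_const * coeff_const R * G * T powr (1/2)) * (gp N l - gp N k) powr \<gamma>"
proof -
  define d where "d = gp N l - gp N k"
  have m: "gp N k \<in> {0..T}" "gp N l \<in> {0..T}" "gp N k \<le> gp N l"
    using kl gp_mem[OF N, of k] gp_mem[OF N, of l] gp_mono[of k l N] by auto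
  then have d: "0 \<le> d" "d \<le> T" by (auto simp: d_def)
  have G: "0 \<le> G" using w by (simp add: driver_holder_def)
  have "\<bar>\<sigma> (gp N k) (eX N w k) $ i $ j\<bar> \<le> Ms"
    using component_le_norm_cart[of "\<sigma> (gp N k) (eX N w k) $ i" j]
      Finite_Cartesian_Product.norm_nth_le[of "\<sigma> (gp N k) (eX N w k)" i] \<sigma>_bound[OF m(1), of "eX N w k"]
    by linarith
  moreover have "\<bar>w j (gp N l) - w j (gp N k)\<bar> \<le> G * d powr \<gamma>"
    using driver_holderD[OF w m(1,2), of j] m(3) by (simp add: d_def)
  ultimately have 1: "\<bar>\<sigma> (gp N k) (eX N w k) $ i $ j * (w j (gp N l) - w j (gp N k))\<bar> \<le> Ms * (G * d powr \<gamma>)"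
    unfolding abs_mult using Ms_nonneg by (intro mult_mono) auto
  have "d powr (1/2 + \<gamma>) \<le> T powr (1/2) * d powr \<gamma>"
    unfolding powr_add using d by (intro mult_right_mono powr_mono2) auto
  then have 2: "young_const * coeff_const R * G * d powr (1/2 + \<gamma>) \<le> young_const * coeff_const R * G * (T powr (1/2) * d powr \<gamma>)"
    using G coeff_const_nonneg young_const_nonneg by (intro mult_left_mono) auto
  have "\<bar>eA N w l $ i $ j - eA N w k $ i $ j\<bar> \<le> Ms * (G * d powr \<gamma>) + young_const * coeff_const R * G * (T powr (1/2) * d powr \<gamma>)"
    using 1 2 euler_young[OF assms, of i j] unfolding d_def[symmetric] by linarith
  then show ?thesis unfolding d_def[symmetric] by (simp add: algebra_simps)
qed

lemma euler_Z_incr: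
  assumes N: "N > 0" and kl: "k \<le> l" "l \<le> N" and w: "driver_holder G w" and R: "0 \<le> R"
    and X: "\<And>p q. k \<le> p \<Longrightarrow> p \<le> q \<Longrightarrow> q < l \<Longrightarrow> norm (eX N w q - eX N w p) \<le> R * (gp N q - gp N p) powr \<gamma>"
  shows "\<bar>eZ N w l $ i - eZ N w k $ i\<bar> \<le> incr_const G R * (gp N l - gp N k) powr \<gamma>"
proof -
  define d where "d = gp N l - gp N k"
  have m: "gp N k \<in> {0..T}" "gp N l \<in> {0..T}" "gp N k \<le> gp N l"
    using kl gp_mem[OF N, of k] gp_mem[OF N, of l] gp_mono[of k l N] by auto
  then have d: "0 \<le> d" "d \<le> T" by (auto simp: d_def)
  have "\<bar>eD N w l $ i - eD N w k $ i\<bar> \<le> norm (eD N w l - eD N w k)"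
    using component_le_norm_cart[of "eD N w l - eD N w k" i] by simp
  also have "\<dots> \<le> Mb * d" unfolding d_def by (rule eD_norm[OF N kl])
  also have "d = d powr (1 - \<gamma>) * d powr \<gamma>" using d by (simp add: powr_add[symmetric])
  also have "Mb * \<dots> \<le> Mb * (T powr (1 - \<gamma>) * d powr \<gamma>)"
    using d \<gamma> Mb_nonneg by (intro mult_left_mono mult_right_mono powr_mono2) auto
  finally have 1: "\<bar>eD N w l $ i - eD N w k $ i\<bar> \<le> Mb * (T powr (1 - \<gamma>) * d powr \<gamma>)" .
  define c where "c = (Ms * G + young_const * coeff_const R * G * T powr (1/2)) * d powr \<gamma>"
  have "\<bar>\<Sum>j\<in>UNIV. eA N w l $ i $ j - eA N w k $ i $ j\<bar> \<le> (\<Sum>j\<in>(UNIV::'m set). c)"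
    unfolding c_def d_def by (intro order_trans[OF sum_abs] sum_mono euler_A_incr[OF assms])
  then have 2: "\<bar>\<Sum>j\<in>UNIV. eA N w l $ i $ j - eA N w k $ i $ j\<bar> \<le> real CARD('m) * c" by simp
  have "eZ N w l $ i - eZ N w k $ i = (eD N w l $ i - eD N w k $ i) + (\<Sum>j\<in>UNIV. eA N w l $ i $ j - eA N w k $ i $ j)"
    by (simp add: zst_nth sum_subtractf)
  then have "\<bar>eZ N w l $ i - eZ N w k $ i\<bar> \<le> Mb * (T powr (1 - \<gamma>) * d powr \<gamma>) + real CARD('m) * c"
    using 1 2 by linarith
  also have "\<dots> = incr_const G R * d powr \<gamma>" by (simp add: incr_const_def c_def algebra_simps)
  finally show ?thesis by (simp only: d_def)
qed

text \<open>Induction on the length: the bound on shorter index intervals controls Z up to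
  \<open>l\<close>, hence the regulator. The 2 counts Z and the regulator, \<open>CARD('d)\<close>
  comes from the l1 norm.\<close>

lemma euler_X_incr:
  assumes N: "N > 0" and kl: "k \<le> l" "l \<le> N" and w: "driver_holder G w"
    and R: "0 \<le> R" "real CARD('d) * (2 * incr_const G R) \<le> R"
  shows "norm (eX N w l - eX N w k) \<le> R * (gp N l - gp N k) powr \<gamma>"
  using kl
proof (induction "l - k" arbitrary: k l rule: less_induct)
  case less
  define d where "d = gp N l - gp N k"
  have G: "0 \<le> G" using w by (simp add: driver_holder_def)
  have inc: "0 \<le> incr_const G R"
    using G Ms_nonneg Mb_nonneg coeff_const_nonneg young_const_nonneg by (simp add: incr_const_def)
  have Z: "\<bar>eZ N w r $ i - eZ N w k $ i\<bar> \<le> incr_const G R * d powr \<gamma>" if r: "k \<le> r" "r \<le> l" for r i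
  proof -
    have "\<bar>eZ N w r $ i - eZ N w k $ i\<bar> \<le> incr_const G R * (gp N r - gp N k) powr \<gamma>"
      using r less.prems by (intro euler_Z_incr[OF N r(1) _ w R(1)] less.hyps) auto
    also have "\<dots> \<le> incr_const G R * d powr \<gamma>"
      using r \<gamma> gp_mono[of r l N] gp_mono[of k r N] inc by (intro mult_left_mono powr_mono2) (auto simp: d_def)
    finally show ?thesis .
  qed
  have "\<bar>(eX N w l - eX N w k) $ i\<bar> \<le> 2 * incr_const G R * d powr \<gamma>" for i
  proof -
    have "\<bar>eY N w l $ i - eY N w k $ i\<bar> \<le> incr_const G R * d powr \<gamma>"
      using less.prems by (intro eY_diff Z) auto
    then show ?thesis using Z[of l i] less.prems by (simp add: xst_def)
  qed
  then have "(\<Sum>i\<in>UNIV. \<bar>(eX N w l - eX N w k) $ i\<bar>) \<le> (\<Sum>i\<in>(UNIV::'d set). 2 * incr_const G R * d powr \<gamma>)"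
    by (intro sum_mono)
  then have "norm (eX N w l - eX N w k) \<le> real CARD('d) * (2 * incr_const G R) * d powr \<gamma>"
    using norm_le_l1_cart[of "eX N w l - eX N w k"] by simp
  also have "\<dots> \<le> R * d powr \<gamma>" using R(2) by (intro mult_right_mono) auto
  finally show ?case by (simp only: d_def)
qed

lemma euler_bounds:
  assumes w: "driver_holder G w"
  shows "\<exists>R C. 0 \<le> R \<and> 0 \<le> C \<and> (\<forall>N k l. 0 < N \<longrightarrow> k \<le> l \<longrightarrow> l \<le> N \<longrightarrow>
     norm (euler N w l - euler N w k) \<le> R * (gp N l - gp N k) powr \<gamma> \<and>
     (\<forall>i j. \<bar>eA N w l $ i $ j - eA N w k $ i $ j - \<sigma> (gp N k) (eX N w k) $ i $ j * (w j (gp N l) - w j (gp N k))\<bar>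
        \<le> C * (gp N l - gp N k) powr (1/2 + \<gamma>)))"
proof -
  have G: "0 \<le> G" using w by (simp add: driver_holder_def)
  \<comment> \<open>\<open>a\<close> and \<open>c\<close> separate the required bound into its part
    free of \<open>R\<close> and the coefficient of the sublinear power, so that an admissible
    \<open>R\<close> exists.\<close>
  define a where "a = real CARD('d) * (2 * (Mb * T powr (1 - \<gamma>) + real CARD('m) * (Ms * G)))"
  define c where "c = real CARD('d) * (2 * (real CARD('m) * (young_const * (2 * Ms) powr (1 - 1/2/\<gamma>) * G * T powr (1/2))))"
  have "\<exists>R\<ge>0. a + c * (K * R + K * T powr (\<nu> - \<gamma>)) powr (1/2/\<gamma>) \<le> R"
    using G Ms_nonneg Mb_nonneg young_const_nonneg K \<gamma> by (intro exists_sublinear_bound) (auto simp: a_def c_def)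
  then obtain R where R: "0 \<le> R" "a + c * (K * R + K * T powr (\<nu> - \<gamma>)) powr (1/2/\<gamma>) \<le> R" by blast
  have "real CARD('d) * (2 * incr_const G R) = a + c * (K * R + K * T powr (\<nu> - \<gamma>)) powr (1/2/\<gamma>)"
    by (simp add: incr_const_def coeff_const_def a_def c_def algebra_simps)
  with R have R': "real CARD('d) * (2 * incr_const G R) \<le> R" by simp
  define q where "q = Ms * G + young_const * coeff_const R * G * T powr (1/2)"
  define C where "C = young_const * coeff_const R * G"
  have C: "0 \<le> C" using G coeff_const_nonneg young_const_nonneg by (simp add: C_def)
  have q: "0 \<le> q" using G Ms_nonneg coeff_const_nonneg young_const_nonneg by (simp add: q_def)
  have inc: "0 \<le> incr_const G R"
    using G Ms_nonneg Mb_nonneg coeff_const_nonneg young_const_nonneg by (simp add: incr_const_def)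
  \<comment> \<open>The bounds of the drift, of the matrix of integrals and of the regulator, added
    up: compactness is needed for the whole state, not for X alone.\<close>
  define S where "S = Mb * T powr (1 - \<gamma>) + (real CARD('d) * (real CARD('m) * q) + real CARD('d) * incr_const G R)"
  have S: "0 \<le> S" using Mb_nonneg q inc by (simp add: S_def)
  have "norm (euler N w l - euler N w k) \<le> S * (gp N l - gp N k) powr \<gamma> \<and>
     (\<forall>i j. \<bar>eA N w l $ i $ j - eA N w k $ i $ j - \<sigma> (gp N k) (eX N w k) $ i $ j * (w j (gp N l) - w j (gp N k))\<bar>
        \<le> C * (gp N l - gp N k) powr (1/2 + \<gamma>))"
    if N: "0 < N" and kl: "k \<le> l" "l \<le> N" for N k l
  proof
    define d where "d = gp N l - gp N k"
    have m: "gp N k \<in> {0..T}" "gp N l \<in> {0..T}" "gp N k \<le> gp N l"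
      using kl gp_mem[OF N, of k] gp_mem[OF N, of l] gp_mono[of k l N] by auto
    then have d: "0 \<le> d" "d \<le> T" by (auto simp: d_def)
    have X: "norm (eX N w q - eX N w p) \<le> R * (gp N q - gp N p) powr \<gamma>" if "k \<le> p" "p \<le> q" "q \<le> l" for p q
      using that kl by (intro euler_X_incr[OF N _ _ w R(1) R']) auto
    show "\<forall>i j. \<bar>eA N w l $ i $ j - eA N w k $ i $ j - \<sigma> (gp N k) (eX N w k) $ i $ j * (w j (gp N l) - w j (gp N k))\<bar>
        \<le> C * (gp N l - gp N k) powr (1/2 + \<gamma>)"
      unfolding C_def by (intro allI euler_young[OF N kl w R(1)] X) auto
    have "norm (eD N w l - eD N w k) \<le> Mb * d" unfolding d_def by (rule eD_norm[OF N kl])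
    also have "d = d powr (1 - \<gamma>) * d powr \<gamma>" using d by (simp add: powr_add[symmetric])
    also have "Mb * \<dots> \<le> Mb * (T powr (1 - \<gamma>) * d powr \<gamma>)"
      using d \<gamma> Mb_nonneg by (intro mult_left_mono mult_right_mono powr_mono2) auto
    finally have 1: "norm (eD N w l - eD N w k) \<le> Mb * (T powr (1 - \<gamma>) * d powr \<gamma>)" .
    have "(\<Sum>i\<in>UNIV. \<Sum>j\<in>UNIV. \<bar>(eA N w l - eA N w k) $ i $ j\<bar>) \<le> (\<Sum>i\<in>(UNIV::'d set). \<Sum>j\<in>(UNIV::'m set). q * d powr \<gamma>)"
    proof (intro sum_mono)
      show "\<bar>(eA N w l - eA N w k) $ i $ j\<bar> \<le> q * d powr \<gamma>" for i j
        using euler_A_incr[OF N kl w R(1), of i j] X by (simp add: q_def d_def)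
    qed
    then have 2: "norm (eA N w l - eA N w k) \<le> real CARD('d) * (real CARD('m) * (q * d powr \<gamma>))"
      using norm_le_l1_matrix[of "eA N w l - eA N w k"] by simp
    have Z: "\<bar>eZ N w r $ i - eZ N w k $ i\<bar> \<le> incr_const G R * d powr \<gamma>" if r: "k \<le> r" "r \<le> l" for r i
    proof -
      have "\<bar>eZ N w r $ i - eZ N w k $ i\<bar> \<le> incr_const G R * (gp N r - gp N k) powr \<gamma>"
        using r kl by (intro euler_Z_incr[OF N r(1) _ w R(1)] X) auto
      also have "\<dots> \<le> incr_const G R * d powr \<gamma>"
        using r \<gamma> gp_mono[of r l N] gp_mono[of k r N] inc by (intro mult_left_mono powr_mono2) (auto simp: d_def)
      finally show ?thesis .
    qed
    have "(\<Sum>i\<in>UNIV. \<bar>(eY N w l - eY N w k) $ i\<bar>) \<le> (\<Sum>i\<in>(UNIV::'d set). incr_const G R * d powr \<gamma>)"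
      using eY_diff[OF kl(1) Z] by (intro sum_mono) simp
    then have 3: "norm (eY N w l - eY N w k) \<le> real CARD('d) * (incr_const G R * d powr \<gamma>)"
      using norm_le_l1_cart[of "eY N w l - eY N w k"] by simp
    have "norm (euler N w l - euler N w k) \<le> norm (eD N w l - eD N w k) + (norm (eA N w l - eA N w k) + norm (eY N w l - eY N w k))"
    proof -
      have "norm p \<le> norm (fst p) + (norm (fst (snd p)) + norm (snd (snd p)))" for p :: "(real^'d) \<times> (real^'m^'d) \<times> (real^'d)"
        using norm_Pair_le[of "fst p" "snd p"] norm_Pair_le[of "fst (snd p)" "snd (snd p)"] by simp
      from this[of "euler N w l - euler N w k"] show ?thesis by simp
    qed
    also have "\<dots> \<le> S * d powr \<gamma>" using 1 2 3 by (simp add: S_def algebra_simps)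
    finally show "norm (euler N w l - euler N w k) \<le> S * (gp N l - gp N k) powr \<gamma>" by (simp only: d_def)
  qed
  then show ?thesis using S C by blast
qed

end

section \<open>Limits of the Euler scheme\<close>

context reflected_sde
begin

section \<open>Extension of the scheme to continuous time\<close>

definition gidx :: "nat \<Rightarrow> real \<Rightarrow> nat" where
  "gidx N t = nat \<lfloor>t * real N / T\<rfloor>"

text \<open>Piecewise constant extension: every value is a state of the scheme, and the coefficients
  stay frozen on each cell.\<close>

definition epath where
  "epath N w t = euler N w (gidx N t)"

lemma epath_0: "epath N w 0 = 0"
  by (simp add: epath_def gidx_def zero_prod_def)

lemma gp_le_iff: "N > 0 \<Longrightarrow> gp N k \<le> t \<longleftrightarrow> real k \<le> t * real N / T"
  using T by (simp add: gp_def field_simps)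

lemma gp_gidx:
  assumes "N > 0" "0 \<le> t"
  shows "gp N (gidx N t) \<le> t" "t < gp N (Suc (gidx N t))"
proof -
  have 0: "0 \<le> t * real N / T" using assms T by simp
  then have "real (gidx N t) \<le> t * real N / T" unfolding gidx_def by (rule of_nat_floor)
  then show "gp N (gidx N t) \<le> t" using assms(1) by (simp only: gp_le_iff)
  have "\<not> real (Suc (gidx N t)) \<le> t * real N / T" using 0 unfolding gidx_def by linarith
  then show "t < gp N (Suc (gidx N t))" by (simp only: not_le[symmetric] gp_le_iff[OF assms(1)] not_False_eq_True)
qed

lemma gidx_cell:
  assumes "N > 0" "gp N k \<le> s" "s < gp N (Suc k)"
  shows "gidx N s = k"
proof -
  have "real k \<le> s * real N / T" using assms by (simp only: gp_le_iff)
  moreover have "\<not> real (Suc k) \<le> s * real N / T"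
    using assms(3) by (simp only: not_le[symmetric] gp_le_iff[OF assms(1)] not_False_eq_True)
  ultimately show ?thesis unfolding gidx_def by linarith
qed

lemma gidx_gp: "N > 0 \<Longrightarrow> gidx N (gp N k) = k"
  using T by (intro gidx_cell) (auto simp: gp_def divide_strict_right_mono)

lemma gidx_mono: "s \<le> t \<Longrightarrow> gidx N s \<le> gidx N t"
  unfolding gidx_def using T by (intro nat_mono floor_mono divide_right_mono mult_right_mono) auto

lemma gidx_le:
  assumes "N > 0" "t \<le> T"
  shows "gidx N t \<le> N"
proof -
  have "gp N N = T" using assms(1) by (simp add: gp_def)
  then show ?thesis using gidx_mono[of t "gp N N" N] gidx_gp[OF assms(1), of N] assms(2) by simp
qed

lemma gp_Suc: "gp N (Suc k) = gp N k + T / real N"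
  by (simp add: gp_def field_simps add_divide_distrib)

lemma gp_gidx_dist:
  assumes "N > 0" "0 \<le> t"
  shows "\<bar>gp N (gidx N t) - t\<bar> \<le> T / real N"
  using gp_gidx[OF assms] unfolding gp_Suc by (simp add: abs_if)

lemma zst_tendsto:
  assumes "(f \<longlongrightarrow> p) F"
  shows "((\<lambda>n. zst (f n)) \<longlongrightarrow> zst p) F"
  unfolding zst_def by (intro tendsto_intros tendsto_vec_lambda tendsto_sum tendsto_fst tendsto_snd assms)

lemma xst_tendsto: "(f \<longlongrightarrow> p) F \<Longrightarrow> ((\<lambda>n. xst (f n)) \<longlongrightarrow> xst p) F"
  unfolding xst_def by (intro tendsto_add zst_tendsto tendsto_snd)

lemma zst_xst_lipschitz:
  "\<exists>B\<ge>0. \<forall>p q. norm (zst p - zst q) \<le> B * norm (p - q) \<and> norm (xst p - xst q) \<le> B * norm (p - q)"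
proof -
  define L :: "(real^'d) \<times> (real^'m^'d) \<times> (real^'d) \<Rightarrow> real^'d" where
    "L r = fst r + (\<chi> i. \<Sum>j\<in>UNIV. fst (snd r) $ i $ j)" for r
  have "linear L"
    by (rule linearI) (auto simp: L_def vec_eq_iff sum.distrib sum_distrib_left algebra_simps)
  then obtain B where B: "B > 0" "\<And>r. norm (L r) \<le> B * norm r"
    using linear_bounded_pos by blast
  have z: "norm (zst p - zst q) \<le> B * norm (p - q)" for p q
  proof -
    have "zst p - zst q = L (p - q)" by (simp add: zst_def L_def vec_eq_iff sum_subtractf)
    then show ?thesis using B(2) by simp
  qed
  have "norm (xst p - xst q) \<le> (B + 1) * norm (p - q)" for p q
  proof -
    have "norm (xst p - xst q) \<le> norm (zst p - zst q) + norm (snd (snd p) - snd (snd q))"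
      unfolding xst_def by (rule norm_diff_triangle_ineq)
    moreover have "norm (snd (snd p) - snd (snd q)) \<le> norm (p - q)"
      using order_trans[OF norm_snd_le norm_snd_le, of "p - q"]
      by (metis (no_types) norm_snd_le order_trans prod.collapse snd_diff)
    ultimately show ?thesis using z[of p q] by (simp add: algebra_simps)
  qed
  moreover have "norm (zst p - zst q) \<le> (B + 1) * norm (p - q)" for p q
    using z[of p q] unfolding distrib_right by (simp add: add_increasing2)
  ultimately show ?thesis using B(1) by (intro exI[of _ "B + 1"]) auto
qed

text \<open>Since the path is constant on cells, the cellwise drifts merge into one integral along
  the path, ready for dominated convergence.\<close>

lemma eD_integral:
  assumes N: "N > 0" and "k \<le> N"
  shows "set_integrable lebesgue {0..<gp N k} (\<lambda>s. b s (xst (epath N w s)))"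
    and "eD N w k = (LINT s:{0..<gp N k}|lebesgue. b s (xst (epath N w s)))"
proof -
  have "set_integrable lebesgue {0..<gp N k} (\<lambda>s. b s (xst (epath N w s))) \<and>
    eD N w k = (LINT s:{0..<gp N k}|lebesgue. b s (xst (epath N w s)))"
    using assms(2)
  proof (induction k)
    case 0
    then show ?case by (simp add: gp_def set_integrable_def set_lebesgue_integral_def)
  next
    case (Suc k)
    let ?f = "\<lambda>s. b s (xst (epath N w s))"
    let ?I = "{gp N k..<gp N (Suc k)}"
    have g: "0 \<le> gp N k" "gp N k \<le> gp N (Suc k)" "gp N (Suc k) \<le> T"
    proof -
      have "k \<le> N" using Suc.prems by simp
      from gp_mem[OF N this] gp_mem[OF N Suc.prems] gp_mono[OF le_SucI[OF order_refl], of N k]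
      show "0 \<le> gp N k" "gp N k \<le> gp N (Suc k)" "gp N (Suc k) \<le> T" by simp_all
    qed
    have eq: "?f s = b s (eX N w k)" if "s \<in> ?I" for s
      using gidx_cell[OF N, of k s] that by (simp add: epath_def)
    have i: "set_integrable lebesgue ?I ?f"
      using b_set_integrable[of "gp N k" "gp N (Suc k)" "eX N w k"] g eq
      by (subst set_integrable_cong[OF refl refl eq]) auto
    have un: "{0..<gp N (Suc k)} = {0..<gp N k} \<union> ?I" "{0..<gp N k} \<inter> ?I = {}" using g by auto
    have IH: "set_integrable lebesgue {0..<gp N k} ?f" "eD N w k = (LINT s:{0..<gp N k}|lebesgue. ?f s)"
      using Suc by auto
    have "drift (gp N k) (gp N (Suc k)) (eX N w k) = (LINT s:?I|lebesgue. ?f s)"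
      unfolding drift_def by (rule set_lebesgue_integral_cong) (auto simp: eq)
    then have "eD N w (Suc k) = (LINT s:{0..<gp N (Suc k)}|lebesgue. ?f s)"
      unfolding euler_Suc(1) un(1) IH(2) by (simp add: set_integral_Un[OF un(2) IH(1) i])
    moreover have "set_integrable lebesgue {0..<gp N (Suc k)} ?f"
      unfolding un(1) by (rule set_integrable_Un[OF IH(1) i]) auto
    ultimately show ?case by blast
  qed
  then show "set_integrable lebesgue {0..<gp N k} (\<lambda>s. b s (xst (epath N w s)))"
    "eD N w k = (LINT s:{0..<gp N k}|lebesgue. b s (xst (epath N w s)))" by auto
qed

end

text \<open>The mesh sequence is a parameter because it is instantiated twice: by all meshes for
  compactness, and by the selected subsequence for the limit.\<close>

locale euler_limit = reflected_sde T \<nu> K \<gamma> Mb Ms b \<sigma> x0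
  for T \<nu> K \<gamma> Mb Ms :: real and b :: "real \<Rightarrow> real^'d \<Rightarrow> real^'d"
    and \<sigma> :: "real \<Rightarrow> real^'d \<Rightarrow> real^'m^'d" and x0 :: "real^'d" +
  fixes G :: real and w :: "'m \<Rightarrow> real \<Rightarrow> real" and N :: "nat \<Rightarrow> nat"
  assumes w: "driver_holder G w" and N_pos: "\<And>n. 0 < N n" and N_lim: "filterlim N at_top sequentially"
begin

section \<open>Equicontinuity and convergence along a sequence of meshes\<close>

lemma mesh_lim: "(\<lambda>n. T / real (N n)) \<longlonglongrightarrow> 0"
  by (intro tendsto_divide_0[OF tendsto_const] filterlim_at_top_imp_at_infinity
      filterlim_compose[OF filterlim_real_sequentially N_lim])

lemma gp_lim:
  assumes "0 \<le> t"
  shows "(\<lambda>n. gp (N n) (gidx (N n) t)) \<longlonglongrightarrow> t"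
proof -
  have "(\<lambda>n. gp (N n) (gidx (N n) t) - t) \<longlonglongrightarrow> 0"
    by (rule Lim_null_comparison[OF _ mesh_lim]) (use gp_gidx_dist[OF N_pos assms] in simp)
  then show ?thesis by (simp add: LIM_zero_iff)
qed

text \<open>Both times are rounded down to the grid, which can lengthen their distance by at most
  one cell.\<close>

lemma epath_bounds:
  obtains R C where "0 \<le> R" "0 \<le> C"
    "\<And>n s t. s \<in> {0..T} \<Longrightarrow> t \<in> {0..T} \<Longrightarrow>
       norm (epath (N n) w t - epath (N n) w s) \<le> R * (\<bar>t - s\<bar> + T / real (N n)) powr \<gamma>"
    "\<And>n s t i j. 0 \<le> s \<Longrightarrow> s \<le> t \<Longrightarrow> t \<le> T \<Longrightarrow>
       \<bar>fst (snd (epath (N n) w t)) $ i $ j - fst (snd (epath (N n) w s)) $ i $ j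
         - \<sigma> (gp (N n) (gidx (N n) s)) (xst (epath (N n) w s)) $ i $ j
             * (w j (gp (N n) (gidx (N n) t)) - w j (gp (N n) (gidx (N n) s)))\<bar>
       \<le> C * (gp (N n) (gidx (N n) t) - gp (N n) (gidx (N n) s)) powr (1/2 + \<gamma>)"
proof -
  from euler_bounds[OF w] obtain R C where RC: "0 \<le> R" "0 \<le> C" and *: "\<And>N k l. 0 < N \<Longrightarrow> k \<le> l \<Longrightarrow> l \<le> N \<Longrightarrow>
     norm (euler N w l - euler N w k) \<le> R * (gp N l - gp N k) powr \<gamma> \<and>
     (\<forall>i j. \<bar>eA N w l $ i $ j - eA N w k $ i $ j - \<sigma> (gp N k) (eX N w k) $ i $ j * (w j (gp N l) - w j (gp N k))\<bar>
        \<le> C * (gp N l - gp N k) powr (1/2 + \<gamma>))" by blast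
  have le: "norm (epath (N n) w t - epath (N n) w s) \<le> R * (\<bar>t - s\<bar> + T / real (N n)) powr \<gamma>"
    if st: "0 \<le> s" "s \<le> t" "t \<le> T" for n s t
  proof -
    have g: "gp (N n) (gidx (N n) s) \<le> gp (N n) (gidx (N n) t)"
      using st by (intro gp_mono gidx_mono)
    have "gp (N n) (gidx (N n) t) \<le> t" "s < gp (N n) (gidx (N n) s) + T / real (N n)"
      using gp_gidx[OF N_pos, of t n] gp_gidx[OF N_pos, of s n] st by (auto simp: gp_Suc)
    then have d: "gp (N n) (gidx (N n) t) - gp (N n) (gidx (N n) s) \<le> \<bar>t - s\<bar> + T / real (N n)" by linarith
    have "norm (epath (N n) w t - epath (N n) w s) \<le> R * (gp (N n) (gidx (N n) t) - gp (N n) (gidx (N n) s)) powr \<gamma>"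
      unfolding epath_def using *[OF N_pos gidx_mono[OF st(2)] gidx_le[OF N_pos st(3)]] by blast
    also have "\<dots> \<le> R * (\<bar>t - s\<bar> + T / real (N n)) powr \<gamma>"
      using d g \<gamma> RC by (intro mult_left_mono powr_mono2) auto
    finally show ?thesis .
  qed
  show thesis
  proof (rule that[OF RC])
    show "norm (epath (N n) w t - epath (N n) w s) \<le> R * (\<bar>t - s\<bar> + T / real (N n)) powr \<gamma>"
      if "s \<in> {0..T}" "t \<in> {0..T}" for n s t
      using le[of s t n] le[of t s n] that
      by (cases "s \<le> t") (auto simp: norm_minus_commute abs_minus_commute)
    show "\<bar>fst (snd (epath (N n) w t)) $ i $ j - fst (snd (epath (N n) w s)) $ i $ j
         - \<sigma> (gp (N n) (gidx (N n) s)) (xst (epath (N n) w s)) $ i $ j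
             * (w j (gp (N n) (gidx (N n) t)) - w j (gp (N n) (gidx (N n) s)))\<bar>
       \<le> C * (gp (N n) (gidx (N n) t) - gp (N n) (gidx (N n) s)) powr (1/2 + \<gamma>)"
      if st: "0 \<le> s" "s \<le> t" "t \<le> T" for n s t i j
      unfolding epath_def using *[OF N_pos gidx_mono[OF st(2)] gidx_le[OF N_pos st(3)]] by blast
  qed
qed

lemma equi_lim: "((\<lambda>n. R * (a + T / real (N n)) powr \<gamma>) \<longlongrightarrow> R * a powr \<gamma>) sequentially" if "0 \<le> a"
proof -
  have "(\<lambda>n. a + T / real (N n)) \<longlonglongrightarrow> a + 0" by (intro tendsto_add tendsto_const mesh_lim)
  then show ?thesis using that T \<gamma> by (intro tendsto_mult_left tendsto_powr') (auto intro!: add_nonneg_nonneg always_eventually)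
qed

lemma epath_incr:
  obtains R where "0 \<le> R" "\<And>n s t. s \<in> {0..T} \<Longrightarrow> t \<in> {0..T} \<Longrightarrow>
    norm (epath (N n) w t - epath (N n) w s) \<le> R * (\<bar>t - s\<bar> + T / real (N n)) powr \<gamma>"
  by (rule epath_bounds) (rule that)

text \<open>The jumps vanish with the mesh, so the paths are asymptotically equicontinuous and
  convergence spreads from a dense set of times.\<close>

lemma epath_convergent:
  assumes Q: "Q \<subseteq> {0..T}" "\<And>t e. t \<in> {0..T} \<Longrightarrow> 0 < e \<Longrightarrow> \<exists>q\<in>Q. \<bar>t - q\<bar> < e"
    and conv: "\<And>q. q \<in> Q \<Longrightarrow> convergent (\<lambda>n. epath (N n) w q)"
    and t: "t \<in> {0..T}"
  shows "convergent (\<lambda>n. epath (N n) w t)"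
proof -
  obtain R where R: "0 \<le> R" and inc: "\<And>n s t. s \<in> {0..T} \<Longrightarrow> t \<in> {0..T} \<Longrightarrow>
       norm (epath (N n) w t - epath (N n) w s) \<le> R * (\<bar>t - s\<bar> + T / real (N n)) powr \<gamma>"
    using epath_incr by metis
  have "Cauchy (\<lambda>n. epath (N n) w t)"
  proof (rule metric_CauchyI)
    fix e :: real assume e: "0 < e"
    \<comment> \<open>Dividing by \<open>R + 1\<close> also covers \<open>R = 0\<close>; the 4
      leaves a strict margin below \<open>e / 3\<close>.\<close>
    define d where "d = (e / 4 / (R + 1)) powr (1 / \<gamma>)"
    have d: "0 < d" using e R by (simp add: d_def)
    have dg: "d powr \<gamma> = e / 4 / (R + 1)" using \<gamma> e R by (simp add: d_def powr_powr)
    have "R * d powr \<gamma> < e / 3"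
    proof -
      have "R * d powr \<gamma> \<le> (R + 1) * d powr \<gamma>" by (intro mult_right_mono) auto
      also have "\<dots> = e / 4"
        using R nonzero_mult_div_cancel_left[of "R + 1" "e / 4"] unfolding dg times_divide_eq_right by simp
      finally show ?thesis using e by simp
    qed
    obtain q where q: "q \<in> Q" "\<bar>t - q\<bar> < d" using Q(2)[OF t d] by blast
    have qT: "q \<in> {0..T}" using q Q by auto
    have "R * \<bar>t - q\<bar> powr \<gamma> \<le> R * d powr \<gamma>" using q \<gamma> R by (intro mult_left_mono powr_mono2) auto
    with \<open>R * d powr \<gamma> < e / 3\<close> have "R * \<bar>t - q\<bar> powr \<gamma> < e / 3" by linarith
    then have "eventually (\<lambda>n. R * (\<bar>t - q\<bar> + T / real (N n)) powr \<gamma> < e / 3) sequentially"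
      by (intro order_tendstoD(2)[OF equi_lim]) auto
    then obtain n1 where n1: "\<And>n. n \<ge> n1 \<Longrightarrow> R * (\<bar>t - q\<bar> + T / real (N n)) powr \<gamma> < e / 3"
      unfolding eventually_sequentially by blast
    have "Cauchy (\<lambda>n. epath (N n) w q)" using conv[OF q(1)] by (rule convergent_Cauchy)
    then obtain n2 where n2: "\<And>m n. m \<ge> n2 \<Longrightarrow> n \<ge> n2 \<Longrightarrow> dist (epath (N m) w q) (epath (N n) w q) < e / 3"
      using e by (meson metric_CauchyD divide_pos_pos zero_less_numeral)
    have "dist (epath (N m) w t) (epath (N n) w t) < e" if "m \<ge> max n1 n2" "n \<ge> max n1 n2" for m n
    proof -
      have "dist (epath (N m) w t) (epath (N m) w q) < e / 3" "dist (epath (N n) w t) (epath (N n) w q) < e / 3"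
        unfolding dist_norm using order_le_less_trans[OF inc[OF qT t] n1] that by auto
      moreover have "dist (epath (N m) w q) (epath (N n) w q) < e / 3" using n2 that by simp
      moreover have "dist (epath (N m) w t) (epath (N n) w t) \<le>
          dist (epath (N m) w t) (epath (N m) w q) + (dist (epath (N m) w q) (epath (N n) w q) + dist (epath (N n) w t) (epath (N n) w q))"
        using dist_triangle[of "epath (N m) w t" "epath (N n) w t" "epath (N m) w q"]
          dist_triangle2[of "epath (N m) w q" "epath (N n) w t" "epath (N n) w q"] by linarith
      ultimately show ?thesis by linarith
    qed
    then show "\<exists>M. \<forall>m\<ge>M. \<forall>n\<ge>M. dist (epath (N m) w t) (epath (N n) w t) < e" by blast
  qed
  then show ?thesis by (simp add: Cauchy_convergent_iff)
qed

context
  fixes P :: "real \<Rightarrow> (real^'d) \<times> (real^'m^'d) \<times> (real^'d)"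
  assumes P: "\<And>t. t \<in> {0..T} \<Longrightarrow> (\<lambda>n. epath (N n) w t) \<longlonglongrightarrow> P t"
begin

section \<open>Identification of the limit path\<close>

lemma P_incr:
  obtains R where "0 \<le> R"
    "\<And>s t. s \<in> {0..T} \<Longrightarrow> t \<in> {0..T} \<Longrightarrow> norm (P t - P s) \<le> R * \<bar>t - s\<bar> powr \<gamma>"
proof (rule epath_incr)
  fix R assume R: "0 \<le> R" and inc: "\<And>n s t. s \<in> {0..T} \<Longrightarrow> t \<in> {0..T} \<Longrightarrow>
    norm (epath (N n) w t - epath (N n) w s) \<le> R * (\<bar>t - s\<bar> + T / real (N n)) powr \<gamma>"
  have "norm (P t - P s) \<le> R * \<bar>t - s\<bar> powr \<gamma>" if st: "s \<in> {0..T}" "t \<in> {0..T}" for s t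
  proof (rule LIMSEQ_le)
    show "(\<lambda>n. norm (epath (N n) w t - epath (N n) w s)) \<longlonglongrightarrow> norm (P t - P s)"
      by (intro tendsto_norm tendsto_diff P st)
    show "(\<lambda>n. R * (\<bar>t - s\<bar> + T / real (N n)) powr \<gamma>) \<longlonglongrightarrow> R * \<bar>t - s\<bar> powr \<gamma>"
      by (rule equi_lim) simp
  qed (use inc[OF st] in blast)
  then show thesis by (rule that[OF R])
qed

lemma P_0: "P 0 = 0"
proof -
  have "(\<lambda>n. epath (N n) w 0) \<longlonglongrightarrow> 0" by (simp add: epath_0)
  then show ?thesis using P[of 0] T LIMSEQ_unique by force
qed

lemma xst_P_incr:
  obtains R where "0 \<le> R"
    "\<And>s t. s \<in> {0..T} \<Longrightarrow> t \<in> {0..T} \<Longrightarrow> norm (xst (P t) - xst (P s)) \<le> R * \<bar>t - s\<bar> powr \<gamma>"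
    "\<And>s t. s \<in> {0..T} \<Longrightarrow> t \<in> {0..T} \<Longrightarrow> norm (zst (P t) - zst (P s)) \<le> R * \<bar>t - s\<bar> powr \<gamma>"
proof (rule P_incr)
  fix R assume R: "0 \<le> R" and inc: "\<And>s t. s \<in> {0..T} \<Longrightarrow> t \<in> {0..T} \<Longrightarrow> norm (P t - P s) \<le> R * \<bar>t - s\<bar> powr \<gamma>"
  obtain B where B: "0 \<le> B" "\<And>p q. norm (zst p - zst q) \<le> B * norm (p - q)" "\<And>p q. norm (xst p - xst q) \<le> B * norm (p - q)"
    using zst_xst_lipschitz by blast
  show thesis
  proof (rule that[of "B * R"])
    show "norm (xst (P t) - xst (P s)) \<le> B * R * \<bar>t - s\<bar> powr \<gamma>" if "s \<in> {0..T}" "t \<in> {0..T}" for s t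
      using order_trans[OF B(3) mult_left_mono[OF inc[OF that] B(1)]] by (simp only: mult.assoc)
    show "norm (zst (P t) - zst (P s)) \<le> B * R * \<bar>t - s\<bar> powr \<gamma>" if "s \<in> {0..T}" "t \<in> {0..T}" for s t
      using order_trans[OF B(2) mult_left_mono[OF inc[OF that] B(1)]] by (simp only: mult.assoc)
  qed (use B R in simp)
qed

lemma w_lim:
  assumes t: "t \<in> {0..T}"
  shows "(\<lambda>n. w j (gp (N n) (gidx (N n) t))) \<longlonglongrightarrow> w j t"
proof -
  have m: "gp (N n) (gidx (N n) t) \<in> {0..T}" for n
    using t by (intro gp_mem gidx_le N_pos) auto
  have "(\<lambda>n. w j (gp (N n) (gidx (N n) t)) - w j t) \<longlonglongrightarrow> 0"
  proof (rule Lim_null_comparison)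
    have "(\<lambda>n. \<bar>gp (N n) (gidx (N n) t) - t\<bar>) \<longlonglongrightarrow> \<bar>t - t\<bar>"
      using t by (intro tendsto_intros gp_lim) auto
    then have "(\<lambda>n. G * \<bar>gp (N n) (gidx (N n) t) - t\<bar> powr \<gamma>) \<longlonglongrightarrow> G * \<bar>t - t\<bar> powr \<gamma>"
      using \<gamma> by (intro tendsto_mult_left tendsto_powr') auto
    then show "(\<lambda>n. G * \<bar>gp (N n) (gidx (N n) t) - t\<bar> powr \<gamma>) \<longlonglongrightarrow> 0" by simp
  qed (use driver_holderD[OF w t m] in simp)
  then show ?thesis by (simp only: LIM_zero_iff)
qed

lemma \<sigma>_lim:
  assumes u: "u \<in> {0..T}"
  shows "(\<lambda>n. \<sigma> (gp (N n) (gidx (N n) u)) (xst (epath (N n) w u))) \<longlonglongrightarrow> \<sigma> u (xst (P u))"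
proof -
  let ?g = "\<lambda>n. gp (N n) (gidx (N n) u)" and ?x = "\<lambda>n. xst (epath (N n) w u)"
  have m: "?g n \<in> {0..T}" for n using u by (intro gp_mem gidx_le N_pos) auto
  have "(\<lambda>n. \<sigma> (?g n) (?x n) - \<sigma> u (xst (P u))) \<longlonglongrightarrow> 0"
  proof (rule Lim_null_comparison)
    have "(\<lambda>n. \<bar>?g n - u\<bar>) \<longlonglongrightarrow> \<bar>u - u\<bar>"
      using u by (intro tendsto_intros gp_lim) auto
    then have "(\<lambda>n. K * \<bar>?g n - u\<bar> powr \<nu>) \<longlonglongrightarrow> K * \<bar>u - u\<bar> powr \<nu>"
      using \<gamma> by (intro tendsto_mult_left tendsto_powr') auto
    moreover have "(\<lambda>n. K * norm (?x n - xst (P u))) \<longlonglongrightarrow> K * norm (xst (P u) - xst (P u))"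
      by (intro tendsto_intros xst_tendsto P u)
    ultimately have "(\<lambda>n. K * norm (?x n - xst (P u)) + K * \<bar>?g n - u\<bar> powr \<nu>)
        \<longlonglongrightarrow> K * norm (xst (P u) - xst (P u)) + K * \<bar>u - u\<bar> powr \<nu>" by (intro tendsto_add)
    then show "(\<lambda>n. K * norm (?x n - xst (P u)) + K * \<bar>?g n - u\<bar> powr \<nu>) \<longlonglongrightarrow> 0" by simp
    have "norm (\<sigma> (?g n) (?x n) - \<sigma> u (xst (P u))) \<le> K * norm (?x n - xst (P u)) + K * \<bar>?g n - u\<bar> powr \<nu>" for n
      using norm_triangle_ineq[of "\<sigma> (?g n) (?x n) - \<sigma> (?g n) (xst (P u))" "\<sigma> (?g n) (xst (P u)) - \<sigma> u (xst (P u))"]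
        \<sigma>_x[OF m, of n "?x n" "xst (P u)"] \<sigma>_t[OF u m, of n "xst (P u)"] by simp
    then show "\<forall>\<^sub>F n in sequentially. norm (\<sigma> (?g n) (?x n) - \<sigma> u (xst (P u))) \<le> K * norm (?x n - xst (P u)) + K * \<bar>?g n - u\<bar> powr \<nu>"
      by simp
  qed
  then show ?thesis by (simp only: LIM_zero_iff)
qed

text \<open>The left-point remainder estimate survives the limit. Moving the tag from the left end
  to any point of the interval costs a product of two \<gamma>-Hoelder increments, of order
  \<open>2 * \<gamma> > 1\<close>.\<close>

lemma limit_young:
  assumes x: "\<And>s. s \<in> {0..T} \<Longrightarrow> x s = xst (P s)" and t: "t \<in> {0..T}"
  shows "has_young_integral (\<lambda>s. \<sigma> s (x s) $ i $ j) (w j) 0 t (fst (snd (P t)) $ i $ j)"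
proof -
  let ?A = "\<lambda>t. fst (snd (P t)) $ i $ j" and ?f = "\<lambda>s. \<sigma> s (xst (P s)) $ i $ j"
  obtain C where C: "0 \<le> C" and rem: "\<And>u v. 0 \<le> u \<Longrightarrow> u \<le> v \<Longrightarrow> v \<le> T \<Longrightarrow>
      \<bar>?A v - ?A u - ?f u * (w j v - w j u)\<bar> \<le> C * (v - u) powr (1/2 + \<gamma>)"
  proof (rule epath_bounds)
    fix R C assume C: "0 \<le> C" and est: "\<And>n s t i j. 0 \<le> s \<Longrightarrow> s \<le> t \<Longrightarrow> t \<le> T \<Longrightarrow>
       \<bar>fst (snd (epath (N n) w t)) $ i $ j - fst (snd (epath (N n) w s)) $ i $ j
         - \<sigma> (gp (N n) (gidx (N n) s)) (xst (epath (N n) w s)) $ i $ j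
             * (w j (gp (N n) (gidx (N n) t)) - w j (gp (N n) (gidx (N n) s)))\<bar>
       \<le> C * (gp (N n) (gidx (N n) t) - gp (N n) (gidx (N n) s)) powr (1/2 + \<gamma>)"
    have "\<bar>?A v - ?A u - ?f u * (w j v - w j u)\<bar> \<le> C * (v - u) powr (1/2 + \<gamma>)"
      if uv: "0 \<le> u" "u \<le> v" "v \<le> T" for u v
    proof (rule LIMSEQ_le)
      have m: "u \<in> {0..T}" "v \<in> {0..T}" using uv by auto
      show "(\<lambda>n. \<bar>fst (snd (epath (N n) w v)) $ i $ j - fst (snd (epath (N n) w u)) $ i $ j
         - \<sigma> (gp (N n) (gidx (N n) u)) (xst (epath (N n) w u)) $ i $ j
             * (w j (gp (N n) (gidx (N n) v)) - w j (gp (N n) (gidx (N n) u)))\<bar>)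
         \<longlonglongrightarrow> \<bar>?A v - ?A u - ?f u * (w j v - w j u)\<bar>"
        by (intro tendsto_rabs tendsto_diff tendsto_mult tendsto_vec_nth tendsto_fst tendsto_snd P m w_lim \<sigma>_lim)
      have "(\<lambda>n. gp (N n) (gidx (N n) v) - gp (N n) (gidx (N n) u)) \<longlonglongrightarrow> v - u"
        using uv by (intro tendsto_diff gp_lim) auto
      then show "(\<lambda>n. C * (gp (N n) (gidx (N n) v) - gp (N n) (gidx (N n) u)) powr (1/2 + \<gamma>)) \<longlonglongrightarrow> C * (v - u) powr (1/2 + \<gamma>)"
        using uv \<gamma> by (intro tendsto_mult_left tendsto_powr' tendsto_const)
          (auto intro!: always_eventually gp_mono gidx_mono)
    qed (use est[OF uv] in blast)
    then show thesis by (rule that[OF C])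
  qed
  show ?thesis
  proof (rule xst_P_incr)
    fix R assume R: "0 \<le> R" and inc: "\<And>s t. s \<in> {0..T} \<Longrightarrow> t \<in> {0..T} \<Longrightarrow> norm (xst (P t) - xst (P s)) \<le> R * \<bar>t - s\<bar> powr \<gamma>"
    define F where "F = K * R + K * T powr (\<nu> - \<gamma>)"
    have F: "0 \<le> F" using K R by (simp add: F_def)
    have G: "0 \<le> G" using w by (simp add: driver_holder_def)
    \<comment> \<open>The power of \<open>T\<close> lowers the exponent \<open>2 * \<gamma>\<close>
      of the tag error to the common \<open>1/2 + \<gamma>\<close>.\<close>
    define C' where "C' = C + F * G * T powr (\<gamma> - 1/2)"
    have C': "0 \<le> C'" using C F G by (simp add: C'_def)
    have "has_young_integral (\<lambda>s. \<sigma> s (x s) $ i $ j) (w j) 0 t (?A t - ?A 0)"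
    proof (rule has_young_integralI[OF _ _ C'])
      fix u r v assume uv: "0 \<le> u" "u \<le> r" "r \<le> v" "v \<le> t"
      have m: "u \<in> {0..T}" "r \<in> {0..T}" "v \<in> {0..T}" using uv t by auto
      define d where "d = v - u"
      have d: "0 \<le> d" "d \<le> T" using uv t by (auto simp: d_def)
      have "\<bar>?f r - ?f u\<bar> \<le> norm (\<sigma> r (xst (P r)) - \<sigma> u (xst (P u)))"
        using order_trans[OF component_le_norm_cart Finite_Cartesian_Product.norm_nth_le, of "\<sigma> r (xst (P r)) - \<sigma> u (xst (P u))" i j]
        by simp
      also have "\<dots> \<le> F * \<bar>r - u\<bar> powr \<gamma>" unfolding F_def by (intro coeff_incr(1) m R inc)
      also have "\<dots> \<le> F * d powr \<gamma>" using uv F \<gamma> by (intro mult_left_mono powr_mono2) (auto simp: d_def)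
      finally have f: "\<bar>?f r - ?f u\<bar> \<le> F * d powr \<gamma>" .
      have "\<bar>w j v - w j u\<bar> \<le> G * d powr \<gamma>" using driver_holderD[OF w m(1,3), of j] uv by (simp add: d_def)
      then have "\<bar>(?f r - ?f u) * (w j v - w j u)\<bar> \<le> (F * d powr \<gamma>) * (G * d powr \<gamma>)"
        unfolding abs_mult using f F by (intro mult_mono) auto
      also have "\<dots> = F * G * (d powr (\<gamma> - 1/2) * d powr (1/2 + \<gamma>))"
        by (simp add: powr_add[symmetric])
      also have "\<dots> \<le> F * G * (T powr (\<gamma> - 1/2) * d powr (1/2 + \<gamma>))"
        using F G d \<gamma> by (intro mult_left_mono mult_right_mono powr_mono2) auto
      finally have 1: "\<bar>(?f r - ?f u) * (w j v - w j u)\<bar> \<le> F * G * T powr (\<gamma> - 1/2) * d powr (1/2 + \<gamma>)" by (simp only: mult.assoc)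
      have "?f r * (w j v - w j u) - (?A v - ?A u) =
          (?f r - ?f u) * (w j v - w j u) - (?A v - ?A u - ?f u * (w j v - w j u))" by (simp add: algebra_simps)
      then have "\<bar>?f r * (w j v - w j u) - (?A v - ?A u)\<bar> \<le>
          \<bar>(?f r - ?f u) * (w j v - w j u)\<bar> + \<bar>?A v - ?A u - ?f u * (w j v - w j u)\<bar>"
        by (simp only: abs_triangle_ineq4)
      also have "\<dots> \<le> F * G * T powr (\<gamma> - 1/2) * d powr (1/2 + \<gamma>) + C * d powr (1/2 + \<gamma>)"
        using rem[of u v] uv t unfolding d_def[symmetric] by (intro add_mono 1) auto
      also have "\<dots> = C' * d powr (1/2 + \<gamma>)" by (simp add: C'_def algebra_simps)
      finally show "\<bar>\<sigma> r (x r) $ i $ j * (w j v - w j u) - (?A v - ?A u)\<bar> \<le> C' * (v - u) powr (1/2 + \<gamma>)"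
        by (simp only: x[OF m(2)] d_def)
    qed (use t \<gamma> in auto)
    then show ?thesis by (simp add: P_0)
  qed
qed

text \<open>Dominated convergence with the bound \<open>Mb\<close>; pointwise convergence of the
  integrands comes from the Lipschitz condition in space.\<close>

lemma limit_drift:
  assumes x: "\<And>s. s \<in> {0..T} \<Longrightarrow> x s = xst (P s)" and t: "t \<in> {0..T}"
  shows "set_integrable lebesgue {0..t} (\<lambda>s. b s (x s))"
    and "fst (P t) = (LINT s:{0..t}|lebesgue. b s (x s))"
proof -
  let ?xn = "\<lambda>n s. xst (epath (N n) w s)"
  have b_lim: "(\<lambda>n. b s (?xn n s)) \<longlonglongrightarrow> b s (x s)" if s: "s \<in> {0..T}" for s
  proof -
    have "(\<lambda>n. K * norm (?xn n s - xst (P s))) \<longlonglongrightarrow> K * norm (xst (P s) - xst (P s))"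
      by (intro tendsto_intros xst_tendsto P s)
    then have "(\<lambda>n. K * norm (?xn n s - xst (P s))) \<longlonglongrightarrow> 0" by simp
    then have "(\<lambda>n. b s (?xn n s) - b s (x s)) \<longlonglongrightarrow> 0"
      by (rule Lim_null_comparison[rotated]) (use b_x[OF s] x[OF s] in simp)
    then show ?thesis by (simp only: LIM_zero_iff)
  qed
  have g_le: "gp (N n) (gidx (N n) t) \<le> t" for n using t gp_gidx(1)[OF N_pos] by auto
  have "gp (N n) (N n) = T" for n using N_pos[of n] by (simp add: gp_def)
  then have hn: "(\<lambda>s. indicator {0..<T} s *\<^sub>R b s (?xn n s)) \<in> borel_measurable lebesgue" for n
    using eD_integral(1)[OF N_pos order_refl, of n w] unfolding set_integrable_def by auto
  \<comment> \<open>Measurability of \<open>b s (x s)\<close> in \<open>s\<close> is inherited from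
    the piecewise constant paths.\<close>
  have h: "(\<lambda>s. indicator {0..<T} s *\<^sub>R b s (x s)) \<in> borel_measurable lebesgue"
  proof (rule borel_measurable_LIMSEQ_metric[OF hn])
    show "(\<lambda>n. indicator {0..<T} s *\<^sub>R b s (?xn n s)) \<longlonglongrightarrow> indicator {0..<T} s *\<^sub>R b s (x s)" for s
      using b_lim[of s] by (cases "s \<in> {0..<T}") auto
  qed
  define g where "g s = indicator {0..<t} s *\<^sub>R b s (x s)" for s
  \<comment> \<open>The domain ends at the grid point below \<open>t\<close> and so moves with
    \<open>n\<close>; the indicator makes this part of the integrand.\<close>
  define gn where "gn n s = indicator {0..<gp (N n) (gidx (N n) t)} s *\<^sub>R b s (?xn n s)" for n s
  have "(\<lambda>s. indicator {0..<t} s *\<^sub>R (indicator {0..<T} s *\<^sub>R b s (x s))) \<in> borel_measurable lebesgue"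
    by (rule borel_measurable_scaleR[OF borel_measurable_indicator h]) simp
  also have "(\<lambda>s. indicator {0..<t} s *\<^sub>R (indicator {0..<T} s *\<^sub>R b s (x s))) = g"
    using t by (auto simp: g_def fun_eq_iff indicator_def)
  finally have gm: "g \<in> borel_measurable lebesgue" .
  have gnI: "gn n \<in> borel_measurable lebesgue" for n
    using eD_integral(1)[OF N_pos gidx_le[OF N_pos], of t n w] t unfolding set_integrable_def gn_def by auto
  have gnE: "fst (epath (N n) w t) = integral\<^sup>L lebesgue (gn n)" for n
    using eD_integral(2)[OF N_pos gidx_le[OF N_pos], of t n w] t
    unfolding set_lebesgue_integral_def gn_def epath_def by auto
  have dom: "integrable lebesgue (\<lambda>s. indicator {0..<T} s * Mb)"
    using T by (intro integrable_mult_left integrable_real_indicator) auto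
  have lim: "(\<lambda>n. gn n s) \<longlonglongrightarrow> g s" for s
  proof (cases "0 \<le> s \<and> s < t")
    case True
    have "eventually (\<lambda>n. s < gp (N n) (gidx (N n) t)) sequentially"
      using t True by (intro order_tendstoD(1)[OF gp_lim]) auto
    then have "eventually (\<lambda>n. b s (?xn n s) = gn n s) sequentially"
      by eventually_elim (use True in \<open>simp add: gn_def\<close>)
    moreover have "(\<lambda>n. b s (?xn n s)) \<longlonglongrightarrow> g s" using b_lim[of s] True t by (simp add: g_def)
    ultimately show ?thesis by (rule Lim_transform_eventually[rotated])
  next
    case False
    then have "gn n s = 0" for n using g_le[of n] by (auto simp: gn_def indicator_def)
    moreover have "g s = 0" using False by (auto simp: g_def)
    ultimately show ?thesis by simp
  qed
  have bnd: "norm (gn n s) \<le> indicator {0..<T} s * Mb" for n s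
    using b_bound[of s "?xn n s"] g_le[of n] t Mb_nonneg by (auto simp: gn_def indicator_def)
  have "(\<lambda>n. integral\<^sup>L lebesgue (gn n)) \<longlonglongrightarrow> integral\<^sup>L lebesgue g"
    by (rule integral_dominated_convergence[where s=gn, OF gm gnI dom]; intro AE_I2 lim bnd)
  moreover have "(\<lambda>n. integral\<^sup>L lebesgue (gn n)) \<longlonglongrightarrow> fst (P t)"
    unfolding gnE[symmetric] by (intro tendsto_fst P t)
  ultimately have eq: "fst (P t) = integral\<^sup>L lebesgue g" using LIMSEQ_unique by blast
  have gi: "integrable lebesgue g"
    by (rule integrable_dominated_convergence[where s=gn, OF gm gnI dom]; intro AE_I2 lim bnd)
  have pt: "integrable lebesgue (\<lambda>s. indicator {t} s *\<^sub>R b t (x t))"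
    by (intro integrable_scaleR_left integrable_real_indicator) auto
  \<comment> \<open>The scheme integrates over half-open intervals, the equation over closed ones;
    the end point is a null set.\<close>
  have split: "indicator {0..t} s *\<^sub>R b s (x s) = g s + indicator {t} s *\<^sub>R b t (x t)" for s
    using t by (auto simp: g_def indicator_def)
  show "set_integrable lebesgue {0..t} (\<lambda>s. b s (x s))"
    unfolding set_integrable_def split by (rule Bochner_Integration.integrable_add[OF gi pt])
  have "(LINT s:{0..t}|lebesgue. b s (x s)) = integral\<^sup>L lebesgue g + (LINT s|lebesgue. indicator {t} s *\<^sub>R b t (x t))"
    unfolding set_lebesgue_integral_def split by (rule Bochner_Integration.integral_add[OF gi pt])
  also have "(LINT s|lebesgue. indicator {t} s *\<^sub>R b t (x t)) = 0" by simp
  finally show "fst (P t) = (LINT s:{0..t}|lebesgue. b s (x s))" using eq by simp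
qed

text \<open>Domination passes to the limit directly. For attainment, the grid times of the discrete
  maxima accumulate at some point of the compact interval, and that point attains the limiting
  maximum.\<close>

lemma limit_regulator:
  assumes t: "t \<in> {0..T}"
  shows "is_maximum (snd (snd (P t)) $ i) ((\<lambda>s. neg_part (zst (P s) $ i)) ` {0..t})"
  unfolding is_maximum_def
proof
  have neg_lim: "((\<lambda>n. neg_part (f n)) \<longlongrightarrow> neg_part l) F" if "(f \<longlongrightarrow> l) F" for f l and F :: "nat filter"
    unfolding neg_part_def using that by (intro tendsto_max tendsto_minus tendsto_const)
  have Y: "(\<lambda>n. snd (snd (epath (N n) w t)) $ i) \<longlonglongrightarrow> snd (snd (P t)) $ i"
    by (intro tendsto_vec_nth tendsto_snd P t)
  show "\<forall>a\<in>(\<lambda>s. neg_part (zst (P s) $ i)) ` {0..t}. a \<le> snd (snd (P t)) $ i"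
  proof safe
    fix s assume s: "s \<in> {0..t}"
    have "(\<lambda>n. neg_part (zst (epath (N n) w s) $ i)) \<longlonglongrightarrow> neg_part (zst (P s) $ i)"
      using s t by (intro neg_lim tendsto_vec_nth zst_tendsto P) auto
    then show "neg_part (zst (P s) $ i) \<le> snd (snd (P t)) $ i"
      by (rule LIMSEQ_le[OF _ Y]) (use s in \<open>auto simp: epath_def intro!: eY_ge gidx_mono\<close>)
  qed
  have "\<exists>p\<le>gidx (N n) t. snd (snd (epath (N n) w t)) $ i = neg_part (eZ (N n) w p $ i)" for n
    unfolding epath_def by (rule eY_attained)
  then obtain p where p: "\<And>n. p n \<le> gidx (N n) t"
    "\<And>n. snd (snd (epath (N n) w t)) $ i = neg_part (eZ (N n) w (p n) $ i)" by metis
  define s where "s n = gp (N n) (p n)" for n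
  have s: "s n \<in> {0..t}" for n
  proof -
    have "p n \<le> N n" using p(1)[of n] gidx_le[OF N_pos, of t n] t by simp
    then have "0 \<le> gp (N n) (p n)" using gp_mem[OF N_pos] by simp
    moreover have "gp (N n) (p n) \<le> t"
      using order_trans[OF gp_mono[OF p(1)] gp_gidx(1)[OF N_pos]] t by simp
    ultimately show ?thesis by (simp add: s_def)
  qed
  have sZ: "epath (N n) w (s n) = euler (N n) w (p n)" for n
    by (simp add: epath_def s_def gidx_gp[OF N_pos])
  obtain l r where l: "l \<in> {0..t}" and r: "strict_mono r" and sl: "(s \<circ> r) \<longlonglongrightarrow> l"
    using compact_Icc[of 0 t] s unfolding compact_def by metis
  have lT: "l \<in> {0..T}" "\<And>n. s n \<in> {0..T}" using l s t by fastforce+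
  obtain R where R: "0 \<le> R" and inc: "\<And>n s t. s \<in> {0..T} \<Longrightarrow> t \<in> {0..T} \<Longrightarrow>
       norm (epath (N n) w t - epath (N n) w s) \<le> R * (\<bar>t - s\<bar> + T / real (N n)) powr \<gamma>"
    using epath_incr by metis
  \<comment> \<open>Both path and time vary with \<open>n\<close>; the uniform Hoelder bound
    replaces the moving time by its limit \<open>l\<close>.\<close>
  have "(\<lambda>n. epath (N (r n)) w (s (r n)) - epath (N (r n)) w l) \<longlonglongrightarrow> 0"
  proof (rule Lim_null_comparison)
    show "\<forall>\<^sub>F n in sequentially. norm (epath (N (r n)) w (s (r n)) - epath (N (r n)) w l)
        \<le> R * (\<bar>s (r n) - l\<bar> + T / real (N (r n))) powr \<gamma>"
      using inc[OF lT(1) lT(2)] by simp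
    have "(\<lambda>n. \<bar>s (r n) - l\<bar> + T / real (N (r n))) \<longlonglongrightarrow> \<bar>l - l\<bar> + 0"
      using sl LIMSEQ_subseq_LIMSEQ[OF mesh_lim r] unfolding comp_def by (intro tendsto_intros)
    then have "(\<lambda>n. R * (\<bar>s (r n) - l\<bar> + T / real (N (r n))) powr \<gamma>) \<longlonglongrightarrow> R * (\<bar>l - l\<bar> + 0) powr \<gamma>"
      using T \<gamma> by (intro tendsto_mult_left tendsto_powr') (auto intro!: add_nonneg_nonneg always_eventually)
    then show "(\<lambda>n. R * (\<bar>s (r n) - l\<bar> + T / real (N (r n))) powr \<gamma>) \<longlonglongrightarrow> 0" by simp
  qed
  from tendsto_add[OF this LIMSEQ_subseq_LIMSEQ[OF P[OF lT(1)] r, unfolded comp_def]]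
  have "(\<lambda>n. epath (N (r n)) w (s (r n))) \<longlonglongrightarrow> P l" by simp
  then have "(\<lambda>n. neg_part (zst (epath (N (r n)) w (s (r n))) $ i)) \<longlonglongrightarrow> neg_part (zst (P l) $ i)"
    by (intro neg_lim tendsto_vec_nth zst_tendsto)
  moreover have "(\<lambda>n. neg_part (zst (epath (N (r n)) w (s (r n))) $ i)) \<longlonglongrightarrow> snd (snd (P t)) $ i"
    using LIMSEQ_subseq_LIMSEQ[OF Y r] unfolding comp_def sZ p(2) .
  ultimately have "neg_part (zst (P l) $ i) = snd (snd (P t)) $ i" by (rule LIMSEQ_unique)
  then show "snd (snd (P t)) $ i \<in> (\<lambda>s. neg_part (zst (P s) $ i)) ` {0..t}" using l by (metis imageI)
qed

lemma limit_solves: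
  assumes x: "\<And>s. s \<in> {0..T} \<Longrightarrow> x s = xst (P s)"
  shows "solves_reflected_equation T b \<sigma> x0 w x"
proof -
  have I: "set_integrable lebesgue {0..t} (\<lambda>s. b s (x s))"
      "fst (P t) = (LINT s:{0..t}|lebesgue. b s (x s))"
    and Y: "has_young_integral (\<lambda>s. \<sigma> s (x s) $ i $ j) (w j) 0 t (fst (snd (P t)) $ i $ j)"
    if t: "t \<in> {0..T}" for t i j
    using limit_drift[of x t] limit_young[of x t i j] x t by simp_all
  have Z: "unreflected_path b \<sigma> x0 w x t = zst (P t)" if t: "t \<in> {0..T}" for t
    unfolding unreflected_path_def zst_def I(2)[OF t] young_integral_eqI[OF Y[OF t]] ..
  have "solves_reflected_equation T b \<sigma> x0 w x \<longleftrightarrow>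
     (\<forall>t\<in>{0..T}. set_integrable lebesgue {0..t} (\<lambda>s. b s (x s)) \<and>
        (\<forall>i j. young_integrable (\<lambda>s. \<sigma> s (x s) $ i $ j) (w j) 0 t)) \<and>
     (\<exists>z y. (\<forall>t\<in>{0..T}. z t = unreflected_path b \<sigma> x0 w x t) \<and>
        (\<forall>t\<in>{0..T}. \<forall>i. is_maximum (y t $ i) ((\<lambda>s. neg_part (z s $ i)) ` {0..t})) \<and>
        (\<forall>t\<in>{0<..T}. x t = z t + y t))"
    by (simp only: solves_reflected_equation_def)
  moreover have "\<forall>t\<in>{0..T}. set_integrable lebesgue {0..t} (\<lambda>s. b s (x s)) \<and>
        (\<forall>i j. young_integrable (\<lambda>s. \<sigma> s (x s) $ i $ j) (w j) 0 t)"
    using I(1) Y unfolding young_integrable_def by blast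
  moreover have "\<exists>z y. (\<forall>t\<in>{0..T}. z t = unreflected_path b \<sigma> x0 w x t) \<and>
        (\<forall>t\<in>{0..T}. \<forall>i. is_maximum (y t $ i) ((\<lambda>s. neg_part (z s $ i)) ` {0..t})) \<and>
        (\<forall>t\<in>{0<..T}. x t = z t + y t)"
    by (rule exI[of _ "\<lambda>t. zst (P t)"], rule exI[of _ "\<lambda>t. snd (snd (P t))"])
      (use Z limit_regulator x in \<open>auto simp: xst_def\<close>)
  ultimately show ?thesis by blast
qed

lemma limit_holder:
  assumes x: "\<And>s. s \<in> {0..T} \<Longrightarrow> x s = xst (P s)"
  shows "\<exists>R. holder_const T \<gamma> R x"
  using xst_P_incr x unfolding holder_const_def by metis

end

end

section \<open>Existence of a measurable solution\<close>

lemma borel_measurable_vec_lambda: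
  fixes f :: "'i::finite \<Rightarrow> 'a \<Rightarrow> real"
  assumes "\<And>i. f i \<in> borel_measurable M"
  shows "(\<lambda>\<omega>. \<chi> i. f i \<omega>) \<in> borel_measurable M"
  by (rule iffD2[OF borel_measurable_euclidean_space]) (use assms in \<open>auto simp: Basis_vec_def inner_axis\<close>)

lemma lipschitz_imp_continuous:
  fixes f :: "'a::real_normed_vector \<Rightarrow> 'b::real_normed_vector"
  assumes "\<And>x y. norm (f x - f y) \<le> B * norm (x - y)"
  shows "continuous_on UNIV f"
proof -
  have "dist (f x) (f y) \<le> max B 0 * dist x y" for x y
    using assms[of x y] mult_right_mono[of B "max B 0" "norm (x - y)"] by (simp add: dist_norm)
  then show ?thesis by (intro lipschitz_on_continuous_on[of "max B 0"] lipschitz_onI) auto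
qed

text \<open>Tychonoff. With countable index this is the compact metric space holding the values of
  the scheme at a dense sequence of times.\<close>

lemma compact_product_cball:
  "compact {f :: 'i \<Rightarrow> 'b::{real_normed_vector, heine_borel}. \<forall>i. f i \<in> cball 0 r}"
proof -
  have "{f :: 'i \<Rightarrow> 'b. \<forall>i. f i \<in> cball 0 r} = PiE UNIV (\<lambda>_. cball 0 r)" by (auto simp: PiE_def)
  moreover have "compactin (product_topology (\<lambda>_. euclidean) UNIV) (PiE (UNIV :: 'i set) (\<lambda>_. cball (0 :: 'b) r))"
    unfolding compactin_PiE by simp
  ultimately show ?thesis
    by (simp add: euclidean_product_topology flip: compactin_euclidean_iff)
qed

context reflected_sde
begin

section \<open>Measurable dependence of the scheme on the driver\<close>

lemma continuous_on_xst: "continuous_on UNIV xst"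
  using zst_xst_lipschitz lipschitz_imp_continuous[of xst] by blast

lemma euler_measurable:
  assumes N: "0 < N" and W: "\<And>j t. t \<in> {0..T} \<Longrightarrow> W j t \<in> borel_measurable M"
  shows "k \<le> N \<Longrightarrow> (\<lambda>\<omega>. euler N (\<lambda>j t. W j t \<omega>) k) \<in> borel_measurable M"
proof (induction k)
  case (Suc k)
  let ?u = "gp N k" and ?v = "gp N (Suc k)"
  have kN: "k \<le> N" using Suc.prems by simp
  from gp_mem[OF N kN] gp_mem[OF N Suc.prems] gp_mono[OF le_SucI[OF order_refl], of N k]
  have uv: "?u \<in> {0..T}" "?v \<in> {0..T}" "?u \<le> ?v" by auto
  define A where "A p \<delta> = fst (snd p) + (\<chi> i j. \<sigma> ?u (xst p) $ i $ j * \<delta> $ j)"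
    for p :: "(real^'d) \<times> (real^'m^'d) \<times> (real^'d)" and \<delta> :: "real^'m"
  define D where "D p = fst p + drift ?u ?v (xst p)" for p
  \<comment> \<open>One step as a continuous function of the old state and the driver increments, so
    that measurability follows by composition.\<close>
  define H where "H p \<delta> = (D p, A p \<delta>, \<chi> i. max (snd (snd p) $ i) (neg_part (zst (D p, A p \<delta>, 0) $ i)))" for p \<delta>
  have drift: "continuous_on UNIV (drift ?u ?v)"
    using drift_lipschitz[of ?u ?v] uv by (intro lipschitz_imp_continuous) auto
  have sig: "continuous_on UNIV (\<sigma> ?u)"
    by (rule lipschitz_imp_continuous[OF \<sigma>_x[OF uv(1)]])
  note c = continuous_on_compose2[OF drift continuous_on_compose2[OF continuous_on_xst]]
    continuous_on_compose2[OF sig continuous_on_compose2[OF continuous_on_xst]]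
  have H: "continuous_on UNIV (\<lambda>q. H (fst q) (snd q))"
    unfolding H_def A_def D_def zst_def neg_part_def fst_conv snd_conv
    by (intro continuous_intros continuous_on_vec_lambda continuous_on_max continuous_on_component c subset_UNIV)
  have \<delta>: "(\<lambda>\<omega>. \<chi> j. W j ?v \<omega> - W j ?u \<omega>) \<in> borel_measurable M"
    by (intro borel_measurable_vec_lambda borel_measurable_diff W uv)
  have "(\<lambda>\<omega>. H (euler N (\<lambda>j t. W j t \<omega>) k) (\<chi> j. W j ?v \<omega> - W j ?u \<omega>)) \<in> borel_measurable M"
    by (rule borel_measurable_continuous_Pair[OF Suc.IH[OF kN] \<delta> H])
  moreover have "euler N w (Suc k) = H (euler N w k) (\<chi> j. w j ?v - w j ?u)" for w
    by (simp add: estep_def H_def A_def D_def Let_def)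
  ultimately show ?case by (simp only:)
qed simp

end

text \<open>Every path is assumed Hoelder, so that selection and limit need no exceptional set; the
  constant may depend on \<omega>.\<close>

lemma reflected_sde_solution:
  fixes M :: "'a measure" and W :: "'m::finite \<Rightarrow> real \<Rightarrow> 'a \<Rightarrow> real"
    and b :: "real \<Rightarrow> real^'d \<Rightarrow> real^'d" and \<sigma> :: "real \<Rightarrow> real^'d \<Rightarrow> real^'m^'d"
  assumes "reflected_sde T \<nu> K \<gamma> Mb Ms b \<sigma> x0" and lam: "0 < lam" "lam < \<gamma>"
    and W: "\<And>j t. t \<in> {0..T} \<Longrightarrow> W j t \<in> borel_measurable M"
    and hol: "\<And>\<omega>. \<omega> \<in> space M \<Longrightarrow> \<exists>G. reflected_sde.driver_holder T \<gamma> G (\<lambda>j t. W j t \<omega>)"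
  shows "\<exists>X \<in> measurable M (holder_borel lam 0 T).
           \<forall>\<omega>\<in>space M. solves_reflected_equation T b \<sigma> x0 (\<lambda>j t. W j t \<omega>) (X \<omega>)"
proof -
  interpret reflected_sde T \<nu> K \<gamma> Mb Ms b \<sigma> x0 by fact
  let ?w = "\<lambda>\<omega> j t. W j t \<omega>"
  \<comment> \<open>Enumerates the grid points of all meshes; the cap at \<open>T\<close> keeps the
    remaining fractions inside the interval.\<close>
  define qd where "qd i = (case prod_decode i of (a, c) \<Rightarrow> min T (T * real a / real (Suc c)))" for i :: nat
  have qd: "qd i \<in> {0..T}" for i using T by (auto simp: qd_def split: prod.split)
  have dense: "\<exists>q\<in>range qd. \<bar>t - q\<bar> < e" if t: "t \<in> {0..T}" and e: "0 < e" for t e :: real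
  proof -
    obtain c where "T / e < real c" using reals_Archimedean2 by blast
    then have "T < real c * e" using e by (simp only: pos_divide_less_eq)
    also have "\<dots> \<le> e * real (Suc c)" using e by simp
    finally have c: "T / real (Suc c) < e"
      by (simp only: pos_divide_less_eq of_nat_0_less_iff zero_less_Suc)
    have g: "gp (Suc c) (gidx (Suc c) t) \<le> t" "\<bar>gp (Suc c) (gidx (Suc c) t) - t\<bar> \<le> T / real (Suc c)"
      using gp_gidx(1)[of "Suc c" t] gp_gidx_dist[of "Suc c" t] t by auto
    have "qd (prod_encode (gidx (Suc c) t, c)) = gp (Suc c) (gidx (Suc c) t)"
      using g(1) t by (simp add: qd_def gp_def)
    then have "gp (Suc c) (gidx (Suc c) t) \<in> range qd" by (metis rangeI)
    moreover have "\<bar>t - gp (Suc c) (gidx (Suc c) t)\<bar> < e" using g(2) c by linarith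
    ultimately show ?thesis by blast
  qed
  have em: "(\<lambda>\<omega>. epath (Suc n) (?w \<omega>) t) \<in> borel_measurable M" if "t \<in> {0..T}" for n t
    unfolding epath_def using that by (intro euler_measurable W gidx_le) auto
  define f where "f n \<omega> = (\<lambda>i. epath (Suc n) (?w \<omega>) (qd i))" for n \<omega>
  have "\<exists>\<tau> :: nat \<Rightarrow> 'a \<Rightarrow> nat. (\<forall>k. \<tau> k \<in> measurable M (count_space UNIV)) \<and>
     (\<forall>\<omega>\<in>space M. strict_mono (\<lambda>k. \<tau> k \<omega>) \<and> convergent (\<lambda>k. f (\<tau> k \<omega>) \<omega>))"
  proof (rule measurable_convergent_subsequence)
    show "f n \<in> borel_measurable M" for n
      by (rule measurable_coordinatewise_then_product) (simp add: f_def em[OF qd])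
    fix \<omega> assume "\<omega> \<in> space M"
    then obtain G where G: "driver_holder G (?w \<omega>)" using hol by blast
    interpret euler_limit T \<nu> K \<gamma> Mb Ms b \<sigma> x0 G "?w \<omega>" Suc
      by unfold_locales (use G in \<open>auto intro: filterlim_Suc\<close>)
    obtain R where R: "0 \<le> R" and inc: "\<And>n s t. s \<in> {0..T} \<Longrightarrow> t \<in> {0..T} \<Longrightarrow>
        norm (epath (Suc n) (?w \<omega>) t - epath (Suc n) (?w \<omega>) s) \<le> R * (\<bar>t - s\<bar> + T / real (Suc n)) powr \<gamma>"
      using epath_incr by metis
    have "norm (epath (Suc n) (?w \<omega>) t) \<le> R * (2 * T) powr \<gamma>" if t: "t \<in> {0..T}" for n t
    proof -
      have "norm (epath (Suc n) (?w \<omega>) t) \<le> R * (\<bar>t - 0\<bar> + T / real (Suc n)) powr \<gamma>"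
        using inc[OF _ t, of 0 n] T unfolding epath_0 diff_zero by simp
      also have "\<dots> \<le> R * (2 * T) powr \<gamma>"
      proof (intro mult_left_mono powr_mono2 R)
        have "T / real (Suc n) \<le> T" using T by (simp add: divide_le_eq)
        then show "\<bar>t - 0\<bar> + T / real (Suc n) \<le> 2 * T" using t by simp
      qed (use \<gamma> T in auto)
      finally show ?thesis .
    qed
    then have "f n \<omega> \<in> {f. \<forall>i. f i \<in> cball 0 (R * (2 * T) powr \<gamma>)}" for n
      using qd unfolding f_def by (simp del: atLeastAtMost_iff)
    then show "\<exists>K. compact K \<and> (\<forall>n. f n \<omega> \<in> K)" using compact_product_cball by blast
  qed
  then obtain \<tau> :: "nat \<Rightarrow> 'a \<Rightarrow> nat" where \<tau>_all: "\<forall>k. \<tau> k \<in> measurable M (count_space UNIV)"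
    "\<forall>\<omega>\<in>space M. strict_mono (\<lambda>k. \<tau> k \<omega>) \<and> convergent (\<lambda>k. f (\<tau> k \<omega>) \<omega>)" by (elim exE conjE)
  have \<tau>: "\<And>k. \<tau> k \<in> measurable M (count_space UNIV)"
    and mono: "\<And>\<omega>. \<omega> \<in> space M \<Longrightarrow> strict_mono (\<lambda>k. \<tau> k \<omega>)"
    and conv: "\<And>\<omega>. \<omega> \<in> space M \<Longrightarrow> convergent (\<lambda>k. f (\<tau> k \<omega>) \<omega>)"
    using \<tau>_all by auto
  \<comment> \<open>\<open>lim\<close> is a fixed function of the sequence, so nothing further is
    chosen and measurability holds at each time.\<close>
  define P where "P \<omega> t = lim (\<lambda>k. epath (Suc (\<tau> k \<omega>)) (?w \<omega>) t)" for \<omega> t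
  define X where "X \<omega> = restrict (\<lambda>t. xst (P \<omega> t)) {0..T}" for \<omega>
  have X: "solves_reflected_equation T b \<sigma> x0 (?w \<omega>) (X \<omega>)" "\<exists>R. holder_const T \<gamma> R (X \<omega>)"
    if \<omega>: "\<omega> \<in> space M" for \<omega>
  proof -
    obtain G where G: "driver_holder G (?w \<omega>)" using hol[OF \<omega>] by blast
    interpret euler_limit T \<nu> K \<gamma> Mb Ms b \<sigma> x0 G "?w \<omega>" "\<lambda>k. Suc (\<tau> k \<omega>)"
    proof unfold_locales
      show "filterlim (\<lambda>k. Suc (\<tau> k \<omega>)) at_top sequentially"
        by (rule filterlim_compose[OF filterlim_Suc filterlim_subseq[OF mono[OF \<omega>]]])
    qed (use G in auto)
    obtain g where g: "(\<lambda>k. f (\<tau> k \<omega>) \<omega>) \<longlonglongrightarrow> g" using conv[OF \<omega>] unfolding convergent_def by blast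
    have cq: "convergent (\<lambda>k. epath (Suc (\<tau> k \<omega>)) (?w \<omega>) (qd i))" for i
    proof -
      have "(\<lambda>k. f (\<tau> k \<omega>) \<omega> i) \<longlonglongrightarrow> g i"
        by (rule continuous_on_tendsto_compose[OF continuous_on_product_coordinates g]) auto
      then show ?thesis unfolding f_def convergent_def by blast
    qed
    have ct: "convergent (\<lambda>k. epath (Suc (\<tau> k \<omega>)) (?w \<omega>) t)" if "t \<in> {0..T}" for t
    proof (rule epath_convergent[of "range qd"])
      show "range qd \<subseteq> {0..T}" using qd by blast
      show "convergent (\<lambda>k. epath (Suc (\<tau> k \<omega>)) (?w \<omega>) q)" if "q \<in> range qd" for q
        using that cq by blast
    qed (use dense that in auto)
    have lim: "(\<lambda>k. epath (Suc (\<tau> k \<omega>)) (?w \<omega>) t) \<longlonglongrightarrow> P \<omega> t" if "t \<in> {0..T}" for t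
      unfolding P_def using ct[OF that] by (simp only: convergent_LIMSEQ_iff)
    show "solves_reflected_equation T b \<sigma> x0 (?w \<omega>) (X \<omega>)"
      by (rule limit_solves[OF lim]) (auto simp: X_def)
    show "\<exists>R. holder_const T \<gamma> R (X \<omega>)"
      by (rule limit_holder[OF lim]) (auto simp: X_def)
  qed
  have "X \<in> measurable M (holder_borel lam 0 T)"
  proof (rule measurable_holder_borelI[OF T lam])
    fix t assume t: "t \<in> {0..T}"
    have "(\<lambda>\<omega>. epath (Suc (\<tau> k \<omega>)) (?w \<omega>) t) \<in> borel_measurable M" for k
      by (rule measurable_compose_countable[OF em[OF t] \<tau>])
    then have "(\<lambda>\<omega>. P \<omega> t) \<in> borel_measurable M" unfolding P_def by (rule borel_measurable_lim_metric)
    from measurable_compose[OF this borel_measurable_continuous_onI[OF continuous_on_xst]]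
    show "(\<lambda>\<omega>. X \<omega> t) \<in> borel_measurable M" using t by (simp add: X_def)
  qed (use X in \<open>auto simp: X_def\<close>)
  then show ?thesis using X by blast
qed

theorem theorem2p1:
  fixes M :: "'a measure"
    and T H \<nu> K0 lam :: real
    and W :: "'m::finite \<Rightarrow> real \<Rightarrow> 'a \<Rightarrow> real"
    and x0 :: "real^'d::finite"
    and \<sigma> :: "real \<Rightarrow> real^'d \<Rightarrow> real^'m^'d"
    and b :: "real \<Rightarrow> real^'d \<Rightarrow> real^'d"
  assumes "prob_space M" and "complete_measure M"
    and "T > 0" and "1/2 < H" and "H < 1"
    and "\<And>j. fractional_brownian_motion M {0..T} H (W j)"
    and "prob_space.indep_vars M (\<lambda>j. \<Pi>\<^sub>M t\<in>{0..T}. borel)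
           (\<lambda>j \<omega>. \<lambda>t\<in>{0..T}. W j t \<omega>) UNIV"
    and "\<And>i. x0 $ i > 0"
    and "bounded ((\<lambda>(t, x). \<sigma> t x) ` ({0..T} \<times> UNIV))"
    and "bounded ((\<lambda>(t, x). b t x) ` ({0..T} \<times> UNIV))"
    and "\<And>x. (\<lambda>t. b t x) \<in> borel_measurable (lebesgue_on {0..T})"
    and "\<nu> \<ge> H"
    and "\<And>t x y. t \<in> {0..T} \<Longrightarrow> norm (\<sigma> t x - \<sigma> t y) \<le> K0 * norm (x - y)"
    and "\<And>s t x. s \<in> {0..T} \<Longrightarrow> t \<in> {0..T} \<Longrightarrow>
           norm (\<sigma> t x - \<sigma> s x) \<le> K0 * \<bar>t - s\<bar> powr \<nu>"
    and "\<And>t x y. t \<in> {0..T} \<Longrightarrow> norm (b t x - b t y) \<le> K0 * norm (x - y)"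
    and "1/2 < lam" and "lam < H"
  shows "\<exists>X \<in> measurable M (holder_borel lam 0 T :: (real \<Rightarrow> real^'d) measure).
           AE \<omega> in M. solves_reflected_equation T b \<sigma> x0 (\<lambda>j t. W j t \<omega>) (X \<omega>)"
proof -
  interpret prob_space M by fact
  obtain \<gamma> where gam: "lam < \<gamma>" "\<gamma> < H" using dense[OF \<open>lam < H\<close>] by blast
  obtain Ms where Ms: "\<And>t x. t \<in> {0..T} \<Longrightarrow> norm (\<sigma> t x) \<le> Ms"
    using assms(9) unfolding bounded_iff by force
  obtain Mb where Mb: "\<And>t x. t \<in> {0..T} \<Longrightarrow> norm (b t x) \<le> Mb"
    using assms(10) unfolding bounded_iff by force
  \<comment> \<open>The locale takes a nonnegative constant, whence \<open>max K0 0\<close>.\<close>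
  have up: "a \<le> max K0 0 * c" if "a \<le> K0 * c" "0 \<le> c" for a c
    using that mult_right_mono[of K0 "max K0 0" c] by simp
  have sde: "reflected_sde T \<nu> (max K0 0) \<gamma> Mb Ms b \<sigma> x0"
  proof
    show "norm (\<sigma> t x - \<sigma> t y) \<le> max K0 0 * norm (x - y)" if "t \<in> {0..T}" for t x y
      by (rule up[OF assms(13)[OF that]]) simp
    show "norm (b t x - b t y) \<le> max K0 0 * norm (x - y)" if "t \<in> {0..T}" for t x y
      by (rule up[OF assms(15)[OF that]]) simp
    show "norm (\<sigma> t x - \<sigma> s x) \<le> max K0 0 * \<bar>t - s\<bar> powr \<nu>" if "s \<in> {0..T}" "t \<in> {0..T}" for s t x
      by (rule up[OF assms(14)[OF that]]) simp
  qed (use assms gam Ms Mb in auto)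
  then interpret reflected_sde T \<nu> "max K0 0" \<gamma> Mb Ms b \<sigma> x0 .
  have "AE \<omega> in M. \<exists>R. holder_const T \<gamma> R (\<lambda>t. W j t \<omega>)" for j
    by (rule fbm_paths_holder[OF assms(6) T]) (use gam assms in auto)
  then have "AE \<omega> in M. \<forall>j. \<exists>R. holder_const T \<gamma> R (\<lambda>t. W j t \<omega>)"
    by (simp add: AE_all_countable)
  then obtain Z where Z: "Z \<in> sets M" "emeasure M Z = 0"
    "{\<omega> \<in> space M. \<not> (\<forall>j. \<exists>R. holder_const T \<gamma> R (\<lambda>t. W j t \<omega>))} \<subseteq> Z"
    by (rule AE_E) auto
  \<comment> \<open>On the null set \<open>Z\<close> the driver becomes the zero path, Hoelder with
    constant 0; elsewhere nothing changes.\<close>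
  define V where "V j t \<omega> = indicator (space M - Z) \<omega> * W j t \<omega>" for j t \<omega>
  have "\<exists>X \<in> measurable M (holder_borel lam 0 T).
           \<forall>\<omega>\<in>space M. solves_reflected_equation T b \<sigma> x0 (\<lambda>j t. V j t \<omega>) (X \<omega>)"
  proof (rule reflected_sde_solution[OF sde])
    show "V j t \<in> borel_measurable M" if "t \<in> {0..T}" for j t
      unfolding V_def using Z(1) centered_gaussian_moment(1)[OF fbm_gaussian(1)[OF assms(6) that]]
      by (intro borel_measurable_times borel_measurable_indicator) auto
    show "\<exists>G. driver_holder G (\<lambda>j t. V j t \<omega>)" if \<omega>: "\<omega> \<in> space M" for \<omega>
    proof (cases "\<omega> \<in> Z")
      case True
      then show ?thesis by (intro exI[of _ 0]) (simp add: driver_holder_def V_def)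
    next
      case False
      then have "\<forall>j. \<exists>R. holder_const T \<gamma> R (\<lambda>t. W j t \<omega>)" using Z(3) \<omega> by blast
      then have "\<exists>R. \<forall>j. holder_const T \<gamma> (R j) (\<lambda>t. W j t \<omega>)" by (rule choice)
      then obtain R where R: "\<And>j. holder_const T \<gamma> (R j) (\<lambda>t. W j t \<omega>)" by blast
      have R0: "0 \<le> R j" for j by (rule holder_const_nonneg[OF R T])
      \<comment> \<open>The sum is a single constant valid for all of the finitely many
        components.\<close>
      have "R j \<le> (\<Sum>j\<in>UNIV. R j)" for j by (rule member_le_sum) (simp_all add: R0)
      then have "holder_const T \<gamma> (\<Sum>j\<in>UNIV. R j) (\<lambda>t. W j t \<omega>)" for j
        using holder_const_mono[OF R] by blast
      moreover have "0 \<le> (\<Sum>j\<in>UNIV. R j)" by (intro sum_nonneg R0)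
      ultimately show ?thesis
        using False \<omega> by (intro exI[of _ "\<Sum>j\<in>UNIV. R j"]) (simp add: driver_holder_def holder_const_def V_def)
    qed
  qed (use assms gam in auto)
  then obtain X where X: "X \<in> measurable M (holder_borel lam 0 T)"
    "\<And>\<omega>. \<omega> \<in> space M \<Longrightarrow> solves_reflected_equation T b \<sigma> x0 (\<lambda>j t. V j t \<omega>) (X \<omega>)" by blast
  have "AE \<omega> in M. \<omega> \<notin> Z" using Z by (intro AE_not_in) auto
  then have "AE \<omega> in M. solves_reflected_equation T b \<sigma> x0 (\<lambda>j t. W j t \<omega>) (X \<omega>)"
    using AE_space
  proof eventually_elim
    case (elim \<omega>)
    then have "(\<lambda>j t. V j t \<omega>) = (\<lambda>j t. W j t \<omega>)" by (simp add: V_def)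
    then show ?case using X(2)[of \<omega>] elim by simp
  qed
  then show ?thesis using X(1) by blast
qed

end
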